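(* Let $k\in\mathbb{Z}^+$ (and $b\in\mathbb{R}$). For any $R>0$ denote $U_R=\{u_0\in C^1:\ \|u_0\|_{C^1}\le R\}$. Then the data-to-solution map of the Cauchy problem $$u_t+u^ku_x=\mathbf{P}(u),\qquad u(0,x)=u_0(x),\qquad x\in\mathbb{R},$$ $$\mathbf{S}_t:\ U_R\to \mathcal{C}([0,T];C^1)\cap\mathcal{C}^1([0,T];C),\qquad u_0\mapsto \mathbf{S}_t(u_0),$$ is not uniformly continuous from any bounded subset $U_R$ of $C^1$ into $\mathcal{C}([0,T];C^1)$. More precisely, there exist sequences $(f_n)$, $(g_n)$ in $C^1$ and corresponding sequences of solutions $\mathbf{S}_t(f_n+g_n)$ and $\mathbf{S}_t(f_n)$ such that $$\|f_n\|_{C^1}\lesssim 1\quad\text{and}\quad \lim_{n\to\infty}\|g_n\|_{C^1}=0,$$ but $$\liminf_{n\to\infty}\|\mathbf{S}_t(f_n+g_n)-\mathbf{S}_t(f_n)\|_{C^1}\gtrsim t\qquad\text{for all } t\in(0,T_0],$$ for some small time $T_0>0$. Here the constants implicit in $\lesssim,\gtrsim$ are positive and independent of $n$ and $t$.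
   Context: $C^1=C^1(\mathbb{R})$ is the Banach space of bounded continuously differentiable functions on $\mathbb{R}$ with bounded derivative, with norm $\|f\|_{C^1}=\|f\|_{L^\infty}+\|f'\|_{L^\infty}$, $\|f\|_{L^\infty}=\sup_{x\in\mathbb{R}}|f(x)|$; $C$ is the space of bounded continuous functions with the sup norm. For a Banach space $S$, $\mathcal{C}([0,T];S)$ and $\mathcal{C}^1([0,T];S)$ are the continuous, resp. continuously differentiable, functions of time with values in $S$. The nonlocal term (generalized Camassa-Holm equation with parameters $k\in\mathbb{Z}^+$, $b\in\mathbb{R}$) is $$\mathbf{P}(u)=-\partial_x(1-\partial_x^2)^{-1}\left(\frac{b}{k+1}u^{k+1}+\frac{3k-b}{2}u^{k-1}u_x^2\right)-(1-\partial_x^2)^{-1}\left(\frac{(k-1)(b-k)}{2}u^{k-2}u_x^3\right),$$ where $(1-\partial_x^2)^{-1}f=G*f$ with $G(x)=\frac12e^{-|x|}$; for $k=1$ the last term has coefficient zero and is absent. It is known that this Cauchy problem is well-posed in $C^1$: for $u_0\in U_R$ there is a unique solution $\mathbf{S}_t(u_0)$ on a common time interval $[0,T]$ with $T=T(R)>0$. $\mathbf{S}_t(u_0)$ denotes this solution at time $t$.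
   Formalization: The solution map is taken on those data in U_R having exactly one solution on [0,T] (any T>0), as it is not defined on all of U_R: if u_0' is not uniformly continuous, e.g. u_0=A+ε∫_0^x sin(y²)dy, no solution lies in C([0,T];C^1). The f_n and f_n+g_n are in this set. *)

theory Defs
  imports "HOL-Analysis.Analysis"
begin

section \<open>The Banach space of bounded continuously differentiable functions\<close>

typedef c1fun =
  "{f :: real \<Rightarrow> real. (\<forall>x. f differentiable (at x)) \<and> continuous_on UNIV (deriv f) \<and>
      bounded (range f) \<and> bounded (range (deriv f))}"
  morphisms apply_c1fun C1fun
  by (rule exI[of _ "\<lambda>_. 0"]) (auto simp: bounded_def)

setup_lifting type_definition_c1fun

declare [[coercion "apply_c1fun :: c1fun \<Rightarrow> real \<Rightarrow> real"]]

lemma c1fun_eqI: "(\<And>x. apply_c1fun f x = apply_c1fun g x) \<Longrightarrow> f = g"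
  by transfer auto

lemma real_differentiable_imp_DERIV:
  fixes f :: "real \<Rightarrow> real"
  assumes "f differentiable (at x)"
  shows "(f has_field_derivative deriv f x) (at x)"
  using assms DERIV_deriv_iff_real_differentiable by blast

lemma c1fun_has_deriv:
  "(apply_c1fun f has_field_derivative deriv (apply_c1fun f) x) (at x)"
  using apply_c1fun[of f] by (auto intro: real_differentiable_imp_DERIV)

instantiation c1fun :: real_vector
begin

lift_definition zero_c1fun :: c1fun is "\<lambda>_. 0"
  by (auto simp: bounded_def)

lift_definition plus_c1fun :: "c1fun \<Rightarrow> c1fun \<Rightarrow> c1fun" is "\<lambda>f g x. f x + g x"
proof -
  fix f g :: "real \<Rightarrow> real"
  assume "(\<forall>x. f differentiable (at x)) \<and> continuous_on UNIV (deriv f) \<and>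
      bounded (range f) \<and> bounded (range (deriv f))"
    and "(\<forall>x. g differentiable (at x)) \<and> continuous_on UNIV (deriv g) \<and>
      bounded (range g) \<and> bounded (range (deriv g))"
  moreover from this have "deriv (\<lambda>x. f x + g x) = (\<lambda>x. deriv f x + deriv g x)"
    by (intro ext DERIV_imp_deriv DERIV_add real_differentiable_imp_DERIV) auto
  ultimately show "(\<forall>x. (\<lambda>x. f x + g x) differentiable (at x)) \<and>
      continuous_on UNIV (deriv (\<lambda>x. f x + g x)) \<and>
      bounded (range (\<lambda>x. f x + g x)) \<and> bounded (range (deriv (\<lambda>x. f x + g x)))"
    by (auto intro!: continuous_intros bounded_plus_comp)
qed

lift_definition scaleR_c1fun :: "real \<Rightarrow> c1fun \<Rightarrow> c1fun" is "\<lambda>a f x. a * f x"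
proof -
  fix a :: real and f :: "real \<Rightarrow> real"
  assume f: "(\<forall>x. f differentiable (at x)) \<and> continuous_on UNIV (deriv f) \<and>
      bounded (range f) \<and> bounded (range (deriv f))"
  then have "deriv (\<lambda>x. a * f x) = (\<lambda>x. a * deriv f x)"
    by (intro ext DERIV_imp_deriv DERIV_cmult real_differentiable_imp_DERIV) auto
  with f show "(\<forall>x. (\<lambda>x. a * f x) differentiable (at x)) \<and>
      continuous_on UNIV (deriv (\<lambda>x. a * f x)) \<and>
      bounded (range (\<lambda>x. a * f x)) \<and> bounded (range (deriv (\<lambda>x. a * f x)))"
    using bounded_scaleR_comp[of f UNIV a] bounded_scaleR_comp[of "deriv f" UNIV a]
    by (auto intro!: continuous_intros derivative_intros)
qed

definition uminus_c1fun :: "c1fun \<Rightarrow> c1fun"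
  where "uminus_c1fun f = (-1) *\<^sub>R f"

definition minus_c1fun :: "c1fun \<Rightarrow> c1fun \<Rightarrow> c1fun"
  where "minus_c1fun f g = f + (-1) *\<^sub>R g"

lemmas [simp] = zero_c1fun.rep_eq plus_c1fun.rep_eq scaleR_c1fun.rep_eq

instance
  by standard (auto intro!: c1fun_eqI simp: uminus_c1fun_def minus_c1fun_def algebra_simps)

end

definition c1_val :: "c1fun \<Rightarrow> (real \<Rightarrow>\<^sub>C real)"
  where "c1_val f = Bcontfun (apply_c1fun f)"

definition c1_deriv :: "c1fun \<Rightarrow> (real \<Rightarrow>\<^sub>C real)"
  where "c1_deriv f = Bcontfun (deriv (apply_c1fun f))"

lemma apply_c1_val: "apply_bcontfun (c1_val f) = apply_c1fun f"
proof -
  have "continuous_on UNIV (apply_c1fun f)"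
    using c1fun_has_deriv[of f] by (auto intro: DERIV_continuous_on has_field_derivative_at_within)
  then have "apply_c1fun f \<in> bcontfun"
    using apply_c1fun[of f] by (auto simp: bcontfun_def)
  then show ?thesis
    unfolding c1_val_def by (rule Bcontfun_inverse)
qed

lemma apply_c1_deriv: "apply_bcontfun (c1_deriv f) = deriv (apply_c1fun f)"
proof -
  have "deriv (apply_c1fun f) \<in> bcontfun"
    using apply_c1fun[of f] by (auto simp: bcontfun_def)
  then show ?thesis
    unfolding c1_deriv_def by (rule Bcontfun_inverse)
qed

lemma c1_val_add: "c1_val (f + g) = c1_val f + c1_val g"
  by (rule bcontfun_eqI) (simp add: apply_c1_val)

lemma c1_val_scaleR: "c1_val (a *\<^sub>R f) = a *\<^sub>R c1_val f"
  by (rule bcontfun_eqI) (simp add: apply_c1_val)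

lemma c1_deriv_add: "c1_deriv (f + g) = c1_deriv f + c1_deriv g"
proof (rule bcontfun_eqI)
  fix x
  have "((\<lambda>x. f x + g x) has_field_derivative deriv f x + deriv g x) (at x)"
    by (intro DERIV_add c1fun_has_deriv)
  moreover have "apply_c1fun (f + g) = (\<lambda>x. f x + g x)"
    by auto
  ultimately show "c1_deriv (f + g) x = (c1_deriv f + c1_deriv g) x"
    by (auto simp: apply_c1_deriv dest: DERIV_imp_deriv)
qed

lemma c1_deriv_scaleR: "c1_deriv (a *\<^sub>R f) = a *\<^sub>R c1_deriv f"
proof (rule bcontfun_eqI)
  fix x
  have "((\<lambda>x. a * f x) has_field_derivative a * deriv f x) (at x)"
    by (intro DERIV_cmult c1fun_has_deriv)
  moreover have "apply_c1fun (a *\<^sub>R f) = (\<lambda>x. a * f x)"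
    by auto
  ultimately show "c1_deriv (a *\<^sub>R f) x = (a *\<^sub>R c1_deriv f) x"
    by (auto simp: apply_c1_deriv dest: DERIV_imp_deriv)
qed

lemma norm_bcontfun_eq_SUP:
  fixes f :: "real \<Rightarrow>\<^sub>C real"
  shows "norm f = (SUP x. \<bar>f x\<bar>)"
  by (simp add: norm_bcontfun_def dist_bcontfun_def dist_norm)

instantiation c1fun :: real_normed_vector
begin

definition norm_c1fun :: "c1fun \<Rightarrow> real"
  where "norm_c1fun f = (SUP x. \<bar>f x\<bar>) + (SUP x. \<bar>deriv f x\<bar>)"

definition dist_c1fun :: "c1fun \<Rightarrow> c1fun \<Rightarrow> real"
  where "dist_c1fun f g = norm (f - g)"

definition sgn_c1fun :: "c1fun \<Rightarrow> c1fun"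
  where "sgn_c1fun f = f /\<^sub>R norm f"

definition uniformity_c1fun :: "(c1fun \<times> c1fun) filter"
  where "uniformity_c1fun = (INF e\<in>{0 <..}. principal {(x, y). dist x y < e})"

definition open_c1fun :: "c1fun set \<Rightarrow> bool"
  where "open_c1fun S = (\<forall>x\<in>S. \<forall>\<^sub>F (x', y) in uniformity. x' = x \<longrightarrow> y \<in> S)"

lemma norm_c1fun_eq: "norm f = norm (c1_val f) + norm (c1_deriv f)" for f :: c1fun
  by (simp add: norm_c1fun_def norm_bcontfun_eq_SUP apply_c1_val apply_c1_deriv)

instance
proof
  fix f g :: c1fun and a :: real
  show "norm f = 0 \<longleftrightarrow> f = 0"
  proof
    assume "norm f = 0"
    then have "norm (c1_val f) = 0"
      unfolding norm_c1fun_eq by (smt (verit) norm_ge_zero)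
    then have "c1_val f = 0" by simp
    then show "f = 0"
      by (metis apply_c1_val c1fun_eqI zero_bcontfun.rep_eq zero_c1fun.rep_eq)
  next
    assume "f = 0"
    then show "norm f = 0"
      using c1_val_scaleR[of 0 f] c1_deriv_scaleR[of 0 f] by (simp add: norm_c1fun_eq)
  qed
  show "norm (f + g) \<le> norm f + norm g"
    using norm_triangle_ineq[of "c1_val f" "c1_val g"]
      norm_triangle_ineq[of "c1_deriv f" "c1_deriv g"]
    by (simp add: norm_c1fun_eq c1_val_add c1_deriv_add)
  show "norm (a *\<^sub>R f) = \<bar>a\<bar> * norm f"
    by (simp add: norm_c1fun_eq c1_val_scaleR c1_deriv_scaleR algebra_simps)
qed (simp_all add: dist_c1fun_def sgn_c1fun_def uniformity_c1fun_def open_c1fun_def)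

end

section \<open>The generalized Camassa--Holm equation\<close>

definition helmholtz_inv :: "(real \<Rightarrow> real) \<Rightarrow> real \<Rightarrow> real"
  where "helmholtz_inv f x = (LINT y|lborel. 1/2 * exp (- \<bar>x - y\<bar>) * f y)"

text \<open>
  For \<open>k = 1\<close> the exponent \<open>k - 2\<close> is truncated subtraction on \<^typ>\<open>nat\<close>; this is harmless, since
  the term carries the coefficient \<open>real k - 1 = 0\<close>.
\<close>

definition nonlocal_P :: "nat \<Rightarrow> real \<Rightarrow> c1fun \<Rightarrow> real \<Rightarrow> real"
  where "nonlocal_P k b u x =
    - deriv (helmholtz_inv (\<lambda>y. b / (real k + 1) * u y ^ (k + 1)
        + (3 * real k - b) / 2 * u y ^ (k - 1) * (deriv u y)\<^sup>2)) x
    - helmholtz_inv (\<lambda>y. (real k - 1) * (b - real k) / 2 * u y ^ (k - 2) * (deriv u y) ^ 3) x"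

text \<open>
  The metric space \<open>C([0,T]; C\<^sup>1)\<close> with the distance \<open>sup\<^sub>t \<parallel>u(t) - v(t)\<parallel>\<close>.  Its elements are
  functions on \<^typ>\<open>real\<close> that are \<^term>\<open>undefined\<close> outside \<open>[0,T]\<close>.
\<close>

definition CT_C1 :: "real \<Rightarrow> (real \<Rightarrow> c1fun) metric"
  where "CT_C1 T = cfunspace (top_of_set {0..T}) euclidean_metric"

text \<open>
  \<open>u\<close> is a solution in \<open>C([0,T]; C\<^sup>1) \<inter> C\<^sup>1([0,T]; C)\<close>: the time derivative \<open>v\<close> is taken in the
  sup norm, and one-sidedly at the endpoints of \<open>[0,T]\<close>.
\<close>

definition gch_solution :: "nat \<Rightarrow> real \<Rightarrow> real \<Rightarrow> c1fun \<Rightarrow> (real \<Rightarrow> c1fun) \<Rightarrow> bool"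
  where "gch_solution k b T u0 u \<longleftrightarrow>
    u \<in> mspace (CT_C1 T) \<and> u 0 = u0 \<and>
    (\<exists>v :: real \<Rightarrow> (real \<Rightarrow>\<^sub>C real). continuous_on {0..T} v \<and>
      (\<forall>t\<in>{0..T}. ((\<lambda>s. c1_val (u s)) has_vector_derivative v t) (at t within {0..T}) \<and>
        (\<forall>x. v t x + u t x ^ k * deriv (u t) x = nonlocal_P k b (u t) x)))"

text \<open>
  The data to solution map is defined on the initial data that have a unique solution on \<open>[0,T]\<close>.
  On the real line this cannot be all of a ball of \<open>C\<^sup>1\<close>: if the derivative of the datum is not
  uniformly continuous, transport may destroy the continuity of \<open>t \<mapsto> u(t)\<close> in the \<open>C\<^sup>1\<close> norm, as
  for a datum that is a nonzero constant plus a small primitive of \<open>sin (x\<^sup>2)\<close>.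
\<close>

definition gch_data :: "nat \<Rightarrow> real \<Rightarrow> real \<Rightarrow> c1fun set"
  where "gch_data k b T = {u0. \<exists>!u. gch_solution k b T u0 u}"

definition gch_flow :: "nat \<Rightarrow> real \<Rightarrow> real \<Rightarrow> c1fun \<Rightarrow> real \<Rightarrow> c1fun"
  where "gch_flow k b T u0 = (THE u. gch_solution k b T u0 u)"

definition gch_ball :: "nat \<Rightarrow> real \<Rightarrow> real \<Rightarrow> real \<Rightarrow> c1fun set"
  where "gch_ball k b T R = {u0 \<in> gch_data k b T. norm u0 \<le> R}"

text \<open>
  The library predicate \<^const>\<open>uniformly_continuous_map\<close> includes that the map sends the source into the
  target space; the following fact shows that its negation is never due to that clause.
\<close>

lemma gch_flow_maps:
  "gch_flow k b T \<in> mspace (submetric euclidean_metric (gch_ball k b T R)) \<rightarrow> mspace (CT_C1 T)"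
proof -
  have "gch_solution k b T u0 (gch_flow k b T u0)" if "u0 \<in> gch_data k b T" for u0
    using that theI'[of "gch_solution k b T u0"] unfolding gch_data_def gch_flow_def by simp
  then show ?thesis
    by (auto simp: gch_ball_def gch_solution_def)
qed

end

theory Submission
  imports Defs
begin

text \<open>
  If \<open>u(t, x)\<close> solves the equation, so does \<open>a u(a\<^sup>k t, x)\<close>. A travelling wave \<open>\<phi>(x - t)\<close> therefore yields
  the solutions \<open>\<epsilon> \<phi>(x - \<epsilon>\<^sup>k t)\<close> and \<open>\<epsilon> (1 + \<delta>) \<phi>(x - \<epsilon>\<^sup>k (1 + \<delta>)\<^sup>k t)\<close>, whose data differ by \<open>O(\<delta>)\<close> and which
  drift apart by at least \<open>\<epsilon>\<^sup>k k \<delta> t\<close>. For every \<open>k\<close> and \<open>b\<close> there are waves, bounded in \<open>C\<^sup>1\<close>, whose slope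
  changes by a fixed amount on an arbitrarily small scale \<open>\<eta>\<close>. With \<open>\<delta> = \<eta>\<close> the drift changes the slope by
  an amount of order \<open>t\<close>.

  The profiles are orbits of an oscillator \<open>\<phi>'\<^sup>2 = Q(\<phi>)\<close>. For \<open>0 < b < k\<close> they are not \<open>C\<^sup>1\<^sup>,\<^sup>1\<close>, but \<open>\<phi>'\<close> has
  locally bounded variation. This is enough for uniqueness: the difference of two solutions is
  transported along characteristics and estimated in \<open>L\<^sup>\<infinity>\<close> together with the local \<open>L\<^sup>1\<close> norm of its derivative.
\<close>

section \<open>Periodic orbits of one-dimensional oscillators\<close>

text \<open>With one fixed profile nothing is lost: its slope is uniformly continuous, so translates
  by a drift tending to 0 converge in C^1. The slope has to vary on the scale of the drift itself.
  Exact waves need no error estimate in time, but the flow is a definite description, so each datum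
  must be shown to have no second solution whatsoever.

  With the speed normalised to 1 the transport coefficient \<open>f ^ k - 1\<close> degenerates at
  the level 1. The wave equation makes the momentum density f - f'' proportional to a power -b/k of
  the distance of \<open>f ^ k\<close> from 1, and the fast change of slope is produced at this
  level. Integrability of that power decides the shape: for \<open>b >= k\<close> the orbit is
  repelled just below 1, for \<open>b < k\<close> it passes through 1 back and forth. The strength
  \<open>A\<close> of the density is the free parameter.

  The lower bound comes from a walk. The slope changes from 0 to size 1/4 over a distance of order
  \<eta>; the drift is of order t \<eta>; so about 1/t steps of drift length cover the distance, and
  one of them changes the slope by a multiple of t.\<close>

lemma continuous_real_antiderivative:
  fixes f :: "real \<Rightarrow> real"
  assumes "continuous_on UNIV f"
  obtains F where "\<And>x. DERIV F x :> f x"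
proof -
  have "isCont f x" for x
    using assms by (simp add: continuous_on_eq_continuous_at)
  then have "\<exists>F. \<forall>x::real. -\<infinity> < ereal x \<longrightarrow> ereal x < \<infinity> \<longrightarrow> (F has_vector_derivative f x) (at x)"
    by (intro einterval_antiderivative) auto
  then show ?thesis
    using that by (auto simp: has_real_derivative_iff_has_vector_derivative)
qed

text \<open>Meant for points where the second factor is merely continuous: the turning points of an
  oscillator, and the points where a wave crosses the level 1.\<close>

lemma DERIV_mult_zero:
  fixes f g :: "real \<Rightarrow> real"
  assumes "(f has_field_derivative d) (at x within S)" "f x = 0"
    and "continuous (at x within S) g"
  shows "((\<lambda>y. f y * g y) has_field_derivative d * g x) (at x within S)"
proof -
  have "((\<lambda>y. (f y - f x) / (y - x) * g y) \<longlongrightarrow> d * g x) (at x within S)"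
    using assms by (intro tendsto_mult)
      (auto simp: has_field_derivative_iff continuous_within)
  then show ?thesis
    using assms(2) by (simp add: has_field_derivative_iff)
qed

lemma DERIV_bound_imp_lipschitz:
  fixes f :: "real \<Rightarrow> real"
  assumes "\<And>x. DERIV f x :> f' x" "\<And>x. \<bar>f' x\<bar> \<le> B"
  shows "\<bar>f x - f y\<bar> \<le> B * \<bar>x - y\<bar>"
  using field_differentiable_bound[of UNIV f f' B x y] assms by auto

text \<open>
  The two simple zeros of \<open>Q\<close> are divided out: \<open>Q y = (y - \<alpha>) * (\<beta> - y) * \<kappa> y\<close> with \<open>\<kappa> > 0\<close>.
  Substituting \<open>\<phi> = m + r * sin \<theta>\<close> turns \<open>\<phi>'\<^sup>2 = Q(\<phi>)\<close> into \<open>\<theta>' = sqrt (\<kappa> (m + r * sin \<theta>))\<close>, which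
  is regular across the turning points.
\<close>

lemma oscillator:
  fixes Q :: "real \<Rightarrow> real"
  assumes "\<alpha> < \<beta>" and contQ: "continuous_on {\<alpha>..\<beta>} Q"
    and Q0: "Q \<alpha> = 0" "Q \<beta> = 0" and Qpos: "\<And>y. \<alpha> < y \<Longrightarrow> y < \<beta> \<Longrightarrow> 0 < Q y"
    and qa: "(Q has_real_derivative qa) (at \<alpha> within {\<alpha>..\<beta>})" "qa > 0"
    and qb: "(Q has_real_derivative qb) (at \<beta> within {\<alpha>..\<beta>})" "qb < 0"
  obtains \<phi> \<psi> where "\<And>x. DERIV \<phi> x :> \<psi> x" "uniformly_continuous_on UNIV \<psi>"
    "\<And>x. \<phi> x \<in> {\<alpha>..\<beta>}" "\<And>x. (\<psi> x)\<^sup>2 = Q (\<phi> x)" "\<phi> 0 = \<beta>"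
    "\<And>x q. (Q has_real_derivative q) (at (\<phi> x) within {\<alpha>..\<beta>}) \<Longrightarrow> DERIV \<psi> x :> q / 2"
proof -
  define r where "r = (\<beta> - \<alpha>) / 2"
  define m where "m = (\<alpha> + \<beta>) / 2"
  have r: "r > 0" and mr: "m - r = \<alpha>" "m + r = \<beta>"
    using \<open>\<alpha> < \<beta>\<close> by (auto simp: r_def m_def field_simps)
  \<comment> \<open>The end values are the limits of the quotient, read off from the one-sided
    derivatives of \<open>Q\<close>; their signs make \<open>\<kappa>\<close> positive up to the
    ends.\<close>
  define \<kappa> where "\<kappa> y = (if y = \<alpha> then qa / (\<beta> - \<alpha>) else if y = \<beta> then - qb / (\<beta> - \<alpha>)
      else Q y / ((y - \<alpha>) * (\<beta> - y)))" for y
  have \<kappa>pos: "\<kappa> y > 0" if "y \<in> {\<alpha>..\<beta>}" for y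
    using that \<open>\<alpha> < \<beta>\<close> qa(2) qb(2) Qpos[of y] by (auto simp: \<kappa>_def intro: divide_neg_pos)
  have Q\<kappa>: "Q y = (y - \<alpha>) * (\<beta> - y) * \<kappa> y" for y
    using Q0 by (auto simp: \<kappa>_def)
  have "continuous_on {\<alpha>..\<beta>} \<kappa>"
    unfolding continuous_on_eq_continuous_within
  proof
    fix y assume y: "y \<in> {\<alpha>..\<beta>}"
    consider "y = \<alpha>" | "y = \<beta>" | "y \<in> {\<alpha><..<\<beta>}"
      using y by force
    then show "continuous (at y within {\<alpha>..\<beta>}) \<kappa>"
    proof cases
      case 1
      have "((\<lambda>z. (Q z - Q \<alpha>) / (z - \<alpha>) / (\<beta> - z)) \<longlongrightarrow> qa / (\<beta> - \<alpha>)) (at \<alpha> within {\<alpha>..\<beta>})"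
        using qa(1) \<open>\<alpha> < \<beta>\<close> by (intro tendsto_divide tendsto_diff tendsto_const tendsto_ident_at)
          (auto simp: has_field_derivative_iff)
      moreover have "\<forall>\<^sub>F z in at \<alpha> within {\<alpha>..\<beta>}. (Q z - Q \<alpha>) / (z - \<alpha>) / (\<beta> - z) = \<kappa> z"
        unfolding eventually_at using Q0 by (intro exI[of _ "\<beta> - \<alpha>"]) (use \<open>\<alpha> < \<beta>\<close> in \<open>auto simp: \<kappa>_def dist_real_def\<close>)
      ultimately have "(\<kappa> \<longlongrightarrow> qa / (\<beta> - \<alpha>)) (at \<alpha> within {\<alpha>..\<beta>})"
        by (rule Lim_transform_eventually)
      then show ?thesis using 1 by (simp add: continuous_within \<kappa>_def)
    next
      case 2
      have "((\<lambda>z. - ((Q z - Q \<beta>) / (z - \<beta>)) / (z - \<alpha>)) \<longlongrightarrow> - qb / (\<beta> - \<alpha>)) (at \<beta> within {\<alpha>..\<beta>})"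
        using qb(1) \<open>\<alpha> < \<beta>\<close> by (intro tendsto_divide tendsto_diff tendsto_const tendsto_ident_at tendsto_minus)
          (auto simp: has_field_derivative_iff)
      moreover have "\<forall>\<^sub>F z in at \<beta> within {\<alpha>..\<beta>}. - ((Q z - Q \<beta>) / (z - \<beta>)) / (z - \<alpha>) = \<kappa> z"
        unfolding eventually_at using Q0
        by (intro exI[of _ "\<beta> - \<alpha>"]) (use \<open>\<alpha> < \<beta>\<close> in \<open>auto simp: \<kappa>_def dist_real_def divide_simps\<close>, simp add: algebra_simps)
      ultimately have "(\<kappa> \<longlongrightarrow> - qb / (\<beta> - \<alpha>)) (at \<beta> within {\<alpha>..\<beta>})"
        by (rule Lim_transform_eventually)
      then show ?thesis using 2 \<open>\<alpha> < \<beta>\<close> by (simp add: continuous_within \<kappa>_def)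
    next
      case 3
      have "continuous_on {\<alpha><..<\<beta>} (\<lambda>y. Q y / ((y - \<alpha>) * (\<beta> - y)))"
        by (intro continuous_intros continuous_on_subset[OF contQ]) auto
      then have "continuous_on {\<alpha><..<\<beta>} \<kappa>"
        by (rule continuous_on_eq) (auto simp: \<kappa>_def)
      then have "isCont \<kappa> y"
        using 3 by (simp add: continuous_on_eq_continuous_at)
      then show ?thesis
        by (rule continuous_at_imp_continuous_at_within)
    qed
  qed
  then have contK: "continuous_on {\<alpha>..\<beta>} (\<lambda>y. sqrt (\<kappa> y))"
    by (intro continuous_intros)
  define Y where "Y \<theta> = m + r * sin \<theta>" for \<theta>
  have Y: "Y \<theta> \<in> {\<alpha>..\<beta>}" for \<theta>
    using mult_left_mono[OF sin_ge_minus_one[of \<theta>], of r] mult_left_mono[OF sin_le_one[of \<theta>], of r] r mr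
    by (auto simp: Y_def)
  have contY: "continuous_on S Y" for S
    unfolding Y_def by (intro continuous_intros)
  have contKY: "continuous_on S (\<lambda>\<theta>. sqrt (\<kappa> (Y \<theta>)))" for S
    using Y by (intro continuous_on_compose2[OF contK contY]) auto
  have KYpos: "sqrt (\<kappa> (Y \<theta>)) > 0" for \<theta>
    using \<kappa>pos[OF Y] by simp
  have "{\<alpha>..\<beta>} \<noteq> {}" using \<open>\<alpha> < \<beta>\<close> by simp
  then obtain y1 where y1: "\<And>y. y \<in> {\<alpha>..\<beta>} \<Longrightarrow> sqrt (\<kappa> y) \<le> y1"
    using continuous_attains_sup[OF compact_Icc _ contK] by blast
  define c where "c = max 1 y1"
  have c: "sqrt (\<kappa> (Y \<theta>)) \<le> c" "c > 0" for \<theta>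
    using y1[OF Y[of \<theta>]] by (auto simp: c_def)
  \<comment> \<open>Time as a function of the angle is obtained by integrating
    \<open>1 / \<theta>'\<close>; the angle is its inverse function. Shifting by the value at
    \<open>pi / 2\<close> puts the crest at time 0.\<close>
  obtain X0 where X0: "\<And>\<theta>. DERIV X0 \<theta> :> inverse (sqrt (\<kappa> (Y \<theta>)))"
    using continuous_real_antiderivative[of "\<lambda>\<theta>. inverse (sqrt (\<kappa> (Y \<theta>)))"]
      contKY[of UNIV] KYpos by (metis continuous_on_inverse less_irrefl)
  define X where "X \<theta> = X0 \<theta> - X0 (pi / 2)" for \<theta>
  have X: "DERIV X \<theta> :> inverse (sqrt (\<kappa> (Y \<theta>)))" for \<theta>
    unfolding X_def by (auto intro!: derivative_eq_intros X0)
  have invc: "inverse c \<le> inverse (sqrt (\<kappa> (Y \<theta>)))" for \<theta>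
    using c(1) KYpos by (intro le_imp_inverse_le)
  \<comment> \<open>The angular speed is at most \<open>c\<close>, so time grows at least linearly
    in the angle. Hence \<open>X\<close> is onto and the orbit exists for all times.\<close>
  have growth: "inverse c * (b - a) \<le> X b - X a" if "a \<le> b" for a b
  proof (cases "a = b")
    case False
    with that obtain z where "X b - X a = (b - a) * inverse (sqrt (\<kappa> (Y z)))"
      using MVT2[of a b X, OF _ X] by force
    then show ?thesis
      using mult_left_mono[OF invc[of z], of "b - a"] that by (simp add: mult.commute)
  qed simp
  have inj: "X a < X b" if "a < b" for a b
  proof -
    have "0 < inverse c * (b - a)"
      using that \<open>c > 0\<close> by simp
    then show ?thesis using growth[of a b] that by simp
  qed
  have contX: "continuous_on S X" for S
    by (rule DERIV_continuous_on[OF has_field_derivative_at_within[OF X]])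
  have "\<exists>\<theta>. X \<theta> = x" for x
  proof -
    define d where "d = c * (\<bar>x - X 0\<bar>)"
    have d: "d \<ge> 0" "inverse c * d = \<bar>x - X 0\<bar>"
      using \<open>c > 0\<close> by (auto simp: d_def)
    then have "X (- d) \<le> x" "x \<le> X d"
      using growth[of 0 d] growth[of "-d" 0] by auto
    moreover have "- d \<le> d" using d(1) by simp
    ultimately obtain \<theta> where "X \<theta> = x"
      using IVT'[of X "-d" x d, OF _ _ _ contX] by blast
    then show ?thesis by blast
  qed
  then obtain \<Theta> where \<Theta>: "\<And>x. X (\<Theta> x) = x"
    by metis
  have \<Theta>': "\<Theta> (X \<theta>) = \<theta>" for \<theta>
    using \<Theta>[of "X \<theta>"] inj by (metis linorder_neq_iff)
  have cont\<Theta>: "isCont \<Theta> x" for x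
  proof -
    have "isCont \<Theta> (X (\<Theta> x))"
      by (rule isCont_inverse_function[of 1]) (use X DERIV_isCont \<Theta>' in auto)
    then show ?thesis by (simp add: \<Theta>)
  qed
  have D\<Theta>: "DERIV \<Theta> x :> sqrt (\<kappa> (Y (\<Theta> x)))" for x
    using DERIV_inverse_function[of X "inverse (sqrt (\<kappa> (Y (\<Theta> x))))" \<Theta> x "x - 1" "x + 1"]
      X[of "\<Theta> x"] KYpos[of "\<Theta> x"] \<Theta> cont\<Theta> by (auto simp: less_imp_neq)
  define \<phi> where "\<phi> x = Y (\<Theta> x)" for x
  define \<psi> where "\<psi> x = r * cos (\<Theta> x) * sqrt (\<kappa> (\<phi> x))" for x
  have D\<phi>: "DERIV \<phi> x :> \<psi> x" for x
    using D\<Theta>[of x] unfolding \<phi>_def \<psi>_def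
    by (auto intro!: derivative_eq_intros simp: Y_def[abs_def])
  have \<phi>: "\<phi> x \<in> {\<alpha>..\<beta>}" for x
    unfolding \<phi>_def by (rule Y)
  have ab: "(\<phi> x - \<alpha>) * (\<beta> - \<phi> x) = (r * cos (\<Theta> x))\<^sup>2" for x
    unfolding \<phi>_def Y_def mr[symmetric] cos_squared_eq power_mult_distrib
    by (simp add: algebra_simps power2_eq_square)
  have sq: "(\<psi> x)\<^sup>2 = Q (\<phi> x)" for x
    using \<kappa>pos[OF \<phi>[of x]] by (simp add: \<psi>_def Q\<kappa> ab power_mult_distrib)
  have uc: "uniformly_continuous_on UNIV \<psi>"
  proof -
    have lip: "B-lipschitz_on UNIV f" if "\<And>x. DERIV f x :> f' x" "\<And>x. \<bar>f' x\<bar> \<le> B" "B \<ge> 0"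
      for f f' :: "real \<Rightarrow> real" and B
      using DERIV_bound_imp_lipschitz[of f f' B] that by (intro lipschitz_onI) (auto simp: dist_real_def)
    have "c-lipschitz_on UNIV (\<lambda>x. cos (\<Theta> x))"
    proof (rule lip)
      show "DERIV (\<lambda>x. cos (\<Theta> x)) x :> - sin (\<Theta> x) * sqrt (\<kappa> (\<phi> x))" for x
        using D\<Theta>[of x] by (auto intro!: derivative_eq_intros simp: \<phi>_def)
      have "\<bar>sin (\<Theta> x)\<bar> * \<bar>sqrt (\<kappa> (\<phi> x))\<bar> \<le> 1 * c" for x
        using c(1)[of "\<Theta> x"] KYpos[of "\<Theta> x"] by (intro mult_mono) (auto simp: \<phi>_def)
      then show "\<bar>- sin (\<Theta> x) * sqrt (\<kappa> (\<phi> x))\<bar> \<le> c" for x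
        by (simp add: abs_mult)
    qed (use c in simp)
    moreover have "(r * c)-lipschitz_on UNIV \<phi>"
    proof (rule lip[OF D\<phi>])
      have "r * \<bar>cos (\<Theta> x)\<bar> * \<bar>sqrt (\<kappa> (\<phi> x))\<bar> \<le> (r * 1) * c" for x
        using c(1)[of "\<Theta> x"] KYpos[of "\<Theta> x"] r by (intro mult_mono) (auto simp: \<phi>_def)
      then show "\<bar>\<psi> x\<bar> \<le> r * c" for x
        using r by (simp add: \<psi>_def abs_mult)
    qed (use c r in simp)
    ultimately have u1: "uniformly_continuous_on UNIV (\<lambda>x. (cos (\<Theta> x), \<phi> x))"
      using lipschitz_on_Pair lipschitz_on_uniformly_continuous by blast
    \<comment> \<open>The square root of \<open>\<kappa>\<close> need not be Lipschitz. The slope is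
      therefore written as a function continuous on a compact rectangle, composed with a Lipschitz
      curve.\<close>
    let ?g = "\<lambda>p. r * fst p * sqrt (\<kappa> (snd p))"
    have "continuous_on ({-1..1} \<times> {\<alpha>..\<beta>}) ?g"
      by (intro continuous_intros continuous_on_compose2[OF contK]) auto
    then have "uniformly_continuous_on ({-1..1} \<times> {\<alpha>..\<beta>}) ?g"
      by (intro compact_uniformly_continuous compact_Times) auto
    then have "uniformly_continuous_on (range (\<lambda>x. (cos (\<Theta> x), \<phi> x))) ?g"
      using \<phi> unfolding uniformly_continuous_on_def by (auto 0 4)
    then show ?thesis
      using uniformly_continuous_on_compose[OF u1, of ?g] by (simp add: \<psi>_def[abs_def])
  qed
  then have cont\<psi>: "isCont \<psi> x" for x
    using uniformly_continuous_imp_continuous continuous_on_eq_continuous_at by blast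
  have "\<phi> 0 = \<beta>"
    proof -
    have "\<Theta> 0 = pi / 2"
      using \<Theta>'[of "pi/2"] by (simp add: X_def)
    then have "\<phi> 0 = m + r * sin (pi / 2)" by (simp only: \<phi>_def Y_def)
    then show ?thesis using mr by simp
  qed
  moreover have "DERIV \<psi> x :> q / 2" if q: "(Q has_real_derivative q) (at (\<phi> x) within {\<alpha>..\<beta>})" for x q
  \<comment> \<open>Away from the turning points the relation between \<open>\<psi>\<close> and
    \<open>Q\<close> is differentiated and divided by \<open>2 * \<psi> x\<close>. At a turning
    point this divides by zero; there the factor \<open>cos\<close> vanishes and
    \<open>DERIV_mult_zero\<close> applies.\<close>
  proof (cases "cos (\<Theta> x) = 0")
    case False
    then have "\<psi> x \<noteq> 0"
      using r KYpos[of "\<Theta> x"] by (auto simp: \<psi>_def \<phi>_def)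
    then have ne: "\<phi> x \<noteq> \<alpha>" "\<phi> x \<noteq> \<beta>"
      using sq[of x] Q0 by auto
    then have "\<phi> x \<in> interior {\<alpha>..\<beta>}"
      using \<phi>[of x] by auto
    then have "DERIV Q (\<phi> x) :> q"
      using q at_within_interior by metis
    then have DQ: "DERIV (\<lambda>x. Q (\<phi> x)) x :> q * \<psi> x"
      using D\<phi> DERIV_chain2 by blast
    have "((\<lambda>y. ((\<psi> y)\<^sup>2 - (\<psi> x)\<^sup>2) / (y - x) / (\<psi> y + \<psi> x)) \<longlongrightarrow> q * \<psi> x / (\<psi> x + \<psi> x)) (at x)"
      using DQ cont\<psi>[of x] \<open>\<psi> x \<noteq> 0\<close>
      by (intro tendsto_divide tendsto_add tendsto_const) (auto simp: sq has_field_derivative_iff isCont_def)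
    moreover have "\<forall>\<^sub>F y in at x. \<psi> y + \<psi> x \<noteq> 0"
    proof -
      have "((\<lambda>y. \<psi> y + \<psi> x) \<longlongrightarrow> \<psi> x + \<psi> x) (at x)"
        using cont\<psi>[of x] by (intro tendsto_add tendsto_const) (auto simp: isCont_def)
      then show ?thesis
        using \<open>\<psi> x \<noteq> 0\<close> by (elim tendsto_imp_eventually_ne) auto
    qed
    then have "\<forall>\<^sub>F y in at x. ((\<psi> y)\<^sup>2 - (\<psi> x)\<^sup>2) / (y - x) / (\<psi> y + \<psi> x) = (\<psi> y - \<psi> x) / (y - x)"
      by eventually_elim (simp add: power2_eq_square square_diff_square_factored)
    ultimately have "((\<lambda>y. (\<psi> y - \<psi> x) / (y - x)) \<longlongrightarrow> q * \<psi> x / (\<psi> x + \<psi> x)) (at x)"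
      by (rule Lim_transform_eventually)
    then show ?thesis
      using \<open>\<psi> x \<noteq> 0\<close> by (simp add: has_field_derivative_iff mult_2[symmetric])
  next
    case True
    let ?K = "\<lambda>y. sqrt (\<kappa> (\<phi> y))"
    have "isCont ?K x"
      using continuous_on_compose2[OF contKY[of UNIV], of UNIV \<Theta>] cont\<Theta>
      by (simp add: continuous_on_eq_continuous_at \<phi>_def)
    moreover have "DERIV (\<lambda>y. r * cos (\<Theta> y)) x :> - (r * sin (\<Theta> x) * ?K x)"
      using D\<Theta>[of x] by (auto intro!: derivative_eq_intros simp: \<phi>_def)
    ultimately have "DERIV \<psi> x :> - (r * sin (\<Theta> x) * ?K x) * ?K x"
      unfolding \<psi>_def[abs_def] using True by (intro DERIV_mult_zero) auto
    then have D: "DERIV \<psi> x :> - (r * sin (\<Theta> x) * \<kappa> (\<phi> x))"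
      using \<kappa>pos[OF \<phi>[of x]] by (simp add: mult.assoc)
    from True have "sin (\<Theta> x) = 1 \<or> sin (\<Theta> x) = -1"
      using sin_cos_squared_add[of "\<Theta> x"] by (simp add: power2_eq_1_iff)
    then have "- (r * sin (\<Theta> x) * \<kappa> (\<phi> x)) = q / 2"
    proof
      assume s: "sin (\<Theta> x) = 1"
      then have e: "\<phi> x = \<beta>" using mr by (simp add: \<phi>_def Y_def)
      have "q = qb"
        using vector_derivative_unique_within[of \<beta> "{\<alpha>..\<beta>}" Q q qb] q qb(1) e \<open>\<alpha> < \<beta>\<close>
        by (auto simp: trivial_limit_within islimpt_Icc has_real_derivative_iff_has_vector_derivative)
      then show ?thesis
        using s e \<open>\<alpha> < \<beta>\<close> by (simp add: \<kappa>_def r_def field_simps)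
    next
      assume s: "sin (\<Theta> x) = -1"
      then have e: "\<phi> x = \<alpha>" using mr by (simp add: \<phi>_def Y_def)
      have "q = qa"
        using vector_derivative_unique_within[of \<alpha> "{\<alpha>..\<beta>}" Q q qa] q qa(1) e \<open>\<alpha> < \<beta>\<close>
        by (auto simp: trivial_limit_within islimpt_Icc has_real_derivative_iff_has_vector_derivative)
      then show ?thesis
        using s e \<open>\<alpha> < \<beta>\<close> by (simp add: \<kappa>_def r_def field_simps)
    qed
    with D show ?thesis by metis
  qed
  ultimately show ?thesis
    using that D\<phi> uc \<phi> sq by blast
qed

section \<open>The inverse of \<open>1 - \<partial>\<^sub>x\<^sup>2\<close>\<close>

lemma integrable_exp_minus_abs: "integrable lborel (\<lambda>y::real. exp (- \<bar>x - y\<bar>))"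
proof -
  have "integrable lborel (\<lambda>y::real. exp (- \<bar>y\<bar>))"
  proof -
    have "(\<lambda>y::real. exp (- 1 * y)) absolutely_integrable_on {0..}"
      using has_integral_exp_minus_to_infinity[of 1 0]
      by (intro nonnegative_absolutely_integrable_1) auto
    then have f: "integrable lborel (\<lambda>y::real. indicator {0..} y * exp (- y))"
      by (simp add: set_integrable_def integrable_completion)
    have "integrable lborel (\<lambda>y::real. indicator {0..} y * exp (- y) + indicator {0..} (- y) * exp y)"
      using lborel_integrable_real_affine[OF f, of "-1" 0] f by simp
    then show ?thesis
      by (rule Bochner_Integration.integrable_bound) (auto simp: indicator_def)
  qed
  from lborel_integrable_real_affine[OF this, of "-1" x] show ?thesis by simp
qed

lemma integrable_helmholtz_kernel:
  fixes h :: "real \<Rightarrow> real"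
  assumes h: "continuous_on UNIV h" "\<And>y. \<bar>h y\<bar> \<le> B"
  shows "integrable lborel (\<lambda>y. exp (- \<bar>x - y\<bar>) * h y)"
proof (rule Bochner_Integration.integrable_bound)
  show "integrable lborel (\<lambda>y. B * exp (- \<bar>x - y\<bar>))"
    using integrable_exp_minus_abs by simp
  show "(\<lambda>y. exp (- \<bar>x - y\<bar>) * h y) \<in> borel_measurable lborel"
    using borel_measurable_continuous_onI[OF h(1)] by simp
  have "\<bar>h y\<bar> * exp (- \<bar>x - y\<bar>) \<le> \<bar>B\<bar> * exp (- \<bar>x - y\<bar>)" for y
    using h(2)[of y] by (intro mult_right_mono) auto
  then show "AE y in lborel. norm (exp (- \<bar>x - y\<bar>) * h y) \<le> norm (B * exp (- \<bar>x - y\<bar>))"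
    by (simp add: abs_mult mult.commute)
qed

text \<open>Left of \<open>x\<close> the kernel factors as \<open>exp (- x) * exp y\<close>, so
  \<open>L\<close> is \<open>exp (- x)\<close> times an indefinite integral and the product rule
  gives the equation.\<close>

lemma left_exp_potential:
  fixes h :: "real \<Rightarrow> real"
  assumes h: "continuous_on UNIV h" "\<And>y. \<bar>h y\<bar> \<le> B"
  defines "L \<equiv> \<lambda>x. LINT y:{..x}|lborel. exp (- \<bar>x - y\<bar>) * h y"
  shows "DERIV L x :> h x - L x"
proof -
  define A where "A x = (LINT y:{..x}|lborel. exp y * h y)" for x
  have int: "set_integrable lborel {..x} (\<lambda>y. exp y * h y)" for x
  proof -
    have "set_integrable lborel {..x} (\<lambda>y. exp x * (exp (- \<bar>x - y\<bar>) * h y))"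
      unfolding set_integrable_def
      by (intro integrable_mult_indicator integrable_mult_right integrable_helmholtz_kernel[OF h]) auto
    then show ?thesis
      by (rule set_integrable_cong[THEN iffD1, rotated -1]) (auto simp: exp_diff exp_minus)
  qed
  have LA: "L x = exp (- x) * A x" for x
  proof -
    have "L x = (LINT y:{..x}|lborel. exp (- x) * (exp y * h y))"
      unfolding L_def by (intro set_lebesgue_integral_cong) (auto simp: exp_diff exp_minus field_simps)
    then show ?thesis
      by (simp add: A_def)
  qed
  have "DERIV A x :> exp x * h x"
  proof -
    have cont: "continuous_on S (\<lambda>y. exp y * h y)" for S
      by (intro continuous_intros continuous_on_subset[OF h(1)]) auto
    \<comment> \<open>Differentiation at \<open>x\<close> is local, so the half-line is cut at
      \<open>x - 1\<close> and the fundamental theorem is applied on a bounded interval.\<close>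
    have *: "A (x - 1) + integral {x - 1..y} (\<lambda>y. exp y * h y) = A y" if "y \<in> {x - 1<..}" for y
    proof -
      have "A y = A (x - 1) + (LINT z:{x - 1<..y}|lborel. exp z * h z)"
      proof -
        have *: "{..y} = {..x - 1} \<union> {x - 1<..y}" using that by auto
        show ?thesis
          unfolding A_def * by (intro set_integral_Un) (auto intro: set_integrable_subset[OF int[of y]] int)
      qed
      also have "(LINT z:{x - 1<..y}|lborel. exp z * h z) = (LINT z:{x - 1..y}|lborel. exp z * h z)"
      proof (rule set_integral_cong_set)
        show "set_borel_measurable lborel {x - 1<..y} (\<lambda>z. exp z * h z)"
          "set_borel_measurable lborel {x - 1..y} (\<lambda>z. exp z * h z)"
          unfolding set_borel_measurable_def
          using borel_measurable_continuous_onI[OF cont] by simp_all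
        show "AE z in lborel. (z \<in> {x - 1..y}) = (z \<in> {x - 1<..y})"
          using AE_lborel_singleton[of "x - 1"] by eventually_elim auto
      qed
      also have "\<dots> = integral {x - 1..y} (\<lambda>y. exp y * h y)"
        by (intro set_borel_integral_eq_integral borel_integrable_atLeastAtMost' cont)
      finally show ?thesis by (rule sym)
    qed
    have "((\<lambda>y. A (x - 1) + integral {x - 1..y} (\<lambda>y. exp y * h y)) has_real_derivative exp x * h x) (at x)"
    proof -
      have "((\<lambda>y. integral {x - 1..y} (\<lambda>y. exp y * h y)) has_real_derivative exp x * h x)
          (at x within {x - 1..x + 1})"
        by (intro integral_has_real_derivative cont) auto
      then have "((\<lambda>y. integral {x - 1..y} (\<lambda>y. exp y * h y)) has_real_derivative exp x * h x) (at x)"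
        by (simp add: at_within_Icc_at)
      then show ?thesis
        by (auto intro!: derivative_eq_intros)
    qed
    then show ?thesis
      by (rule has_field_derivative_transform_within_open[of _ _ _ "{x - 1<..}"]) (use * in auto)
  qed
  then have "DERIV (\<lambda>x. exp (- x) * A x) x :> - exp (- x) * A x + exp x * h x * exp (- x)"
    by (auto intro!: derivative_eq_intros)
  also have "- exp (- x) * A x + exp x * h x * exp (- x) = h x - exp (- x) * A x"
    by (simp add: exp_minus)
  finally show ?thesis
    unfolding LA[abs_def] .
qed

text \<open>Over a window of length \<open>r\<close> the damping contributes a factor
  \<open>exp (- r)\<close> and the source at most \<open>B\<close>. Taking the supremum gives
  \<open>S <= B + exp (- r) * S\<close>; the crude bound \<open>C\<close> makes \<open>S\<close>
  finite and so excludes multiples of exp(-x). Only local integrals of the source enter, as required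
  by a uniqueness proof in a local L^1 norm.\<close>

lemma exp_decay_sup_bound:
  fixes f :: "real \<Rightarrow> real"
  assumes D: "\<And>x. DERIV f x :> g x - f x" and g: "\<And>x. \<bar>g x\<bar> \<le> e x"
    and bdd: "\<And>x. \<bar>f x\<bar> \<le> C" and e: "continuous_on UNIV e" "r > 0"
    and B: "\<And>z. integral {z..z + r} e \<le> B"
  shows "\<bar>f x\<bar> \<le> B / (1 - exp (- r))"
proof -
  have step: "\<bar>f x\<bar> \<le> B + exp (- r) * \<bar>f (x - r)\<bar>" for x
  proof -
    define G where "G y = integral {x - r..y} e" for y
    have DG: "(G has_real_derivative e y) (at y within {x - r..x})" if "x - r \<le> y" "y \<le> x" for y
      unfolding G_def using that
      by (intro integral_has_real_derivative continuous_on_subset[OF e(1)]) auto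
    have G: "G (x - r) = 0" "G x \<le> B"
      using B[of "x - r"] by (auto simp: G_def)
    \<comment> \<open>The weight \<open>exp (y - x)\<close> removes the damping and \<open>G\<close>
      absorbs the source, leaving a nonincreasing function; \<open>\<sigma>\<close> treats
      \<open>f\<close> and \<open>- f\<close> at once. The factor \<open>exp (x - x)\<close> is the
      weight at the right end.\<close>
    have mono: "exp (x - x) * \<sigma> * f x - G x \<le> exp (x - r - x) * \<sigma> * f (x - r) - G (x - r)"
      if \<sigma>: "\<bar>\<sigma>\<bar> = 1" for \<sigma>
    proof (rule DERIV_nonpos_imp_decreasing_open[of "x - r" x "\<lambda>y. exp (y - x) * \<sigma> * f y - G y"])
      fix y assume y: "x - r < y" "y < x"
      have "(G has_real_derivative e y) (at y)"
        using DG[of y] y by (simp add: at_within_Icc_at)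
      then have "DERIV (\<lambda>y. exp (y - x) * \<sigma> * f y - G y) y :> exp (y - x) * \<sigma> * g y - e y"
        by (auto intro!: derivative_eq_intros D simp: algebra_simps)
      moreover have "exp (y - x) * (\<sigma> * g y) \<le> 1 * e y"
      proof (rule order_trans[OF mult_left_mono])
        show "\<sigma> * g y \<le> \<bar>g y\<bar>"
          using \<sigma> by (metis abs_ge_self abs_mult mult_1)
        show "exp (y - x) * \<bar>g y\<bar> \<le> 1 * e y"
          using y g[of y] by (intro mult_mono) auto
      qed auto
      ultimately show "\<exists>d. DERIV (\<lambda>y. exp (y - x) * \<sigma> * f y - G y) y :> d \<and> d \<le> 0"
        by (auto simp: mult.assoc)
    qed (use e(2) in \<open>auto intro!: continuous_intros DERIV_continuous_on[OF DG] 
        DERIV_continuous_on[OF has_field_derivative_at_within[OF D]]\<close>)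
    have "\<bar>f x\<bar> - G x \<le> exp (- r) * \<bar>f (x - r)\<bar>"
    proof (cases "f x \<ge> 0")
      case True
      have "exp (- r) * f (x - r) \<le> exp (- r) * \<bar>f (x - r)\<bar>" by (intro mult_left_mono) auto
      moreover have "f x - G x \<le> exp (- r) * f (x - r)" using mono[of 1] G(1) by simp
      ultimately show ?thesis using True by linarith
    next
      case False
      have "exp (- r) * - f (x - r) \<le> exp (- r) * \<bar>f (x - r)\<bar>" by (intro mult_left_mono) auto
      moreover have "- f x - G x \<le> exp (- r) * - f (x - r)" using mono[of "-1"] G(1) by simp
      ultimately show ?thesis using False by linarith
    qed
    then show ?thesis using G(2) by simp
  qed
  define S where "S = (SUP x. \<bar>f x\<bar>)"
  have S: "\<bar>f x\<bar> \<le> S" for x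
    unfolding S_def by (rule cSUP_upper) (use bdd in \<open>auto intro!: bdd_aboveI\<close>)
  have "S \<le> B + exp (- r) * S"
    unfolding S_def
  proof (rule cSUP_least)
    fix x
    show "\<bar>f x\<bar> \<le> B + exp (- r) * (SUP x. \<bar>f x\<bar>)"
      using order_trans[OF step[of x] add_left_mono[OF mult_left_mono[OF S[of "x - r"]]]] by (simp add: S_def)
  qed simp
  moreover have "exp (- r) < 1" using e(2) by simp
  ultimately have "S \<le> B / (1 - exp (- r))"
    by (simp add: pos_le_divide_eq algebra_simps)
  then show ?thesis using S[of x] by simp
qed

lemma exp_growth_sup_bound:
  fixes f :: "real \<Rightarrow> real"
  assumes D: "\<And>x. DERIV f x :> f x - g x" and g: "\<And>x. \<bar>g x\<bar> \<le> e x"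
    and bdd: "\<And>x. \<bar>f x\<bar> \<le> C" and e: "continuous_on UNIV e" "r > 0"
    and B: "\<And>z. integral {z..z + r} e \<le> B"
  shows "\<bar>f x\<bar> \<le> B / (1 - exp (- r))"
proof -
  have "\<bar>f (- (- x))\<bar> \<le> B / (1 - exp (- r))"
  proof (rule exp_decay_sup_bound[where f = "\<lambda>x. f (- x)" and g = "\<lambda>x. g (- x)" and e = "\<lambda>x. e (- x)"])
    show "DERIV (\<lambda>x. f (- x)) x :> g (- x) - f (- x)" for x
      using DERIV_chain2[OF D DERIV_minus[OF DERIV_ident], of x UNIV] by simp
    show "continuous_on UNIV (\<lambda>x. e (- x))"
      by (intro continuous_on_compose2[OF e(1)] continuous_intros) auto
    show "integral {z..z + r} (\<lambda>x. e (- x)) \<le> B" for z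
      using B[of "- z - r"] Henstock_Kurzweil_Integration.integral_reflect_real[of "- z" "- z - r" e] by (simp add: add.commute)
  qed (use g bdd e in auto)
  then show ?thesis by simp
qed

lemma bounded_exp_growth_zero:
  fixes f :: "real \<Rightarrow> real"
  assumes "\<And>x. \<bar>f x\<bar> \<le> C"
  shows "(\<And>x. DERIV f x :> f x) \<Longrightarrow> f x = 0" "(\<And>x. DERIV f x :> - f x) \<Longrightarrow> f x = 0"
  using exp_growth_sup_bound[of f "\<lambda>_. 0" "\<lambda>_. 0" C 1 0] exp_decay_sup_bound[of f "\<lambda>_. 0" "\<lambda>_. 0" C 1 0] assms
  by auto

text \<open>\<open>L\<close> and \<open>R\<close> are the integrals against the kernel over the two
  half-lines. From here on the convolution is handled only through these two first-order
  equations.\<close>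

lemma helmholtz_inv_split:
  fixes h :: "real \<Rightarrow> real"
  assumes h: "continuous_on UNIV h" "\<And>y. \<bar>h y\<bar> \<le> B"
  obtains L R C where "\<And>x. \<bar>L x\<bar> \<le> C" "\<And>x. \<bar>R x\<bar> \<le> C"
    "\<And>x. DERIV L x :> h x - L x" "\<And>x. DERIV R x :> R x - h x"
    "\<And>x. helmholtz_inv h x = (L x + R x) / 2"
    "\<And>x. deriv (helmholtz_inv h) x = (R x - L x) / 2"
proof -
  define L where "L x = (LINT y:{..x}|lborel. exp (- \<bar>x - y\<bar>) * h y)" for x
  define R where "R x = (LINT y:{x..}|lborel. exp (- \<bar>x - y\<bar>) * h y)" for x
  note int = integrable_helmholtz_kernel[OF h]
  have si: "set_integrable lborel A (\<lambda>y. exp (- \<bar>x - y\<bar>) * h y)" if "A \<in> sets borel" for A x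
    using that unfolding set_integrable_def by (intro integrable_mult_indicator int) auto
  have half: "helmholtz_inv h x = (L x + R x) / 2" for x
  proof -
    have "(LINT y|lborel. exp (- \<bar>x - y\<bar>) * h y) = (LINT y:{..x} \<union> {x<..}|lborel. exp (- \<bar>x - y\<bar>) * h y)"
    proof -
      have "{..x} \<union> {x<..} = UNIV" by auto
      then show ?thesis by (simp only: set_lebesgue_integral_def) simp
    qed
    also have "\<dots> = L x + (LINT y:{x<..}|lborel. exp (- \<bar>x - y\<bar>) * h y)"
      unfolding L_def by (intro set_integral_Un si) auto
    also have "(LINT y:{x<..}|lborel. exp (- \<bar>x - y\<bar>) * h y) = R x"
      unfolding R_def
    proof (rule set_integral_cong_set)
      show "AE y in lborel. (y \<in> {x..}) = (y \<in> {x<..})"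
        using AE_lborel_singleton[of x] by eventually_elim auto
    qed (use borel_measurable_integrable[OF int[of x]] in \<open>auto simp: set_borel_measurable_def\<close>)
    finally have *: "(LINT y|lborel. exp (- \<bar>x - y\<bar>) * h y) = L x + R x" .
    have "helmholtz_inv h x = (LINT y|lborel. (exp (- \<bar>x - y\<bar>) * h y) / 2)"
      unfolding helmholtz_inv_def by (intro Bochner_Integration.integral_cong) auto
    also have "\<dots> = (L x + R x) / 2"
      using * by simp
    finally show ?thesis .
  qed
  have DL: "DERIV L x :> h x - L x" for x
    unfolding L_def[abs_def] by (rule left_exp_potential[OF h])
  have R: "R x = (LINT y:{..- x}|lborel. exp (- \<bar>- x - y\<bar>) * h (- y))" for x
    unfolding R_def set_lebesgue_integral_def
    by (subst lborel_integral_real_affine[of "-1" _ 0])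
      (auto intro!: Bochner_Integration.integral_cong simp: indicator_def)
  have h': "continuous_on UNIV (\<lambda>y. h (- y))"
    by (intro continuous_on_compose2[OF h(1)] continuous_intros) auto
  have DR: "DERIV R x :> R x - h x" for x
  proof -
    have "DERIV (\<lambda>x. R (- x)) (- x) :> h (- (- x)) - R (- (- x))"
      using left_exp_potential[OF h', of B "- x"] h(2) by (simp add: R)
    then have "DERIV (\<lambda>x. R (- x)) (- x) :> - (R x - h x)" by simp
    from DERIV_chain2[where g = uminus and Db = "-1" and s = UNIV, OF this]
    show ?thesis
      using DERIV_minus[OF DERIV_ident[of "at x"]] by simp
  qed
  define K where "K = (LINT y|lborel. exp (- \<bar>y :: real\<bar>))"
  have bound: "\<bar>LINT y:A|lborel. exp (- \<bar>x - y\<bar>) * h y\<bar> \<le> B * K" if A: "A \<in> sets borel" for A x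
  proof -
    have "\<bar>LINT y:A|lborel. exp (- \<bar>x - y\<bar>) * h y\<bar> \<le> (LINT y|lborel. B * exp (- \<bar>x - y\<bar>))"
      unfolding set_lebesgue_integral_def real_norm_def[symmetric, of "integral\<^sup>L _ _"]
    proof (rule Bochner_Integration.integral_norm_bound_integral)
      have "0 \<le> B" using h(2)[of 0] by linarith
      then show "norm (indicat_real A y *\<^sub>R (exp (- \<bar>x - y\<bar>) * h y)) \<le> B * exp (- \<bar>x - y\<bar>)" for y
        using h(2)[of y] by (simp add: indicator_def abs_mult mult.commute)
    qed (use si[OF A, of x] integrable_exp_minus_abs[of x] in \<open>auto simp: set_integrable_def\<close>)
    also have "\<dots> = B * (LINT y|lborel. exp (- \<bar>x - y\<bar>))"
      by simp
    also have "(LINT y|lborel. exp (- \<bar>x - y\<bar>)) = K"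
      unfolding K_def using lborel_integral_real_affine[of "-1" "\<lambda>y. exp (- \<bar>y\<bar>)" x] by simp
    finally show ?thesis .
  qed
  have "DERIV (helmholtz_inv h) x :> (R x - L x) / 2" for x
    unfolding half[abs_def] by (auto intro!: derivative_eq_intros DL DR)
  then have "deriv (helmholtz_inv h) x = (R x - L x) / 2" for x
    by (rule DERIV_imp_deriv)
  moreover have "\<bar>L x\<bar> \<le> B * K" "\<bar>R x\<bar> \<le> B * K" for x
    using bound[of "{..x}" x] bound[of "{x..}" x] by (simp_all add: L_def R_def)
  ultimately show ?thesis
    using that[of L "B * K" R] DL DR half by blast
qed

text \<open>The system is the first-order form of w - w'' = - h1' - h2, with no derivative of
  \<open>h1\<close>. Adding the half-line integrals to \<open>w + a\<close> and \<open>w - a\<close>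
  cancels the sources: \<open>p' = p\<close> and \<open>m' = - m\<close>, whose bounded solutions
  vanish.\<close>

lemma helmholtz_inv_system:
  fixes h1 h2 w a :: "real \<Rightarrow> real"
  assumes h: "continuous_on UNIV h1" "\<And>y. \<bar>h1 y\<bar> \<le> B" "continuous_on UNIV h2" "\<And>y. \<bar>h2 y\<bar> \<le> B"
    and w: "\<And>x. DERIV w x :> a x + h1 x" "\<And>x. \<bar>w x\<bar> \<le> C"
    and a: "\<And>x. DERIV a x :> w x + h2 x" "\<And>x. \<bar>a x\<bar> \<le> C"
  shows "w x = - deriv (helmholtz_inv h1) x - helmholtz_inv h2 x"
proof -
  obtain L1 R1 C1 where 1: "\<And>x. \<bar>L1 x\<bar> \<le> C1" "\<And>x. \<bar>R1 x\<bar> \<le> C1" 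
    "\<And>x. DERIV L1 x :> h1 x - L1 x" "\<And>x. DERIV R1 x :> R1 x - h1 x"
    "\<And>x. deriv (helmholtz_inv h1) x = (R1 x - L1 x) / 2"
    using helmholtz_inv_split[OF h(1,2)] by metis
  obtain L2 R2 C2 where 2: "\<And>x. \<bar>L2 x\<bar> \<le> C2" "\<And>x. \<bar>R2 x\<bar> \<le> C2" 
    "\<And>x. DERIV L2 x :> h2 x - L2 x" "\<And>x. DERIV R2 x :> R2 x - h2 x"
    "\<And>x. helmholtz_inv h2 x = (L2 x + R2 x) / 2"
    using helmholtz_inv_split[OF h(3,4)] by metis
  define p where "p x = w x + a x + R1 x + R2 x" for x
  define m where "m x = w x - a x - L1 x + L2 x" for x
  have "DERIV p x :> p x" for x
    unfolding p_def by (rule derivative_eq_intros w a 1 2 refl | simp)+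
  moreover have "\<bar>p x\<bar> \<le> 2 * C + C1 + C2" for x
    unfolding p_def using w(2)[of x] a(2)[of x] 1(2)[of x] 2(2)[of x] by linarith
  ultimately have "p x = 0"
    using bounded_exp_growth_zero(1) by blast
  moreover have "DERIV m x :> - m x" for x
    unfolding m_def by (rule derivative_eq_intros w a 1 2 refl | simp)+
  moreover have "\<bar>m x\<bar> \<le> 2 * C + C1 + C2" for x
    unfolding m_def using w(2)[of x] a(2)[of x] 1(1)[of x] 2(1)[of x] by linarith
  ultimately have "p x + m x = 0"
    using bounded_exp_growth_zero(2)[of m] by (metis add.right_neutral)
  then show ?thesis
    unfolding p_def m_def 1(5) 2(5) by (simp add: field_simps)
qed

section \<open>The space of \<open>C\<^sup>1\<close> functions and the nonlocal term\<close>

lemma c1fun_abs_le_norm: "\<bar>apply_c1fun f x\<bar> \<le> norm f" "\<bar>deriv (apply_c1fun f) x\<bar> \<le> norm f"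
  using norm_bounded[of "c1_val f" x] norm_bounded[of "c1_deriv f" x]
    norm_ge_zero[of "c1_val f"] norm_ge_zero[of "c1_deriv f"]
  unfolding norm_c1fun_eq apply_c1_val apply_c1_deriv real_norm_def by linarith+

lemma c1fun_deriv_continuous: "continuous_on S (deriv (apply_c1fun f))"
proof -
  have "continuous_on UNIV (deriv (apply_c1fun f))"
    using apply_c1fun[of f] by simp
  then show ?thesis by (rule continuous_on_subset) simp
qed

lemma c1fun_continuous: "continuous_on S (apply_c1fun f)"
  by (rule DERIV_continuous_on[OF has_field_derivative_at_within[OF c1fun_has_deriv]])

lemma apply_c1fun_diff: "apply_c1fun (f - g) x = f x - g x"
  unfolding minus_c1fun_def plus_c1fun.rep_eq scaleR_c1fun.rep_eq by simp

lemma deriv_c1fun_diff: "deriv (apply_c1fun (f - g)) x = deriv f x - deriv g x"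
proof -
  have "DERIV (\<lambda>x. apply_c1fun f x - apply_c1fun g x) x :> deriv f x - deriv g x"
    by (intro derivative_intros c1fun_has_deriv)
  then show ?thesis
    by (simp add: apply_c1fun_diff[abs_def] DERIV_imp_deriv)
qed

section \<open>Pointwise Lipschitz bounds for the densities, and differences of the nonlocal
  term\<close>

definition gch_flux :: "nat \<Rightarrow> real \<Rightarrow> real \<Rightarrow> real \<Rightarrow> real"
  where "gch_flux k b p q = b / (real k + 1) * p ^ (k + 1) + (3 * real k - b) / 2 * p ^ (k - 1) * q\<^sup>2"

definition gch_source :: "nat \<Rightarrow> real \<Rightarrow> real \<Rightarrow> real \<Rightarrow> real"
  where "gch_source k b p q = (real k - 1) * (b - real k) / 2 * p ^ (k - 2) * q ^ 3"

lemma nonlocal_P_eq: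
  "nonlocal_P k b u x = - deriv (helmholtz_inv (\<lambda>y. gch_flux k b (u y) (deriv u y))) x
    - helmholtz_inv (\<lambda>y. gch_source k b (u y) (deriv u y)) x"
  by (simp add: nonlocal_P_def gch_flux_def gch_source_def)

text \<open>The power \<open>M ^ n\<close> instead of \<open>M ^ (n - 1)\<close> costs a factor
  \<open>M\<close>, at least 1, and keeps truncated subtraction out of the induction.\<close>

lemma abs_power_diff_le:
  fixes x y :: real
  assumes "\<bar>x\<bar> \<le> M" "\<bar>y\<bar> \<le> M" "1 \<le> M"
  shows "\<bar>x ^ n - y ^ n\<bar> \<le> real n * M ^ n * \<bar>x - y\<bar>"
proof (induction n)
  case (Suc n)
  have "x ^ Suc n - y ^ Suc n = x * (x ^ n - y ^ n) + (x - y) * y ^ n"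
    by (simp add: algebra_simps)
  also have "\<bar>\<dots>\<bar> \<le> M * (real n * M ^ n * \<bar>x - y\<bar>) + \<bar>x - y\<bar> * M ^ n"
    unfolding abs_mult power_abs
    by (intro abs_triangle_ineq[THEN order_trans] add_mono)
      (use assms in \<open>auto simp: abs_mult power_abs intro!: mult_mono power_mono Suc\<close>)
  also have "\<bar>x - y\<bar> * M ^ n \<le> \<bar>x - y\<bar> * M ^ Suc n"
    using assms by (intro mult_left_mono power_increasing) auto
  finally show ?case
    by (simp add: algebra_simps)
qed simp

lemma abs_monomial_diff_le:
  fixes p q p' q' :: real
  assumes "\<bar>p\<bar> \<le> M" "\<bar>q\<bar> \<le> M" "\<bar>p'\<bar> \<le> M" "\<bar>q'\<bar> \<le> M" "1 \<le> M"
  shows "\<bar>p ^ i * q ^ j - p' ^ i * q' ^ j\<bar> \<le> real (i + j) * M ^ (i + j) * (\<bar>p - p'\<bar> + \<bar>q - q'\<bar>)"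
proof -
  have "p ^ i * q ^ j - p' ^ i * q' ^ j = (p ^ i - p' ^ i) * q ^ j + p' ^ i * (q ^ j - q' ^ j)"
    by (simp add: algebra_simps)
  also have "\<bar>\<dots>\<bar> \<le> (real i * M ^ i * \<bar>p - p'\<bar>) * M ^ j + M ^ i * (real j * M ^ j * \<bar>q - q'\<bar>)"
    using assms by (intro abs_triangle_ineq[THEN order_trans] add_mono)
      (auto simp: abs_mult power_abs intro!: mult_mono power_mono abs_power_diff_le)
  also have "\<dots> = M ^ (i + j) * (real i * \<bar>p - p'\<bar> + real j * \<bar>q - q'\<bar>)"
    by (simp add: algebra_simps power_add)
  also have "\<dots> \<le> M ^ (i + j) * (real (i + j) * (\<bar>p - p'\<bar> + \<bar>q - q'\<bar>))"
    using assms by (intro mult_left_mono) (auto simp: algebra_simps)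
  finally show ?thesis
    by (simp add: algebra_simps)
qed

text \<open>One constant for everything that the comparison of two solutions produces: the two
  densities, the transport speed and the spatial derivative of that speed.\<close>

definition gch_lipschitz :: "nat \<Rightarrow> real \<Rightarrow> real \<Rightarrow> real \<Rightarrow> bool"
  where "gch_lipschitz k b M K \<longleftrightarrow> (\<forall>p q p' q'. \<bar>p\<bar> \<le> M \<and> \<bar>q\<bar> \<le> M \<and> \<bar>p'\<bar> \<le> M \<and> \<bar>q'\<bar> \<le> M \<longrightarrow>
      \<bar>gch_flux k b p q - gch_flux k b p' q'\<bar> \<le> K * (\<bar>p - p'\<bar> + \<bar>q - q'\<bar>) \<and>
      \<bar>gch_source k b p q - gch_source k b p' q'\<bar> \<le> K * (\<bar>p - p'\<bar> + \<bar>q - q'\<bar>) \<and>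
      \<bar>p ^ k - p' ^ k\<bar> \<le> K * \<bar>p - p'\<bar> \<and>
      \<bar>real k * (p ^ (k - 1) * q) - real k * (p' ^ (k - 1) * q')\<bar> \<le> K * (\<bar>p - p'\<bar> + \<bar>q - q'\<bar>))"

lemma gch_lipschitzD:
  assumes "gch_lipschitz k b M K" "\<bar>p\<bar> \<le> M" "\<bar>q\<bar> \<le> M" "\<bar>p'\<bar> \<le> M" "\<bar>q'\<bar> \<le> M"
  shows "\<bar>gch_flux k b p q - gch_flux k b p' q'\<bar> \<le> K * (\<bar>p - p'\<bar> + \<bar>q - q'\<bar>)"
    "\<bar>gch_source k b p q - gch_source k b p' q'\<bar> \<le> K * (\<bar>p - p'\<bar> + \<bar>q - q'\<bar>)"
    "\<bar>p ^ k - p' ^ k\<bar> \<le> K * \<bar>p - p'\<bar>"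
    "\<bar>real k * (p ^ (k - 1) * q) - real k * (p' ^ (k - 1) * q')\<bar> \<le> K * (\<bar>p - p'\<bar> + \<bar>q - q'\<bar>)"
  using assms unfolding gch_lipschitz_def by blast+

lemma gch_nonlinearities_lipschitz:
  assumes "1 \<le> M"
  obtains K where "0 < K" "gch_lipschitz k b M K"
proof -
  define N where "N i j = real (i + j) * M ^ (i + j)" for i j
  have N0: "0 \<le> N i j" for i j
    using assms by (simp add: N_def)
  define c1 c2 c3 where "c1 = b / (real k + 1)" and "c2 = (3 * real k - b) / 2"
    and "c3 = (real k - 1) * (b - real k) / 2"
  define K where "K = \<bar>c1\<bar> * N (k + 1) 0 + \<bar>c2\<bar> * N (k - 1) 2 + \<bar>c3\<bar> * N (k - 2) 3 + N k 0
    + real k * N (k - 1) 1 + 1"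
  show ?thesis
  proof (rule that)
    show "0 < K" using N0 by (simp add: K_def add_nonneg_pos)
    show "gch_lipschitz k b M K"
      unfolding gch_lipschitz_def
    proof (intro allI impI, elim conjE)
      fix p q p' q' :: real
      assume M: "\<bar>p\<bar> \<le> M" "\<bar>q\<bar> \<le> M" "\<bar>p'\<bar> \<le> M" "\<bar>q'\<bar> \<le> M"
      define e where "e = \<bar>p - p'\<bar> + \<bar>q - q'\<bar>"
      have e: "0 \<le> e" by (simp add: e_def)
      have mono: "\<bar>c * (p ^ i * q ^ j - p' ^ i * q' ^ j)\<bar> \<le> \<bar>c\<bar> * N i j * e" for c i j
        using abs_monomial_diff_le[OF M assms, of i j]
        by (simp add: abs_mult mult.assoc mult_left_mono N_def e_def)
      have le: "(\<bar>c1\<bar> * N (k + 1) 0 + \<bar>c2\<bar> * N (k - 1) 2) * e \<le> K * e"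
         "\<bar>c3\<bar> * N (k - 2) 3 * e \<le> K * e" "real k * N (k - 1) 1 * e \<le> K * e"
         "N k 0 * \<bar>p - p'\<bar> \<le> K * \<bar>p - p'\<bar>"
        by (rule mult_right_mono; use N0 e in \<open>simp add: K_def\<close>)+
      have "\<bar>gch_flux k b p q - gch_flux k b p' q'\<bar> \<le> \<bar>c1\<bar> * N (k + 1) 0 * e + \<bar>c2\<bar> * N (k - 1) 2 * e"
      proof -
        have "gch_flux k b p q = c1 * p ^ (k + 1) + c2 * (p ^ (k - 1) * q\<^sup>2)" for p q
          by (simp add: gch_flux_def c1_def c2_def)
        then have "gch_flux k b p q - gch_flux k b p' q' = c1 * (p ^ (k + 1) * q ^ 0 - p' ^ (k + 1) * q' ^ 0)
            + c2 * (p ^ (k - 1) * q\<^sup>2 - p' ^ (k - 1) * q'\<^sup>2)"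
          by (simp add: right_diff_distrib)
        then show ?thesis
          using mono[of c1 "k + 1" 0] mono[of c2 "k - 1" 2] by linarith
      qed
      moreover have "\<bar>gch_source k b p q - gch_source k b p' q'\<bar> \<le> \<bar>c3\<bar> * N (k - 2) 3 * e"
      proof -
        have "gch_source k b p q - gch_source k b p' q' = c3 * (p ^ (k - 2) * q ^ 3 - p' ^ (k - 2) * q' ^ 3)"
          by (simp add: gch_source_def c3_def right_diff_distrib)
        then show ?thesis
          using mono[of c3 "k - 2" 3] by simp
      qed
      moreover have "\<bar>p ^ k - p' ^ k\<bar> \<le> N k 0 * \<bar>p - p'\<bar>"
        using abs_power_diff_le[OF M(1) M(3) assms, of k] by (simp add: N_def)
      moreover have "\<bar>real k * (p ^ (k - 1) * q) - real k * (p' ^ (k - 1) * q')\<bar> \<le> real k * N (k - 1) 1 * e"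
        using mono[of "real k" "k - 1" 1] by (simp add: right_diff_distrib)
      ultimately show "\<bar>gch_flux k b p q - gch_flux k b p' q'\<bar> \<le> K * (\<bar>p - p'\<bar> + \<bar>q - q'\<bar>) \<and>
        \<bar>gch_source k b p q - gch_source k b p' q'\<bar> \<le> K * (\<bar>p - p'\<bar> + \<bar>q - q'\<bar>) \<and>
        \<bar>p ^ k - p' ^ k\<bar> \<le> K * \<bar>p - p'\<bar> \<and>
        \<bar>real k * (p ^ (k - 1) * q) - real k * (p' ^ (k - 1) * q')\<bar> \<le> K * (\<bar>p - p'\<bar> + \<bar>q - q'\<bar>)"
        using le unfolding e_def[symmetric] by (auto simp: distrib_right)
    qed
  qed
qed

lemma gch_densities_bounded_continuous:
  fixes f :: c1fun
  shows "continuous_on UNIV (\<lambda>y. gch_flux k b (f y) (deriv f y))"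
    "continuous_on UNIV (\<lambda>y. gch_source k b (f y) (deriv f y))"
    and "\<exists>B. \<forall>y. \<bar>gch_flux k b (f y) (deriv f y)\<bar> \<le> B \<and> \<bar>gch_source k b (f y) (deriv f y)\<bar> \<le> B"
proof -
  show "continuous_on UNIV (\<lambda>y. gch_flux k b (f y) (deriv f y))"
    "continuous_on UNIV (\<lambda>y. gch_source k b (f y) (deriv f y))"
    unfolding gch_flux_def gch_source_def
    by (intro continuous_intros c1fun_continuous c1fun_deriv_continuous)+
  define M where "M = norm f + 1"
  have M1: "1 \<le> M" by (simp add: M_def)
  obtain K where "0 < K" and K': "gch_lipschitz k b M K"
    using gch_nonlinearities_lipschitz[OF M1] by blast
  have K: "\<bar>gch_flux k b p q - gch_flux k b 0 0\<bar> \<le> K * (\<bar>p\<bar> + \<bar>q\<bar>)"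
    "\<bar>gch_source k b p q - gch_source k b 0 0\<bar> \<le> K * (\<bar>p\<bar> + \<bar>q\<bar>)" if "\<bar>p\<bar> \<le> M" "\<bar>q\<bar> \<le> M" for p q
    using gch_lipschitzD(1,2)[OF K' that, of 0 0] M1 by auto
  have "\<bar>gch_flux k b (f y) (deriv f y)\<bar> \<le> \<bar>gch_flux k b 0 0\<bar> + \<bar>gch_source k b 0 0\<bar> + K * (M + M) \<and>
      \<bar>gch_source k b (f y) (deriv f y)\<bar> \<le> \<bar>gch_flux k b 0 0\<bar> + \<bar>gch_source k b 0 0\<bar> + K * (M + M)" for y
  proof -
    have m: "\<bar>f y\<bar> \<le> M" "\<bar>deriv f y\<bar> \<le> M"
      using c1fun_abs_le_norm[of f y] by (auto simp: M_def)
    then have "K * (\<bar>f y\<bar> + \<bar>deriv f y\<bar>) \<le> K * (M + M)"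
      using \<open>0 < K\<close> by (intro mult_left_mono) auto
    then show ?thesis
      using K[OF m] by linarith
  qed
  then show "\<exists>B. \<forall>y. \<bar>gch_flux k b (f y) (deriv f y)\<bar> \<le> B \<and> \<bar>gch_source k b (f y) (deriv f y)\<bar> \<le> B"
    by blast
qed

lemma nonlocal_P_split:
  fixes f :: c1fun
  obtains L1 R1 L2 R2 C where
    "\<And>x. DERIV L1 x :> gch_flux k b (f x) (deriv f x) - L1 x" "\<And>x. \<bar>L1 x\<bar> \<le> C"
    "\<And>x. DERIV R1 x :> R1 x - gch_flux k b (f x) (deriv f x)" "\<And>x. \<bar>R1 x\<bar> \<le> C"
    "\<And>x. DERIV L2 x :> gch_source k b (f x) (deriv f x) - L2 x" "\<And>x. \<bar>L2 x\<bar> \<le> C"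
    "\<And>x. DERIV R2 x :> R2 x - gch_source k b (f x) (deriv f x)" "\<And>x. \<bar>R2 x\<bar> \<le> C"
    "\<And>x. nonlocal_P k b f x = (L1 x - R1 x - L2 x - R2 x) / 2"
proof -
  obtain B where B: "\<And>y. \<bar>gch_flux k b (f y) (deriv f y)\<bar> \<le> B" "\<And>y. \<bar>gch_source k b (f y) (deriv f y)\<bar> \<le> B"
    using gch_densities_bounded_continuous(3)[of k b f] by blast
  define h1 where "h1 x = gch_flux k b (f x) (deriv f x)" for x
  obtain L1 R1 C1 where 1: "\<And>x. \<bar>L1 x\<bar> \<le> C1" "\<And>x. \<bar>R1 x\<bar> \<le> C1"
    "\<And>x. DERIV L1 x :> h1 x - L1 x" "\<And>x. DERIV R1 x :> R1 x - h1 x"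
    "\<And>x. helmholtz_inv h1 x = (L1 x + R1 x) / 2" "\<And>x. deriv (helmholtz_inv h1) x = (R1 x - L1 x) / 2"
    by (rule helmholtz_inv_split[of h1 B])
      (use B gch_densities_bounded_continuous(1) in \<open>auto simp: h1_def[abs_def]\<close>)
  define h2 where "h2 x = gch_source k b (f x) (deriv f x)" for x
  obtain L2 R2 C2 where 2: "\<And>x. \<bar>L2 x\<bar> \<le> C2" "\<And>x. \<bar>R2 x\<bar> \<le> C2"
    "\<And>x. DERIV L2 x :> h2 x - L2 x" "\<And>x. DERIV R2 x :> R2 x - h2 x"
    "\<And>x. helmholtz_inv h2 x = (L2 x + R2 x) / 2" "\<And>x. deriv (helmholtz_inv h2) x = (R2 x - L2 x) / 2"
    by (rule helmholtz_inv_split[of h2 B])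
      (use B gch_densities_bounded_continuous(2) in \<open>auto simp: h2_def[abs_def]\<close>)
  show ?thesis
  proof (rule that[of L1 "max C1 C2" R1 L2 R2])
    show "nonlocal_P k b f x = (L1 x - R1 x - L2 x - R2 x) / 2" for x
      unfolding nonlocal_P_eq h1_def[symmetric] h2_def[symmetric] 1(6) 2(5) by (simp add: field_simps)
  qed (use 1 2 in \<open>auto simp: le_max_iff_disj h1_def h2_def\<close>)
qed

text \<open>One derivative of the kernel is bounded, so the difference is controlled by local
  integrals alone. Differentiating once more produces the identity, since the second derivative of
  the kernel is the kernel minus a point mass; this is the pointwise term in the bound of
  \<open>d\<close>.\<close>

lemma nonlocal_P_diff:
  assumes "1 \<le> M" "0 < r"
  obtains K where "0 < K"
    "\<And>f g B. norm f \<le> M \<Longrightarrow> norm g \<le> M \<Longrightarrow>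
      \<forall>z. integral {z..z + r} (\<lambda>x. \<bar>apply_c1fun f x - apply_c1fun g x\<bar> + \<bar>deriv (apply_c1fun f) x - deriv (apply_c1fun g) x\<bar>) \<le> B \<Longrightarrow>
      \<exists>d. (\<forall>x. DERIV (\<lambda>x. nonlocal_P k b f x - nonlocal_P k b g x) x :> d x \<and>
        \<bar>nonlocal_P k b f x - nonlocal_P k b g x\<bar> \<le> K * B \<and>
        \<bar>d x\<bar> \<le> K * (\<bar>apply_c1fun f x - apply_c1fun g x\<bar> + \<bar>deriv (apply_c1fun f) x - deriv (apply_c1fun g) x\<bar>) + K * B)"
proof -
  obtain K0 where K0: "0 < K0" "gch_lipschitz k b M K0"
    using gch_nonlinearities_lipschitz[OF assms(1)] by blast
  define K1 where "K1 = K0 / (1 - exp (- r))"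
  have "exp (- r) < 1" using assms(2) by simp
  then have K1: "K1 > 0" using K0(1) by (simp add: K1_def)
  show ?thesis
  proof (rule that)
    show "0 < K0 + 2 * K1" using K0(1) K1 by simp
    fix f g :: c1fun and B
    assume M: "norm f \<le> M" "norm g \<le> M"
      and "\<forall>z. integral {z..z + r} (\<lambda>x. \<bar>f x - g x\<bar> + \<bar>deriv f x - deriv g x\<bar>) \<le> B"
    then have B: "integral {z..z + r} (\<lambda>x. \<bar>f x - g x\<bar> + \<bar>deriv f x - deriv g x\<bar>) \<le> B" for z
      by blast
    define e where "e x = \<bar>f x - g x\<bar> + \<bar>deriv f x - deriv g x\<bar>" for x
    have e: "continuous_on UNIV e"
      unfolding e_def by (intro continuous_intros c1fun_continuous c1fun_deriv_continuous)
    have "0 \<le> integral {0..0 + r} e"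
      by (rule integral_nonneg) (auto simp: e_def intro!: integrable_continuous_real continuous_intros c1fun_continuous c1fun_deriv_continuous)
    then have B0: "0 \<le> B" using B[of 0] by (simp add: e_def[abs_def])
    have m: "\<bar>f x\<bar> \<le> M" "\<bar>deriv f x\<bar> \<le> M" "\<bar>g x\<bar> \<le> M" "\<bar>deriv g x\<bar> \<le> M" for x
      using c1fun_abs_le_norm[of f x] c1fun_abs_le_norm[of g x] M by auto
    define h1 where "h1 x = gch_flux k b (f x) (deriv f x) - gch_flux k b (g x) (deriv g x)" for x
    define h2 where "h2 x = gch_source k b (f x) (deriv f x) - gch_source k b (g x) (deriv g x)" for x
    have h: "\<bar>h1 x\<bar> \<le> K0 * e x" "\<bar>h2 x\<bar> \<le> K0 * e x" for x
      using gch_lipschitzD(1,2)[OF K0(2) m, of x x] by (auto simp: h1_def h2_def e_def)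
    have e': "continuous_on UNIV (\<lambda>x. K0 * e x)" by (intro continuous_intros e)
    have iB: "integral {z..z + r} (\<lambda>x. K0 * e x) \<le> K0 * B" for z
      using B[of z] K0(1) by (simp add: e_def[abs_def])
    obtain L1 R1 L2 R2 C where F: 
      "\<And>x. DERIV L1 x :> gch_flux k b (f x) (deriv f x) - L1 x" "\<And>x. \<bar>L1 x\<bar> \<le> C"
      "\<And>x. DERIV R1 x :> R1 x - gch_flux k b (f x) (deriv f x)" "\<And>x. \<bar>R1 x\<bar> \<le> C"
      "\<And>x. DERIV L2 x :> gch_source k b (f x) (deriv f x) - L2 x" "\<And>x. \<bar>L2 x\<bar> \<le> C"
      "\<And>x. DERIV R2 x :> R2 x - gch_source k b (f x) (deriv f x)" "\<And>x. \<bar>R2 x\<bar> \<le> C"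
      "\<And>x. nonlocal_P k b f x = (L1 x - R1 x - L2 x - R2 x) / 2"
      by (rule nonlocal_P_split[where f = f and k = k and b = b]) (rule that)
    obtain L1' R1' L2' R2' C' where G: 
      "\<And>x. DERIV L1' x :> gch_flux k b (g x) (deriv g x) - L1' x" "\<And>x. \<bar>L1' x\<bar> \<le> C'"
      "\<And>x. DERIV R1' x :> R1' x - gch_flux k b (g x) (deriv g x)" "\<And>x. \<bar>R1' x\<bar> \<le> C'"
      "\<And>x. DERIV L2' x :> gch_source k b (g x) (deriv g x) - L2' x" "\<And>x. \<bar>L2' x\<bar> \<le> C'"
      "\<And>x. DERIV R2' x :> R2' x - gch_source k b (g x) (deriv g x)" "\<And>x. \<bar>R2' x\<bar> \<le> C'"
      "\<And>x. nonlocal_P k b g x = (L1' x - R1' x - L2' x - R2' x) / 2"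
      by (rule nonlocal_P_split[where f = g and k = k and b = b]) (rule that)
    have bL: "\<bar>l x - l' x\<bar> \<le> K1 * B"
      if "\<And>x. DERIV (\<lambda>x. l x - l' x) x :> hh x - (l x - l' x)" "\<And>x. \<bar>hh x\<bar> \<le> K0 * e x"
        "\<And>x. \<bar>l x\<bar> \<le> C" "\<And>x. \<bar>l' x\<bar> \<le> C'" for l l' hh x
    proof -
      have "\<bar>l x - l' x\<bar> \<le> C + C'" for x using that(3)[of x] that(4)[of x] by linarith
      from exp_decay_sup_bound[OF that(1,2) this e' assms(2) iB] show ?thesis
        by (simp add: K1_def)
    qed
    have bR: "\<bar>l x - l' x\<bar> \<le> K1 * B"
      if "\<And>x. DERIV (\<lambda>x. l x - l' x) x :> (l x - l' x) - hh x" "\<And>x. \<bar>hh x\<bar> \<le> K0 * e x"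
        "\<And>x. \<bar>l x\<bar> \<le> C" "\<And>x. \<bar>l' x\<bar> \<le> C'" for l l' hh x
    proof -
      have "\<bar>l x - l' x\<bar> \<le> C + C'" for x using that(3)[of x] that(4)[of x] by linarith
      from exp_growth_sup_bound[OF that(1,2) this e' assms(2) iB] show ?thesis
        by (simp add: K1_def)
    qed
    have D: "DERIV (\<lambda>x. L1 x - L1' x) x :> h1 x - (L1 x - L1' x)"
      "DERIV (\<lambda>x. R1 x - R1' x) x :> (R1 x - R1' x) - h1 x" 
      "DERIV (\<lambda>x. L2 x - L2' x) x :> h2 x - (L2 x - L2' x)"
      "DERIV (\<lambda>x. R2 x - R2' x) x :> (R2 x - R2' x) - h2 x" for x
      by (rule derivative_eq_intros F G refl | simp add: h1_def h2_def)+
    have bd: "\<bar>L1 x - L1' x\<bar> \<le> K1 * B" "\<bar>R1 x - R1' x\<bar> \<le> K1 * B" 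
      "\<bar>L2 x - L2' x\<bar> \<le> K1 * B" "\<bar>R2 x - R2' x\<bar> \<le> K1 * B" for x
      using bL[OF D(1) h(1) F(2) G(2)] bR[OF D(2) h(1) F(4) G(4)] bL[OF D(3) h(2) F(6) G(6)]
        bR[OF D(4) h(2) F(8) G(8)] by auto
    \<comment> \<open>\<open>h1\<close> is the contribution of the point mass; the remaining terms
      are again half-line integrals.\<close>
    define d where "d x = h1 x - ((L1 x - L1' x) + (R1 x - R1' x) - (L2 x - L2' x) + (R2 x - R2' x)) / 2" for x
    have d1: "DERIV (\<lambda>x. ((L1 x - L1' x) - (R1 x - R1' x) - (L2 x - L2' x) - (R2 x - R2' x)) / 2) x :> d x" for x
    proof -
      have "DERIV (\<lambda>x. ((L1 x - L1' x) - (R1 x - R1' x) - (L2 x - L2' x) - (R2 x - R2' x)) / 2) x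
        :> ((h1 x - (L1 x - L1' x)) - ((R1 x - R1' x) - h1 x) - (h2 x - (L2 x - L2' x)) - ((R2 x - R2' x) - h2 x)) / 2"
        by (intro DERIV_cdivide DERIV_diff D)
      moreover have "((h1 x - (L1 x - L1' x)) - ((R1 x - R1' x) - h1 x) - (h2 x - (L2 x - L2' x)) - ((R2 x - R2' x) - h2 x)) / 2 = d x"
        by (simp add: d_def field_simps)
      ultimately show ?thesis by (rule DERIV_cong)
    qed
    have half_sum: "\<bar>(p - q - s - t) / 2\<bar> \<le> 2 * c" if "\<bar>p\<bar> \<le> c" "\<bar>q\<bar> \<le> c" "\<bar>s\<bar> \<le> c" "\<bar>t\<bar> \<le> c"
      for p q s t c :: real
    proof -
      have "\<bar>p - q - s - t\<bar> \<le> 4 * c" using that by linarith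
      then show ?thesis by simp
    qed
    have eq: "nonlocal_P k b f x - nonlocal_P k b g x =
      ((L1 x - L1' x) - (R1 x - R1' x) - (L2 x - L2' x) - (R2 x - R2' x)) / 2" for x
      unfolding F(9) G(9) by (simp add: diff_divide_distrib)
    have le: "2 * (K1 * B) \<le> (K0 + 2 * K1) * B"
      using B0 K0(1) by (simp add: distrib_right)
    have "\<bar>nonlocal_P k b f x - nonlocal_P k b g x\<bar> \<le> 2 * (K1 * B)" for x
      unfolding eq by (rule half_sum) (rule bd)+
    with le have d2: "\<bar>nonlocal_P k b f x - nonlocal_P k b g x\<bar> \<le> (K0 + 2 * K1) * B" for x
      using order_trans by blast
    have "\<bar>d x\<bar> \<le> K0 * e x + 2 * (K1 * B)" for x
    proof -
      have "\<bar>((L1 x - L1' x) - - (R1 x - R1' x) - (L2 x - L2' x) - - (R2 x - R2' x)) / 2\<bar> \<le> 2 * (K1 * B)"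
        by (rule half_sum) (use bd[of x] in simp_all)
      moreover have "d x = h1 x - ((L1 x - L1' x) - - (R1 x - R1' x) - (L2 x - L2' x) - - (R2 x - R2' x)) / 2"
        by (simp add: d_def)
      ultimately show ?thesis
        using h(1)[of x] abs_triangle_ineq4 add_mono order_trans by metis
    qed
    moreover have "K0 * e x \<le> (K0 + 2 * K1) * e x" for x
      using K1 by (intro mult_right_mono) (auto simp: e_def)
    ultimately have d3: "\<bar>d x\<bar> \<le> (K0 + 2 * K1) * e x + (K0 + 2 * K1) * B" for x
      using le by (meson add_mono order_trans)
    show "\<exists>d. (\<forall>x. DERIV (\<lambda>x. nonlocal_P k b f x - nonlocal_P k b g x) x :> d x \<and>
        \<bar>nonlocal_P k b f x - nonlocal_P k b g x\<bar> \<le> (K0 + 2 * K1) * B \<and>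
        \<bar>d x\<bar> \<le> (K0 + 2 * K1) * (\<bar>f x - g x\<bar> + \<bar>deriv f x - deriv g x\<bar>) + (K0 + 2 * K1) * B)"
      using d1 d2 d3 unfolding eq[symmetric] e_def by (intro exI[of _ d] allI conjI)
  qed
qed

section \<open>Uniqueness\<close>

lemma gch_solution_continuous_on: "gch_solution k b T u0 u \<Longrightarrow> continuous_on {0..T} u"
  by (simp add: gch_solution_def CT_C1_def)

lemma gch_solution_bounded:
  assumes "gch_solution k b T u0 u"
  obtains M where "1 \<le> M" "\<And>t. t \<in> {0..T} \<Longrightarrow> norm (u t) \<le> M"
proof -
  have "bounded (u ` {0..T})"
    using gch_solution_continuous_on[OF assms] by (intro compact_imp_bounded compact_continuous_image) auto
  then obtain B where B: "\<And>t. t \<in> {0..T} \<Longrightarrow> norm (u t) \<le> B"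
    unfolding bounded_iff by blast
  show ?thesis
    by (rule that[of "max 1 B"]) (use B in \<open>simp_all add: le_max_iff_disj\<close>)
qed

text \<open>Picard iteration, with the value prescribed at the final time: a difference of solutions
  at time \<open>t1\<close> is to be followed back to \<open>t0\<close>, where it vanishes.\<close>

lemma characteristic_exists:
  fixes a :: "real \<Rightarrow> real \<Rightarrow> real"
  assumes "t0 \<le> t1" and cont: "continuous_on ({t0..t1} \<times> UNIV) (\<lambda>(s, x). a s x)"
    and bdd: "\<And>s x. s \<in> {t0..t1} \<Longrightarrow> \<bar>a s x\<bar> \<le> A"
    and lip: "\<And>s x z. s \<in> {t0..t1} \<Longrightarrow> \<bar>a s x - a s z\<bar> \<le> L * \<bar>x - z\<bar>"
    and small: "L * (t1 - t0) \<le> 1 / 2" "0 \<le> L"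
  obtains y where "y t1 = x" "\<And>s. s \<in> {t0..t1} \<Longrightarrow> (y has_real_derivative a s (y s)) (at s within {t0..t1})"
proof -
  have cont_comp: "continuous_on {t0..t1} (\<lambda>s. a s (apply_bcontfun y s))" for y
  proof -
    have "continuous_on {t0..t1} (\<lambda>s. (s, apply_bcontfun y s))"
      by (intro continuous_intros continuous_on_apply_bcontfun)
    from continuous_on_compose2[OF cont this] show ?thesis by auto
  qed
  then have int: "(\<lambda>s. a s (apply_bcontfun y s)) integrable_on {t..t1}" if "t0 \<le> t" for y t
    using that by (intro integrable_continuous_real continuous_on_subset[OF cont_comp]) auto
  \<comment> \<open>The fixed point is sought among bounded continuous functions on the whole line;
    clamping the time extends the integral equation to all \<open>s\<close>.\<close>
  define cl where "cl s = max t0 (min t1 s)" for s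
  have cl: "cl s \<in> {t0..t1}" for s
    using \<open>t0 \<le> t1\<close> by (auto simp: cl_def)
  define G where "G y s = x - integral {cl s..t1} (\<lambda>\<sigma>. a \<sigma> (apply_bcontfun y \<sigma>))" for y s
  have G: "G y \<in> bcontfun" for y
    unfolding bcontfun_def mem_Collect_eq
  proof
    have "continuous_on {t0..t1} (\<lambda>s. integral {s..t1} (\<lambda>\<sigma>. a \<sigma> (apply_bcontfun y \<sigma>)))"
      by (rule indefinite_integral_continuous_1') (rule int[OF order_refl])
    moreover have "continuous_on UNIV cl"
      unfolding cl_def by (intro continuous_intros)
    ultimately have "continuous_on UNIV (\<lambda>s. integral {cl s..t1} (\<lambda>\<sigma>. a \<sigma> (apply_bcontfun y \<sigma>)))"
      by (rule continuous_on_compose2) (use cl in blast)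
    then show "continuous_on UNIV (G y)"
      unfolding G_def by (rule continuous_on_diff[OF continuous_on_const])
    have "norm (G y s) \<le> \<bar>x\<bar> + A * (t1 - t0)" for s
    proof -
      have "A \<ge> 0" using bdd[of t0 0] \<open>t0 \<le> t1\<close> by fastforce
      have "norm (integral {cl s..t1} (\<lambda>\<sigma>. a \<sigma> (apply_bcontfun y \<sigma>))) \<le> A * (t1 - cl s)"
        using cl[of s] by (intro integral_bound bdd continuous_on_subset[OF cont_comp]) (auto intro!: bdd)
      also have "\<dots> \<le> A * (t1 - t0)"
        using cl[of s] \<open>A \<ge> 0\<close> by (intro mult_left_mono) auto
      finally show ?thesis unfolding G_def by simp
    qed
    then show "bounded (range (G y))" unfolding bounded_iff by blast
  qed
  have "dist (Bcontfun (G y)) (Bcontfun (G z)) \<le> 1 / 2 * dist y z" for y z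
  proof (rule dist_bound)
    fix s
    have "\<bar>a \<sigma> (apply_bcontfun y \<sigma>) - a \<sigma> (apply_bcontfun z \<sigma>)\<bar> \<le> L * dist y z" if "\<sigma> \<in> {t0..t1}" for \<sigma>
      using order_trans[OF lip[OF that] mult_left_mono[OF dist_bounded[of y \<sigma> z, unfolded dist_real_def] small(2)]] .
    then have "norm (integral {cl s..t1} (\<lambda>\<sigma>. a \<sigma> (apply_bcontfun y \<sigma>) - a \<sigma> (apply_bcontfun z \<sigma>))) \<le> L * dist y z * (t1 - cl s)"
      using cl[of s] by (intro integral_bound continuous_intros continuous_on_subset[OF cont_comp]) auto
    also have "\<dots> \<le> L * dist y z * (t1 - t0)"
      using cl[of s] small(2) by (intro mult_left_mono) auto
    also have "\<dots> = (L * (t1 - t0)) * dist y z"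
      by simp
    also have "\<dots> \<le> 1 / 2 * dist y z"
      using small by (intro mult_right_mono) auto
    finally have "\<bar>integral {cl s..t1} (\<lambda>\<sigma>. a \<sigma> (apply_bcontfun y \<sigma>)) - integral {cl s..t1} (\<lambda>\<sigma>. a \<sigma> (apply_bcontfun z \<sigma>))\<bar>
        \<le> 1 / 2 * dist y z"
      using cl[of s] by (simp add: integral_diff int)
    then show "dist (apply_bcontfun (Bcontfun (G y)) s) (apply_bcontfun (Bcontfun (G z)) s) \<le> 1 / 2 * dist y z"
      by (simp add: Bcontfun_inverse[OF G] G_def dist_real_def abs_minus_commute)
  qed
  then obtain y where "Bcontfun (G y) = y"
    using banach_fix_type[of "1 / 2" "\<lambda>y. Bcontfun (G y)"] by auto
  then have fixed: "apply_bcontfun y s = G y s" for s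
    using Bcontfun_inverse[OF G, of y] by simp
  show ?thesis
  proof (rule that[of "apply_bcontfun y"])
    show "apply_bcontfun y t1 = x"
      using \<open>t0 \<le> t1\<close> by (subst fixed) (simp add: G_def cl_def)
    fix s assume s: "s \<in> {t0..t1}"
    have "((\<lambda>s. integral {s..t1} (\<lambda>\<sigma>. a \<sigma> (apply_bcontfun y \<sigma>))) has_real_derivative - a s (apply_bcontfun y s))
        (at s within {t0..t1})"
      by (rule integral_has_real_derivative'[OF cont_comp s])
    then have "((\<lambda>s. x - integral {s..t1} (\<lambda>\<sigma>. a \<sigma> (apply_bcontfun y \<sigma>))) has_real_derivative a s (apply_bcontfun y s))
        (at s within {t0..t1})"
      by (auto intro!: derivative_eq_intros)
    then show "(apply_bcontfun y has_real_derivative a s (apply_bcontfun y s)) (at s within {t0..t1})"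
      by (rule has_field_derivative_transform_within[OF _ zero_less_one s])
        (subst fixed, simp add: G_def cl_def)
  qed
qed

text \<open>Curves in the wrong order at \<open>s\<close> would have to meet at some later
  \<open>r\<close>. The squared distance with weight \<open>exp (2 * L * \<sigma>)\<close> is
  nondecreasing and is zero at \<open>r\<close>, so it is already zero at \<open>s\<close>. Order is
  what lets variation sums telescope along characteristics.\<close>

lemma characteristics_ordered:
  fixes a :: "real \<Rightarrow> real \<Rightarrow> real"
  assumes y: "\<And>s. s \<in> {t0..t1} \<Longrightarrow> (y has_real_derivative a s (y s)) (at s within {t0..t1})"
    and z: "\<And>s. s \<in> {t0..t1} \<Longrightarrow> (z has_real_derivative a s (z s)) (at s within {t0..t1})"
    and lip: "\<And>s x z. s \<in> {t0..t1} \<Longrightarrow> \<bar>a s x - a s z\<bar> \<le> L * \<bar>x - z\<bar>"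
    and le: "y t1 \<le> z t1" and s: "s \<in> {t0..t1}"
  shows "y s \<le> z s"
proof (rule ccontr)
  assume neg: "\<not> y s \<le> z s"
  have cont: "continuous_on {t0..t1} y" "continuous_on {t0..t1} z"
    by (rule DERIV_continuous_on, erule y, rule DERIV_continuous_on, erule z)
  then have c: "continuous_on {s..t1} (\<lambda>s. z s - y s)"
    using s by (intro continuous_intros) (auto intro: continuous_on_subset)
  obtain r where r: "s \<le> r" "r \<le> t1" "z r - y r = 0"
    using IVT'[of "\<lambda>s. z s - y s" s 0 t1, OF _ _ _ c] neg le s by auto
  define E where "E \<sigma> = (z \<sigma> - y \<sigma>)\<^sup>2 * exp (2 * L * \<sigma>)" for \<sigma>
  have "E s \<le> E r"
  proof (rule DERIV_nonneg_imp_increasing_open[OF r(1)])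
    fix \<sigma> assume \<sigma>: "s < \<sigma>" "\<sigma> < r"
    then have "\<sigma> \<in> {t0<..<t1}" using s r by auto
    then have at: "at \<sigma> within {t0..t1} = at \<sigma>" "\<sigma> \<in> {t0..t1}" by (auto simp: at_within_Icc_at)
    define w where "w = z \<sigma> - y \<sigma>"
    define g where "g = a \<sigma> (z \<sigma>) - a \<sigma> (y \<sigma>)"
    have "DERIV E \<sigma> :> (2 * w * g + 2 * L * w\<^sup>2) * exp (2 * L * \<sigma>)"
      unfolding E_def w_def g_def using y[OF at(2)] z[OF at(2)] unfolding at
      by (auto intro!: derivative_eq_intros simp: algebra_simps power2_eq_square)
    moreover have "- (w * g) \<le> \<bar>w\<bar> * \<bar>g\<bar>"
      by (metis abs_ge_minus_self abs_mult)
    moreover have "\<bar>w\<bar> * \<bar>g\<bar> \<le> \<bar>w\<bar> * (L * \<bar>w\<bar>)"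
      using lip[OF at(2)] by (intro mult_left_mono) (auto simp: w_def g_def)
    moreover have "\<bar>w\<bar> * (L * \<bar>w\<bar>) = L * w\<^sup>2"
      by (simp add: power2_eq_square)
    ultimately show "\<exists>d. DERIV E \<sigma> :> d \<and> 0 \<le> d"
      by (intro exI conjI) (auto intro!: mult_nonneg_nonneg simp: mult.assoc)
  next
    show "continuous_on {s..r} E"
      unfolding E_def using s r
      by (intro continuous_intros continuous_on_subset[OF cont(1)] continuous_on_subset[OF cont(2)]) auto
  qed
  then have "(z s - y s)\<^sup>2 * exp (2 * L * s) \<le> 0"
    by (simp add: E_def r(3))
  then have "z s = y s"
    by (simp add: mult_le_0_iff not_le power2_eq_iff)
  then show False using neg by simp
qed

lemma c1fun_curve_has_derivative:
  fixes u :: "real \<Rightarrow> c1fun"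
  assumes u: "((\<lambda>s. c1_val (u s)) has_vector_derivative v) (at t within S)"
    and y: "(y has_real_derivative y') (at t within S)"
  shows "((\<lambda>s. u s (y s)) has_real_derivative v (y t) + deriv (u t) (y t) * y') (at t within S)"
proof -
  have yc: "(y \<longlongrightarrow> y t) (at t within S)"
    using y by (metis DERIV_continuous continuous_within)
  have "((\<lambda>s. u t (y s)) has_real_derivative deriv (u t) (y t) * y') (at t within S)"
    by (rule DERIV_chain2[OF c1fun_has_deriv y])
  then have 1: "((\<lambda>s. (u t (y s) - u t (y t)) / (s - t)) \<longlongrightarrow> deriv (u t) (y t) * y') (at t within S)"
    by (simp add: has_field_derivative_iff)
  define q where "q s = (c1_val (u s) - c1_val (u t)) /\<^sub>R (s - t)" for s
  have q: "(q \<longlongrightarrow> v) (at t within S)"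
  proof (rule iffD2[OF tendsto_dist_iff], rule Lim_transform_eventually)
    show "((\<lambda>s. norm ((1 / norm (s - t)) *\<^sub>R (c1_val (u s) - (c1_val (u t) + (s - t) *\<^sub>R v)))) \<longlongrightarrow> 0) (at t within S)"
      using u unfolding has_vector_derivative_def has_derivative_within by (intro tendsto_norm_zero) auto
    show "\<forall>\<^sub>F s in at t within S. norm ((1 / norm (s - t)) *\<^sub>R (c1_val (u s) - (c1_val (u t) + (s - t) *\<^sub>R v))) = dist (q s) v"
    proof (rule eventually_at[THEN iffD2], intro exI[of _ 1] conjI ballI impI zero_less_one)
      fix s assume "s \<noteq> t \<and> dist s t < 1"
      then have "v = (1 / (s - t)) *\<^sub>R ((s - t) *\<^sub>R v)" by simp
      then have "q s - v = (1 / (s - t)) *\<^sub>R (c1_val (u s) - c1_val (u t)) - (1 / (s - t)) *\<^sub>R ((s - t) *\<^sub>R v)"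
        by (simp only: q_def divide_inverse mult_1)
      then have "q s - v = (1 / (s - t)) *\<^sub>R (c1_val (u s) - (c1_val (u t) + (s - t) *\<^sub>R v))"
        by (simp only: scaleR_diff_right[symmetric] diff_diff_eq)
      then show "norm ((1 / norm (s - t)) *\<^sub>R (c1_val (u s) - (c1_val (u t) + (s - t) *\<^sub>R v))) = dist (q s) v"
        by (simp add: dist_norm)
    qed
  qed
  have "((\<lambda>s. q s (y s) - v (y s)) \<longlongrightarrow> 0) (at t within S)"
  proof (rule Lim_null_comparison)
    show "\<forall>\<^sub>F s in at t within S. norm (q s (y s) - v (y s)) \<le> dist (q s) v"
      by (intro always_eventually) (metis dist_bounded dist_norm)
    show "((\<lambda>s. dist (q s) v) \<longlongrightarrow> 0) (at t within S)"
      by (rule iffD1[OF tendsto_dist_iff q])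
  qed
  moreover have "((\<lambda>s. v (y s)) \<longlongrightarrow> v (y t)) (at t within S)"
  proof (rule isCont_tendsto_compose[OF _ yc])
    have "continuous_on UNIV (apply_bcontfun v)" by simp
    then show "isCont (apply_bcontfun v) (y t)"
      using continuous_on_eq_continuous_at[OF open_UNIV] by blast
  qed
  ultimately have "((\<lambda>s. q s (y s) - v (y s) + v (y s)) \<longlongrightarrow> 0 + v (y t)) (at t within S)"
    by (rule tendsto_add)
  then have 2: "((\<lambda>s. (u s (y s) - u t (y s)) / (s - t)) \<longlongrightarrow> v (y t)) (at t within S)"
    by (simp add: q_def apply_c1_val divide_inverse mult.commute)
  show ?thesis
    unfolding has_field_derivative_iff using tendsto_add[OF 2 1]
    by (simp add: add_divide_distrib[symmetric])
qed

text \<open>The slope of a difference of solutions need not be differentiable along characteristics,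
  only the difference itself is. Its local L^1 norm is therefore reached through variation sums;
  equidistant grids suffice since the slope is continuous.\<close>

lemma integral_abs_deriv_le_variation:
  fixes f f' :: "real \<Rightarrow> real"
  assumes D: "\<And>x. DERIV f x :> f' x" and cont: "continuous_on UNIV f'" and r: "0 < r"
    and var: "\<And>n. (\<Sum>i<n. \<bar>f (z + real (Suc i) * (r / real n)) - f (z + real i * (r / real n))\<bar>) \<le> S"
  shows "integral {z..z + r} (\<lambda>x. \<bar>f' x\<bar>) \<le> S"
proof (rule field_le_epsilon)
  fix \<epsilon> :: real assume "0 < \<epsilon>"
  have ca: "continuous_on UNIV (\<lambda>x. \<bar>f' x\<bar>)" by (intro continuous_intros cont)
  obtain G where G: "\<And>x. DERIV G x :> \<bar>f' x\<bar>"
    using continuous_real_antiderivative[OF ca] by blast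
  have "uniformly_continuous_on {z..z + r} f'"
    by (intro compact_uniformly_continuous continuous_on_subset[OF cont]) auto
  moreover have "0 < \<epsilon> / r" using \<open>0 < \<epsilon>\<close> r by simp
  ultimately obtain d where d: "d > 0" "\<And>x y. x \<in> {z..z + r} \<Longrightarrow> y \<in> {z..z + r} \<Longrightarrow> \<bar>y - x\<bar> < d \<Longrightarrow> \<bar>f' y - f' x\<bar> < \<epsilon> / r"
    unfolding uniformly_continuous_on_def dist_real_def by metis
  obtain n where n: "r / d < real n" using reals_Archimedean2 by blast
  have n0: "0 < real n" using n r d(1) by (smt (verit) divide_pos_pos)
  define \<delta> where "\<delta> = r / real n"
  have \<delta>: "0 < \<delta>" "\<delta> < d" "real n * \<delta> = r"
    using n n0 r d(1) by (auto simp: \<delta>_def field_simps)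
  define X where "X i = z + real i * \<delta>" for i :: nat
  have "G (X (Suc i)) - G (X i) \<le> \<bar>f (X (Suc i)) - f (X i)\<bar> + \<epsilon> / r * \<delta>" if "i < n" for i
  proof -
    have lt: "X i < X (Suc i)" and e: "X (Suc i) - X i = \<delta>" using \<delta> by (auto simp: X_def algebra_simps)
    have "real (Suc i) * \<delta> \<le> real n * \<delta>"
      using that \<delta> by (intro mult_right_mono) auto
    then have up: "X (Suc i) \<le> z + r" using \<delta>(3) by (simp add: X_def)
    have low: "z \<le> X i" using \<delta> by (simp add: X_def)
    obtain p where p: "X i < p" "p < X (Suc i)" "G (X (Suc i)) - G (X i) = \<delta> * \<bar>f' p\<bar>"
      using MVT2[OF lt, of G "\<lambda>x. \<bar>f' x\<bar>"] G e by auto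
    obtain q where q: "X i < q" "q < X (Suc i)" "f (X (Suc i)) - f (X i) = \<delta> * f' q"
      using MVT2[OF lt, of f f'] D e by auto
    have "\<bar>f' p - f' q\<bar> < \<epsilon> / r"
      using p q low up \<delta>(2) e by (intro d(2)) auto
    then have "\<bar>f' p\<bar> \<le> \<bar>f' q\<bar> + \<epsilon> / r" by linarith
    then have "\<delta> * \<bar>f' p\<bar> \<le> \<delta> * (\<bar>f' q\<bar> + \<epsilon> / r)"
      using \<delta>(1) by (intro mult_left_mono) auto
    then show ?thesis
      unfolding p(3) q(3) using \<delta>(1) by (simp add: abs_mult algebra_simps)
  qed
  then have "(\<Sum>i<n. G (X (Suc i)) - G (X i)) \<le> (\<Sum>i<n. \<bar>f (X (Suc i)) - f (X i)\<bar> + \<epsilon> / r * \<delta>)"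
    by (intro sum_mono) auto
  also have "\<dots> = (\<Sum>i<n. \<bar>f (X (Suc i)) - f (X i)\<bar>) + \<epsilon>"
    using \<delta> n0 r by (simp add: sum.distrib \<delta>_def)
  also have "\<dots> \<le> S + \<epsilon>"
    using var[of n] by (simp add: X_def \<delta>_def)
  finally have "G (X n) - G (X 0) \<le> S + \<epsilon>"
    using sum_lessThan_telescope[of "\<lambda>i. G (X i)" n] by simp
  moreover have "((\<lambda>x. \<bar>f' x\<bar>) has_integral (G (z + r) - G z)) {z..z + r}"
    using r G by (intro fundamental_theorem_of_calculus)
      (auto simp: has_real_derivative_iff_has_vector_derivative intro: has_vector_derivative_at_within)
  ultimately show "integral {z..z + r} (\<lambda>x. \<bar>f' x\<bar>) \<le> S + \<epsilon>"
    using \<delta>(3) by (simp add: X_def integral_unique)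
qed

lemma DERIV_dominated_increment:
  fixes f F :: "real \<Rightarrow> real"
  assumes "\<And>x. DERIV f x :> f' x" "\<And>x. DERIV F x :> F' x" "\<And>x. \<bar>f' x\<bar> \<le> F' x" "x \<le> y"
  shows "\<bar>f y - f x\<bar> \<le> F y - F x"
proof -
  have "F x - f x \<le> F y - f y"
  proof (rule DERIV_nonneg_imp_nondecreasing[OF assms(4)])
    show "\<exists>d. DERIV (\<lambda>z. F z - f z) z :> d \<and> 0 \<le> d" for z
      using DERIV_diff[OF assms(2)[of z] assms(1)[of z]] abs_le_D1[OF assms(3)[of z]] by (metis diff_ge_0_iff_ge)
  qed
  moreover have "F x + f x \<le> F y + f y"
  proof (rule DERIV_nonneg_imp_nondecreasing[OF assms(4)])
    show "\<exists>d. DERIV (\<lambda>z. F z + f z) z :> d \<and> 0 \<le> d" for z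
      using DERIV_add[OF assms(2)[of z] assms(1)[of z]] abs_le_D2[OF assms(3)[of z]]
      by (metis add.commute diff_ge_0_iff_ge diff_minus_eq_add)
  qed
  ultimately show ?thesis by linarith
qed

text \<open>The distance in which differences contract: L^\<infinity> together with a uniformly
  local W^{1,1} norm. It has to be local because the waves do not decay.\<close>

definition w11_close :: "real \<Rightarrow> real \<Rightarrow> c1fun \<Rightarrow> c1fun \<Rightarrow> bool"
  where "w11_close r B f g \<longleftrightarrow> (\<forall>x. \<bar>f x - g x\<bar> \<le> B) \<and>
    (\<forall>z. integral {z..z + r} (\<lambda>x. \<bar>deriv f x - deriv g x\<bar>) \<le> B)"

text \<open>Bounded variation on windows of length \<open>l\<close>, uniformly in their position.
  The dominating \<open>W\<close> stands for the variation function, so sums over ordered points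
  telescope without a supremum over partitions.\<close>

definition locally_bv :: "real \<Rightarrow> real \<Rightarrow> (real \<Rightarrow> real) \<Rightarrow> bool"
  where "locally_bv l C f \<longleftrightarrow> (\<forall>a. \<exists>W. W (a + l) - W a \<le> C \<and>
    (\<forall>x y. a \<le> x \<longrightarrow> x \<le> y \<longrightarrow> y \<le> a + l \<longrightarrow> \<bar>f y - f x\<bar> \<le> W y - W x))"

lemma c1fun_curve_continuous:
  fixes v :: "real \<Rightarrow> c1fun"
  assumes "continuous_on S v"
  shows "continuous_on (S \<times> UNIV) (\<lambda>(s, x). v s x)"
  unfolding continuous_on_def
proof
  fix p0 assume p0: "p0 \<in> S \<times> (UNIV :: real set)"
  obtain s0 x0 where p: "p0 = (s0, x0)" by (cases p0)
  let ?F = "at p0 within S \<times> UNIV"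
  have 1: "((\<lambda>p. fst p) \<longlongrightarrow> s0) ?F" "((\<lambda>p. snd p) \<longlongrightarrow> x0) ?F"
    unfolding p by (auto intro!: tendsto_eq_intros)
  have vs: "((\<lambda>p. v (fst p)) \<longlongrightarrow> v s0) ?F"
  proof -
    have "continuous_on (S \<times> (UNIV :: real set)) (\<lambda>p. v (fst p))"
      by (intro continuous_on_compose2[OF assms] continuous_intros) auto
    then show ?thesis using p0 by (auto simp: continuous_on_def p)
  qed
  have "((\<lambda>p. (v (fst p) - v s0) (snd p)) \<longlongrightarrow> 0) ?F"
  proof (rule Lim_null_comparison)
    show "\<forall>\<^sub>F p in ?F. norm ((v (fst p) - v s0) (snd p)) \<le> norm (v (fst p) - v s0)"
      by (intro always_eventually allI) (simp add: c1fun_abs_le_norm)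
    show "((\<lambda>p. norm (v (fst p) - v s0)) \<longlongrightarrow> 0) ?F"
      by (intro tendsto_norm_zero LIM_zero vs)
  qed
  moreover have "((\<lambda>p. v s0 (snd p)) \<longlongrightarrow> v s0 x0) ?F"
    by (rule isCont_tendsto_compose[OF DERIV_isCont[OF c1fun_has_deriv] 1(2)])
  ultimately have "((\<lambda>p. (v (fst p) - v s0) (snd p) + v s0 (snd p)) \<longlongrightarrow> 0 + v s0 x0) ?F"
    by (rule tendsto_add)
  then show "((\<lambda>(s, x). v s x) \<longlongrightarrow> (case p0 of (s, x) \<Rightarrow> v s x)) ?F"
    by (simp add: apply_c1fun_diff p split_def)
qed

text \<open>
  With \<open>w = v - u\<close> one has \<open>w\<^sub>t + v\<^sup>k w\<^sub>x = F\<close>, where \<open>F = P(v) - P(u) - (v\<^sup>k - u\<^sup>k) u\<^sub>x\<close>. The sums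
  \<open>\<Sum> \<bar>w(x\<^sub>i\<^sub>+\<^sub>1) - w(x\<^sub>i)\<bar>\<close> are transported along the characteristics of \<open>v\<^sup>k\<close>, and the variation of \<open>F\<close> is
  bounded by local \<open>L\<^sup>1\<close> norms of \<open>w\<close> and \<open>w\<^sub>x\<close>; only the variation of \<open>u\<^sub>x\<close> enters, so that \<open>u\<^sub>x\<close> need
  not be Lipschitz.
\<close>

lemma gch_difference_contracts:
  assumes u: "gch_solution k b T u0 u" and v: "gch_solution k b T v0 v"
    and bv: "0 < l" "\<And>t. t \<in> {0..T} \<Longrightarrow> locally_bv l C (deriv (apply_c1fun (u t)))"
  obtains K \<tau> where "0 < K" "0 < \<tau>"
    "\<And>t0 t1 B t. 0 \<le> t0 \<Longrightarrow> t1 \<le> T \<Longrightarrow> t1 \<le> t0 + \<tau> \<Longrightarrow> u t0 = v t0 \<Longrightarrow>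
      \<forall>s\<in>{t0..t1}. w11_close (l / 2) B (v s) (u s) \<Longrightarrow> t \<in> {t0..t1} \<Longrightarrow>
      w11_close (l / 2) (K * (t - t0) * B) (v t) (u t)"
proof -
  obtain Mu where Mu: "1 \<le> Mu" "\<And>t. t \<in> {0..T} \<Longrightarrow> norm (u t) \<le> Mu"
    using gch_solution_bounded[OF u] by blast
  obtain Mv where Mv: "1 \<le> Mv" "\<And>t. t \<in> {0..T} \<Longrightarrow> norm (v t) \<le> Mv"
    using gch_solution_bounded[OF v] by blast
  define M where "M = max Mu Mv"
  have M1: "1 \<le> M" using Mu(1) by (simp add: M_def le_max_iff_disj)
  have Mn: "norm (u t) \<le> M" "norm (v t) \<le> M" if "t \<in> {0..T}" for t
    using Mu(2)[OF that] Mv(2)[OF that] by (simp_all add: M_def le_max_iff_disj)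
  \<comment> \<open>Variation is measured on a window of length \<open>r\<close>. Characteristics
    move by at most \<open>r / 2\<close>, so their traces stay in a window of length
    \<open>2 * r = l\<close>, where \<open>locally_bv\<close> applies.\<close>
  define r where "r = l / 2"
  have r: "0 < r" "l = 2 * r" using bv(1) by (auto simp: r_def)
  obtain K0 where K0: "0 < K0" "gch_lipschitz k b M K0"
    using gch_nonlinearities_lipschitz[OF M1] by blast
  obtain K1 where K1: "0 < K1"
    "\<And>f g B. norm f \<le> M \<Longrightarrow> norm g \<le> M \<Longrightarrow>
      \<forall>z. integral {z..z + r} (\<lambda>x. \<bar>apply_c1fun f x - apply_c1fun g x\<bar> +
        \<bar>deriv (apply_c1fun f) x - deriv (apply_c1fun g) x\<bar>) \<le> B \<Longrightarrow>
      \<exists>d. (\<forall>x. DERIV (\<lambda>x. nonlocal_P k b f x - nonlocal_P k b g x) x :> d x \<and>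
        \<bar>nonlocal_P k b f x - nonlocal_P k b g x\<bar> \<le> K1 * B \<and>
        \<bar>d x\<bar> \<le> K1 * (\<bar>apply_c1fun f x - apply_c1fun g x\<bar> +
          \<bar>deriv (apply_c1fun f) x - deriv (apply_c1fun g) x\<bar>) + K1 * B)"
    by (rule nonlocal_P_diff[OF M1 r(1), where k = k and b = b]) (rule that)
  have m: "\<bar>u s x\<bar> \<le> M" "\<bar>deriv (u s) x\<bar> \<le> M" "\<bar>v s x\<bar> \<le> M" "\<bar>deriv (v s) x\<bar> \<le> M" if "s \<in> {0..T}" for s x
    using c1fun_abs_le_norm[of "u s" x] c1fun_abs_le_norm[of "v s" x] Mn[OF that] by auto
  \<comment> \<open>\<open>KF * B\<close> will bound \<open>F\<close>, and \<open>KV * B\<close> its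
    variation on a window of length \<open>l\<close>. The factor \<open>r + 1\<close> bounds the
    integral of value plus slope of the difference over a window of length \<open>r\<close>; the
    long window consists of two such, hence \<open>2 * (r + 1)\<close>.\<close>
  define KF where "KF = K1 * (r + 1) + K0 * M"
  define KV where "KV = (K1 + K0 * M) * (2 * (r + 1)) + K1 * (r + 1) * l + K0 * \<bar>C\<bar>"
  define K where "K = KF + KV"
  have KF: "0 < KF" and KV: "0 \<le> KV"
    using K0(1) K1(1) r M1 by (auto simp: KF_def KV_def intro!: add_pos_pos add_nonneg_nonneg mult_nonneg_nonneg)
  \<comment> \<open>The first bound limits the displacement, at speed at most \<open>M ^ k\<close>,
    to \<open>r / 2\<close>; the second is the smallness required by
    \<open>characteristic_exists\<close>.\<close>
  define \<tau> where "\<tau> = min (r / (2 * M ^ k)) (1 / (2 * (K0 * M)))"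
  have Mk: "0 < M ^ k" "0 < K0 * M" using M1 K0(1) by auto
  define w where "w s x = v s x - u s x" for s x
  define F where "F s x = nonlocal_P k b (v s) x - nonlocal_P k b (u s) x - (v s x ^ k - u s x ^ k) * deriv (u s) x" for s x
  show ?thesis
  proof (rule that)
    show "0 < K" using KF KV by (simp add: K_def)
    show "0 < \<tau>" using r Mk by (simp add: \<tau>_def)
    fix t0 t1 B t
    assume t01: "0 \<le> t0" "t1 \<le> T" "t1 \<le> t0 + \<tau>" and init: "u t0 = v t0"
      and bound: "\<forall>s\<in>{t0..t1}. w11_close (l / 2) B (v s) (u s)"
      and t: "t \<in> {t0..t1}"
    have inT: "s \<in> {0..T}" if "s \<in> {t0..t}" for s using that t01 t by auto
    have wB: "\<bar>w s x\<bar> \<le> B" and dB: "integral {z..z + r} (\<lambda>x. \<bar>deriv (v s) x - deriv (u s) x\<bar>) \<le> B"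
      if "s \<in> {t0..t}" for s x z
      using bspec[OF bound, of s] that t by (auto simp: w11_close_def w_def r_def)
    have B0: "0 \<le> B" using wB[of t0 0] t by auto
    have tt: "t - t0 \<le> r / (2 * M ^ k)" "t - t0 \<le> 1 / (2 * (K0 * M))" "t0 \<le> t"
      using t t01(3) by (auto simp: \<tau>_def)
    have e_int: "integral {z..z + r} (\<lambda>x. \<bar>v s x - u s x\<bar> + \<bar>deriv (v s) x - deriv (u s) x\<bar>) \<le> (r + 1) * B"
      if s: "s \<in> {t0..t}" for s z
    proof -
      have "integral {z..z + r} (\<lambda>x. \<bar>v s x - u s x\<bar> + \<bar>deriv (v s) x - deriv (u s) x\<bar>)
          = integral {z..z + r} (\<lambda>x. \<bar>w s x\<bar>) + integral {z..z + r} (\<lambda>x. \<bar>deriv (v s) x - deriv (u s) x\<bar>)"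
        unfolding w_def by (intro Henstock_Kurzweil_Integration.integral_add integrable_continuous_real continuous_intros
            c1fun_continuous c1fun_deriv_continuous)
      also have "integral {z..z + r} (\<lambda>x. \<bar>w s x\<bar>) \<le> B * (z + r - z)"
      proof -
        have "norm (integral {z..z + r} (\<lambda>x. \<bar>w s x\<bar>)) \<le> B * (z + r - z)"
          using r wB[OF s] unfolding w_def
          by (intro integral_bound continuous_intros c1fun_continuous) auto
        then show ?thesis by simp
      qed
      finally show ?thesis using dB[OF s, of z] by (simp add: algebra_simps)
    qed
    have Fbound: "\<bar>F s x\<bar> \<le> KF * B"
      and Fvar: "\<exists>\<Omega>. \<Omega> (a + l) - \<Omega> a \<le> KV * B \<and>
        (\<forall>x y. a \<le> x \<longrightarrow> x \<le> y \<longrightarrow> y \<le> a + l \<longrightarrow> \<bar>F s y - F s x\<bar> \<le> \<Omega> y - \<Omega> x)"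
      if s: "s \<in> {t0..t}" for s x a
    proof -
      note ms = m[OF inT[OF s]]
      define e where "e x = \<bar>v s x - u s x\<bar> + \<bar>deriv (v s) x - deriv (u s) x\<bar>" for x
      have e: "continuous_on UNIV e"
        unfolding e_def by (intro continuous_intros c1fun_continuous c1fun_deriv_continuous)
      obtain d where d: "\<And>x. DERIV (\<lambda>x. nonlocal_P k b (v s) x - nonlocal_P k b (u s) x) x :> d x"
        "\<And>x. \<bar>nonlocal_P k b (v s) x - nonlocal_P k b (u s) x\<bar> \<le> K1 * ((r + 1) * B)"
        "\<And>x. \<bar>d x\<bar> \<le> K1 * e x + K1 * ((r + 1) * B)"
        using K1(2)[OF Mn(2)[OF inT[OF s]] Mn(1)[OF inT[OF s]] allI[OF e_int[OF s]]] unfolding e_def by blast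
      define g where "g x = v s x ^ k - u s x ^ k" for x
      have gB: "\<bar>g x\<bar> \<le> K0 * B" for x
      proof -
        have "\<bar>g x\<bar> \<le> K0 * \<bar>w s x\<bar>"
          using gch_lipschitzD(3)[OF K0(2) ms(3) ms(4) ms(1) ms(2), of x x] by (simp add: g_def w_def)
        also have "\<dots> \<le> K0 * B" using wB[OF s, of x] K0(1) by (intro mult_left_mono) auto
        finally show ?thesis .
      qed
      define g' where "g' x = real k * (v s x ^ (k - 1) * deriv (v s) x) - real k * (u s x ^ (k - 1) * deriv (u s) x)" for x
      have Dg: "DERIV g x :> g' x" for x
        unfolding g_def g'_def by (auto intro!: derivative_eq_intros c1fun_has_deriv simp: mult.commute mult.left_commute)
      have g'B: "\<bar>g' x\<bar> \<le> K0 * e x" for x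
        using gch_lipschitzD(4)[OF K0(2) ms(3) ms(4) ms(1) ms(2), of x x x x] by (simp add: g'_def e_def)
      have gux: "\<bar>g x * deriv (u s) x\<bar> \<le> K0 * B * M" for x
        unfolding abs_mult using gB[of x] ms(2)[of x] K0(1) B0 by (intro mult_mono) auto
      have "\<bar>F s x\<bar> \<le> K1 * ((r + 1) * B) + K0 * B * M"
        using d(2)[of x] gux[of x] abs_triangle_ineq4[of "nonlocal_P k b (v s) x - nonlocal_P k b (u s) x" "g x * deriv (u s) x"]
        unfolding F_def g_def by linarith
      then show "\<bar>F s x\<bar> \<le> KF * B" by (simp add: KF_def algebra_simps)
      obtain E where E: "\<And>x. DERIV E x :> e x"
        using continuous_real_antiderivative[OF e] by blast
      obtain W where W: "W (a + l) - W a \<le> C"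
        "\<And>x y. a \<le> x \<Longrightarrow> x \<le> y \<Longrightarrow> y \<le> a + l \<Longrightarrow> \<bar>deriv (u s) y - deriv (u s) x\<bar> \<le> W y - W x"
        using bv(2)[OF inT[OF s]] unfolding locally_bv_def by blast
      have Eint: "E (z + r) - E z \<le> (r + 1) * B" for z
      proof -
        have "(e has_integral (E (z + r) - E z)) {z..z + r}"
          using r E by (intro fundamental_theorem_of_calculus)
            (auto simp: has_real_derivative_iff_has_vector_derivative intro: has_vector_derivative_at_within)
        then show ?thesis using e_int[OF s, of z] by (simp add: integral_unique e_def[abs_def])
      qed
      \<comment> \<open>\<open>E\<close> carries the pointwise part of the derivatives of the
        nonlocal difference and of \<open>g\<close>, the linear term the uniform part, and
        \<open>W\<close> the increments of the slope of \<open>u\<close>, weighted by the sup bound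
        \<open>K0 * B\<close> of \<open>g\<close>.\<close>
      define \<Omega> where "\<Omega> x = (K1 + K0 * M) * E x + K1 * ((r + 1) * B) * x + K0 * B * W x" for x
      have "\<bar>F s y - F s x\<bar> \<le> \<Omega> y - \<Omega> x" if xy: "a \<le> x" "x \<le> y" "y \<le> a + l" for x y
      proof -
        define P where "P x = nonlocal_P k b (v s) x - nonlocal_P k b (u s) x" for x
        have "\<bar>P y - P x\<bar> \<le> (K1 * E y + K1 * ((r + 1) * B) * y) - (K1 * E x + K1 * ((r + 1) * B) * x)"
          unfolding P_def using d(3) xy(2)
          by (intro DERIV_dominated_increment[OF d(1), where F' = "\<lambda>x. K1 * e x + K1 * ((r + 1) * B)"])
            (auto intro!: derivative_eq_intros E)
        moreover have "\<bar>g y - g x\<bar> \<le> K0 * E y - K0 * E x"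
          using g'B xy(2) by (intro DERIV_dominated_increment[OF Dg, where F' = "\<lambda>x. K0 * e x"])
            (auto intro!: derivative_eq_intros E)
        then have "\<bar>g y - g x\<bar> * \<bar>deriv (u s) y\<bar> \<le> (K0 * E y - K0 * E x) * M"
          using ms(2)[of y] by (intro mult_mono) auto
        moreover have "\<bar>g x\<bar> * \<bar>deriv (u s) y - deriv (u s) x\<bar> \<le> K0 * B * (W y - W x)"
          using gB[of x] W(2)[OF xy] K0(1) B0 by (intro mult_mono) auto
        moreover have "F s y - F s x = (P y - P x) - ((g y - g x) * deriv (u s) y + g x * (deriv (u s) y - deriv (u s) x))"
          by (simp add: F_def P_def g_def algebra_simps)
        then have "\<bar>F s y - F s x\<bar> \<le> \<bar>P y - P x\<bar> + (\<bar>g y - g x\<bar> * \<bar>deriv (u s) y\<bar> + \<bar>g x\<bar> * \<bar>deriv (u s) y - deriv (u s) x\<bar>)"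
          unfolding abs_mult[symmetric] by linarith
        ultimately have "\<bar>F s y - F s x\<bar> \<le> (K1 * E y + K1 * ((r + 1) * B) * y) - (K1 * E x + K1 * ((r + 1) * B) * x)
            + ((K0 * E y - K0 * E x) * M + K0 * B * (W y - W x))"
          by linarith
        also have "\<dots> = \<Omega> y - \<Omega> x"
          by (simp add: \<Omega>_def algebra_simps)
        finally show ?thesis .
      qed
      moreover have "\<Omega> (a + l) - \<Omega> a \<le> KV * B"
      proof -
        have "E (a + l) - E a \<le> 2 * ((r + 1) * B)"
          using Eint[of a] Eint[of "a + r"] r(2) by (simp add: algebra_simps)
        then have "(K1 + K0 * M) * (E (a + l) - E a) \<le> (K1 + K0 * M) * (2 * ((r + 1) * B))"
          using K1(1) K0(1) M1 by (intro mult_left_mono) auto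
        moreover have "K0 * B * (W (a + l) - W a) \<le> K0 * B * \<bar>C\<bar>"
          using W(1) K0(1) B0 by (intro mult_left_mono) auto
        moreover have "\<Omega> (a + l) - \<Omega> a = (K1 + K0 * M) * (E (a + l) - E a) + K1 * ((r + 1) * B) * l + K0 * B * (W (a + l) - W a)"
          by (simp add: \<Omega>_def algebra_simps)
        moreover have "KV * B = (K1 + K0 * M) * (2 * ((r + 1) * B)) + K1 * ((r + 1) * B) * l + K0 * B * \<bar>C\<bar>"
          by (simp add: KV_def algebra_simps)
        ultimately show ?thesis by linarith
      qed
      ultimately show "\<exists>\<Omega>. \<Omega> (a + l) - \<Omega> a \<le> KV * B \<and>
        (\<forall>x y. a \<le> x \<longrightarrow> x \<le> y \<longrightarrow> y \<le> a + l \<longrightarrow> \<bar>F s y - F s x\<bar> \<le> \<Omega> y - \<Omega> x)"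
        by blast
    qed
    have speed: "\<bar>v s x ^ k\<bar> \<le> M ^ k" and lip: "\<bar>v s x ^ k - v s z ^ k\<bar> \<le> K0 * M * \<bar>x - z\<bar>"
      if s: "s \<in> {t0..t}" for s x z
    proof -
      note ms = m[OF inT[OF s]]
      show "\<bar>v s x ^ k\<bar> \<le> M ^ k" unfolding power_abs by (intro power_mono ms) auto
      have "\<bar>v s x ^ k - v s z ^ k\<bar> \<le> K0 * \<bar>v s x - v s z\<bar>"
        using gch_lipschitzD(3)[OF K0(2) ms(3) ms(4) ms(3) ms(4), of x z] by simp
      also have "\<dots> \<le> K0 * (M * \<bar>x - z\<bar>)"
        using K0(1) DERIV_bound_imp_lipschitz[OF c1fun_has_deriv ms(4)] by (intro mult_left_mono) auto
      finally show "\<bar>v s x ^ k - v s z ^ k\<bar> \<le> K0 * M * \<bar>x - z\<bar>" by simp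
    qed
    have "\<exists>y. y t = x \<and> (\<forall>s\<in>{t0..t}. (y has_real_derivative v s (y s) ^ k) (at s within {t0..t}))" for x
    proof (rule characteristic_exists[of t0 t "\<lambda>s x. v s x ^ k" "M ^ k" "K0 * M" x])
      have "continuous_on {t0..t} v"
        using gch_solution_continuous_on[OF v] by (rule continuous_on_subset) (use inT in auto)
      from continuous_on_power[OF c1fun_curve_continuous[OF this], of k]
      show "continuous_on ({t0..t} \<times> UNIV) (\<lambda>(s, x). v s x ^ k)"
        by (simp add: split_def)
      have "K0 * M * (t - t0) \<le> K0 * M * (1 / (2 * (K0 * M)))"
        using tt(2) Mk by (intro mult_left_mono) auto
      also have "\<dots> = 1 / 2" using K0(1) M1 by (simp add: divide_simps)
      finally show "K0 * M * (t - t0) \<le> 1 / 2" .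
    qed (use speed lip tt Mk in auto)
    then obtain Y where Y: "\<And>x. Y x t = x"
      "\<And>x s. s \<in> {t0..t} \<Longrightarrow> (Y x has_real_derivative v s (Y x s) ^ k) (at s within {t0..t})"
      by metis
    have disp: "\<bar>Y x s - x\<bar> \<le> r / 2" if s: "s \<in> {t0..t}" for x s
    proof -
      have "norm (Y x s - Y x t) \<le> M ^ k * norm (s - t)"
        by (rule field_differentiable_bound[of "{t0..t}"]) (use Y(2) speed s in auto)
      also have "\<dots> \<le> M ^ k * (r / (2 * M ^ k))"
        using s tt(1) Mk(1) by (intro mult_left_mono) auto
      also have "\<dots> = r / 2" using M1 by simp
      finally show ?thesis by (simp add: Y(1))
    qed
    obtain ut where ut: "\<And>s. s \<in> {0..T} \<Longrightarrow> ((\<lambda>s. c1_val (u s)) has_vector_derivative ut s) (at s within {0..T})"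
      "\<And>s x. s \<in> {0..T} \<Longrightarrow> ut s x + u s x ^ k * deriv (u s) x = nonlocal_P k b (u s) x"
      using u unfolding gch_solution_def by blast
    obtain vt where vt: "\<And>s. s \<in> {0..T} \<Longrightarrow> ((\<lambda>s. c1_val (v s)) has_vector_derivative vt s) (at s within {0..T})"
      "\<And>s x. s \<in> {0..T} \<Longrightarrow> vt s x + v s x ^ k * deriv (v s) x = nonlocal_P k b (v s) x"
      using v unfolding gch_solution_def by blast
    have sub: "{t0..t} \<subseteq> {0..T}" using inT by auto
    have Dw: "((\<lambda>s. w s (Y x s)) has_real_derivative F s (Y x s)) (at s within {t0..t})"
      if s: "s \<in> {t0..t}" for s x
    proof -
      have "((\<lambda>s. w s (Y x s)) has_real_derivative
          (vt s (Y x s) + deriv (v s) (Y x s) * (v s (Y x s) ^ k)) - (ut s (Y x s) + deriv (u s) (Y x s) * (v s (Y x s) ^ k)))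
          (at s within {t0..t})"
        unfolding w_def
        by (intro DERIV_diff c1fun_curve_has_derivative Y(2)[OF s]
            has_vector_derivative_within_subset[OF vt(1)[OF inT[OF s]] sub]
            has_vector_derivative_within_subset[OF ut(1)[OF inT[OF s]] sub])
      moreover have "(vt s (Y x s) + deriv (v s) (Y x s) * (v s (Y x s) ^ k)) - (ut s (Y x s) + deriv (u s) (Y x s) * (v s (Y x s) ^ k))
          = F s (Y x s)"
        unfolding F_def using ut(2)[OF inT[OF s], of "Y x s"] vt(2)[OF inT[OF s], of "Y x s"]
        by (simp add: algebra_simps)
      ultimately show ?thesis by simp
    qed
    have w0: "w t0 x = 0" for x by (simp add: w_def init)
    have KFV: "KF * B * (t - t0) \<le> K * (t - t0) * B" "KV * B * (t - t0) \<le> K * (t - t0) * B"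
    proof -
      have "0 \<le> (t - t0) * B" using B0 tt(3) by simp
      then have "KF * ((t - t0) * B) \<le> K * ((t - t0) * B)" "KV * ((t - t0) * B) \<le> K * ((t - t0) * B)"
        using KF KV by (auto simp: K_def intro!: mult_right_mono)
      then show "KF * B * (t - t0) \<le> K * (t - t0) * B" "KV * B * (t - t0) \<le> K * (t - t0) * B"
        by (simp_all add: mult_ac)
    qed
    show "w11_close (l / 2) (K * (t - t0) * B) (v t) (u t)"
      unfolding w11_close_def
    proof (intro conjI allI)
      fix x
      have "norm (w t (Y x t) - w t0 (Y x t0)) \<le> KF * B * norm (t - t0)"
        by (rule field_differentiable_bound[of "{t0..t}" "\<lambda>s. w s (Y x s)"]) (use Dw Fbound tt(3) in auto)
      then show "\<bar>v t x - u t x\<bar> \<le> K * (t - t0) * B"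
        using KFV(1) tt(3) by (simp add: w0 Y(1)) (simp add: w_def)
    next
      fix z
      show "integral {z..z + l / 2} (\<lambda>x. \<bar>deriv (v t) x - deriv (u t) x\<bar>) \<le> K * (t - t0) * B"
        unfolding r_def[symmetric]
      proof (rule integral_abs_deriv_le_variation[OF _ _ r(1)])
        show "DERIV (w t) x :> deriv (v t) x - deriv (u t) x" for x
          unfolding w_def by (intro DERIV_diff c1fun_has_deriv)
        show "continuous_on UNIV (\<lambda>x. deriv (v t) x - deriv (u t) x)"
          by (intro continuous_intros c1fun_deriv_continuous)
        fix n :: nat
        define X where "X i = z + real i * (r / real n)" for i
        \<comment> \<open>The signs are frozen at the final time. Then \<open>\<Gamma>\<close> is
          differentiable in \<open>s\<close>, which a sum of absolute values is not, and still
          equals the variation sum at \<open>s = t\<close>.\<close>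
        define \<sigma> where "\<sigma> i = sgn (w t (X (Suc i)) - w t (X i))" for i
        define \<Gamma> where "\<Gamma> s = (\<Sum>i<n. \<sigma> i * (w s (Y (X (Suc i)) s) - w s (Y (X i) s)))" for s
        define \<Gamma>' where "\<Gamma>' s = (\<Sum>i<n. \<sigma> i * (F s (Y (X (Suc i)) s) - F s (Y (X i) s)))" for s
        have "norm (\<Gamma> t - \<Gamma> t0) \<le> KV * B * norm (t - t0)"
        proof (rule field_differentiable_bound[of "{t0..t}" \<Gamma> \<Gamma>'])
          show "(\<Gamma> has_real_derivative \<Gamma>' s) (at s within {t0..t})" if "s \<in> {t0..t}" for s
            unfolding \<Gamma>_def \<Gamma>'_def using that by (intro DERIV_sum DERIV_cmult DERIV_diff Dw)
          show "norm (\<Gamma>' s) \<le> KV * B" if s: "s \<in> {t0..t}" for s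
          proof (cases "n = 0")
            case True
            then show ?thesis using KV B0 by (simp add: \<Gamma>'_def)
          next
            case False
            define a where "a = z - r / 2"
            obtain \<Omega> where \<Omega>: "\<Omega> (a + l) - \<Omega> a \<le> KV * B"
              "\<And>x y. a \<le> x \<Longrightarrow> x \<le> y \<Longrightarrow> y \<le> a + l \<Longrightarrow> \<bar>F s y - F s x\<bar> \<le> \<Omega> y - \<Omega> x"
              using Fvar[OF s, of a] by blast
            have mono: "\<Omega> x \<le> \<Omega> y" if "a \<le> x" "x \<le> y" "y \<le> a + l" for x y
              using \<Omega>(2)[OF that] by linarith
            have XX: "X i \<in> {z..z + r}" if "i \<le> n" for i
            proof -
              have "real i * (r / real n) \<le> real n * (r / real n)"
                using that r by (intro mult_right_mono) auto
              then show ?thesis using False r by (auto simp: X_def)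
            qed
            have YI: "a \<le> Y (X i) s" "Y (X i) s \<le> a + l" if "i \<le> n" for i
              using disp[OF s, of "X i"] XX[OF that] unfolding a_def r(2) by (simp_all only: atLeastAtMost_iff) linarith+
            have ord: "Y (X i) s \<le> Y (X (Suc i)) s" for i
            proof (rule characteristics_ordered[of t0 t _ "\<lambda>s x. v s x ^ k", OF Y(2) Y(2) lip])
              show "Y (X i) t \<le> Y (X (Suc i)) t"
                unfolding Y(1) X_def using r by (intro add_left_mono mult_right_mono) auto
            qed (use s in auto)
            have "norm (\<Gamma>' s) \<le> (\<Sum>i<n. \<bar>F s (Y (X (Suc i)) s) - F s (Y (X i) s)\<bar>)"
              unfolding \<Gamma>'_def real_norm_def
            proof (rule order_trans[OF sum_abs sum_mono])
              fix i
              have "\<bar>\<sigma> i\<bar> \<le> 1" by (auto simp: \<sigma>_def sgn_real_def)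
              then show "\<bar>\<sigma> i * (F s (Y (X (Suc i)) s) - F s (Y (X i) s))\<bar> \<le> \<bar>F s (Y (X (Suc i)) s) - F s (Y (X i) s)\<bar>"
                by (simp add: abs_mult mult_left_le_one_le)
            qed
            also have "\<dots> \<le> (\<Sum>i<n. \<Omega> (Y (X (Suc i)) s) - \<Omega> (Y (X i) s))"
              by (intro sum_mono \<Omega>(2) ord YI) auto
            also have "\<dots> = \<Omega> (Y (X n) s) - \<Omega> (Y (X 0) s)"
              using sum_lessThan_telescope[of "\<lambda>i. \<Omega> (Y (X i) s)" n] by simp
            also have "\<dots> \<le> \<Omega> (a + l) - \<Omega> a"
              using r by (intro diff_mono mono YI) auto
            also note \<Omega>(1)
            finally show ?thesis .
          qed
        qed (use tt in auto)
        moreover have "\<Gamma> t0 = 0" by (simp add: \<Gamma>_def w0)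
        moreover have "\<Gamma> t = (\<Sum>i<n. \<bar>w t (X (Suc i)) - w t (X i)\<bar>)"
          unfolding \<Gamma>_def Y(1) \<sigma>_def by (intro sum.cong) (auto simp: sgn_real_def)
        ultimately have "(\<Sum>i<n. \<bar>w t (X (Suc i)) - w t (X i)\<bar>) \<le> KV * B * (t - t0)"
          using tt(3) by simp
        then show "(\<Sum>i<n. \<bar>w t (z + real (Suc i) * (r / real n)) - w t (z + real i * (r / real n))\<bar>) \<le> K * (t - t0) * B"
          using KFV(2) by (simp add: X_def)
      qed
    qed
  qed
qed

lemma halving_bound_nonpos:
  fixes a B :: real
  assumes "\<And>n. a \<le> B * (1 / 2) ^ n"
  shows "a \<le> 0"
proof -
  have "(\<lambda>n. B * (1 / 2 :: real) ^ n) \<longlonglongrightarrow> B * 0"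
    by (intro tendsto_mult tendsto_const LIMSEQ_power_zero) auto
  then show ?thesis
    using assms LIMSEQ_le_const[of _ "B * 0" a] by auto
qed

text \<open>Asymmetric on purpose: \<open>u\<close> is the known wave and carries the variation
  bound, while \<open>v\<close> is an arbitrary competitor, as membership in \<open>gch_data\<close>
  demands.\<close>

theorem gch_solution_unique:
  assumes u: "gch_solution k b T u0 u" and v: "gch_solution k b T u0 v"
    and bv: "0 < l" "\<And>t. t \<in> {0..T} \<Longrightarrow> locally_bv l C (deriv (apply_c1fun (u t)))"
  shows "v = u"
proof -
  obtain K \<tau> where K: "0 < K" "0 < \<tau>"
    and contract: "\<And>t0 t1 B t. 0 \<le> t0 \<Longrightarrow> t1 \<le> T \<Longrightarrow> t1 \<le> t0 + \<tau> \<Longrightarrow> u t0 = v t0 \<Longrightarrow>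
      \<forall>s\<in>{t0..t1}. w11_close (l / 2) B (v s) (u s) \<Longrightarrow> t \<in> {t0..t1} \<Longrightarrow>
      w11_close (l / 2) (K * (t - t0) * B) (v t) (u t)"
    by (rule gch_difference_contracts[OF u v bv(1) bv(2)], assumption) (rule that)
  obtain Mu where Mu: "1 \<le> Mu" "\<And>t. t \<in> {0..T} \<Longrightarrow> norm (u t) \<le> Mu"
    using gch_solution_bounded[OF u] by blast
  obtain Mv where Mv: "1 \<le> Mv" "\<And>t. t \<in> {0..T} \<Longrightarrow> norm (v t) \<le> Mv"
    using gch_solution_bounded[OF v] by blast
  \<comment> \<open>On a time step of length \<open>h\<close> the factor \<open>K * (t - t0)\<close>
    is at most 1/2, so each application of \<open>contract\<close> halves the bound.\<close>
  define h where "h = min \<tau> (1 / (2 * K))"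
  have h: "0 < h" "h \<le> \<tau>" "K * h \<le> 1 / 2"
    using K mult_left_mono[of h "1 / (2 * K)" K] by (auto simp: h_def)
  have step: "u t = v t" if t0: "0 \<le> t0" "u t0 = v t0" and t: "t0 \<le> t" "t \<le> T" "t \<le> t0 + h" for t0 t
  proof -
    \<comment> \<open>A starting bound for the iteration from the C^1 norms: \<open>Mu + Mv\<close>
      for the values, \<open>(Mu + Mv) * (l / 2)\<close> for the integral of the slopes.\<close>
    define B where "B = (Mu + Mv) * (1 + l / 2)"
    have "\<forall>s\<in>{t0..t}. w11_close (l / 2) (B * (1 / 2) ^ n) (v s) (u s)" for n
    proof (induction n)
      case 0
      have "\<bar>v s x - u s x\<bar> \<le> B" "integral {z..z + l / 2} (\<lambda>x. \<bar>deriv (v s) x - deriv (u s) x\<bar>) \<le> B"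
        if s: "s \<in> {t0..t}" for s x z
      proof -
        have sT: "s \<in> {0..T}" using s t0 t by auto
        have 1: "\<bar>v s x - u s x\<bar> \<le> Mu + Mv" "\<bar>deriv (v s) x - deriv (u s) x\<bar> \<le> Mu + Mv" for x
          using c1fun_abs_le_norm[of "u s" x] c1fun_abs_le_norm[of "v s" x] Mu(2)[OF sT] Mv(2)[OF sT] by linarith+
        have "norm (integral {z..z + l / 2} (\<lambda>x. \<bar>deriv (v s) x - deriv (u s) x\<bar>)) \<le> (Mu + Mv) * (z + l / 2 - z)"
          using bv(1) 1(2) by (intro integral_bound continuous_intros c1fun_deriv_continuous) auto
        moreover have "B = (Mu + Mv) + (Mu + Mv) * (l / 2)" "0 \<le> (Mu + Mv) * (l / 2)"
          using Mu(1) Mv(1) bv(1) by (auto simp: B_def algebra_simps)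
        moreover have "(Mu + Mv) * (z + l / 2 - z) = (Mu + Mv) * (l / 2)" by simp
        ultimately show "\<bar>v s x - u s x\<bar> \<le> B" "integral {z..z + l / 2} (\<lambda>x. \<bar>deriv (v s) x - deriv (u s) x\<bar>) \<le> B"
          using 1(1)[of x] Mu(1) Mv(1) unfolding real_norm_def by linarith+
      qed
      then show ?case by (simp add: w11_close_def)
    next
      case (Suc n)
      show ?case
      proof
        fix s assume s: "s \<in> {t0..t}"
        have B0: "0 \<le> B * (1 / 2) ^ n" using Mu(1) Mv(1) bv(1) by (simp add: B_def)
        have "K * (s - t0) \<le> K * h" using s t K(1) by (intro mult_left_mono) auto
        then have "K * (s - t0) * (B * (1 / 2) ^ n) \<le> 1 / 2 * (B * (1 / 2) ^ n)"
          using h(3) B0 by (intro mult_right_mono) auto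
        then have le: "K * (s - t0) * (B * (1 / 2) ^ n) \<le> B * (1 / 2) ^ Suc n" by simp
        have "t \<le> t0 + \<tau>" using t(3) h(2) by simp
        from contract[OF t0(1) t(2) this t0(2) Suc s]
        show "w11_close (l / 2) (B * (1 / 2) ^ Suc n) (v s) (u s)"
          unfolding w11_close_def by (intro conjI allI order_trans[OF _ le]) (blast+)
      qed
    qed
    then have "\<bar>v t x - u t x\<bar> \<le> B * (1 / 2) ^ n" for n x
      using t(1) by (auto simp: w11_close_def)
    then have "\<bar>v t x - u t x\<bar> \<le> 0" for x
      by (rule halving_bound_nonpos)
    then show ?thesis
      by (intro c1fun_eqI) (metis abs_le_zero_iff eq_iff_diff_eq_0)
  qed
  have init: "u 0 = v 0" using u v by (simp add: gch_solution_def)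
  have "\<forall>t. 0 \<le> t \<longrightarrow> t \<le> T \<longrightarrow> t \<le> real n * h \<longrightarrow> u t = v t" for n
  proof (induction n)
    case 0
    then show ?case using init by (auto dest: antisym)
  next
    case (Suc n)
    show ?case
    proof (intro allI impI)
      fix t assume t: "0 \<le> t" "t \<le> T" "t \<le> real (Suc n) * h"
      show "u t = v t"
      proof (cases "t \<le> real n * h")
        case True
        then show ?thesis using Suc t by blast
      next
        case False
        have le: "0 \<le> real n * h" "real n * h \<le> t" "real n * h \<le> T" "t \<le> real n * h + h"
          using False t h(1) by (auto simp: distrib_right)
        then have "u (real n * h) = v (real n * h)"
          using Suc by blast
        from step[OF le(1) this le(2) t(2) le(4)] show ?thesis .
      qed
    qed
  qed
  note all = this
  have in_T: "v t = u t" if t: "t \<in> {0..T}" for t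
  proof -
    obtain n where "t < real n * h"
      using ex_less_of_nat_mult[OF h(1), of t] by blast
    then show ?thesis using all[of n] t by auto
  qed
  have "u \<in> extensional {0..T}" "v \<in> extensional {0..T}"
    using u v by (auto simp: gch_solution_def CT_C1_def)
  then show ?thesis
    using in_T by (intro extensionalityI[of _ "{0..T}"]) auto
qed

section \<open>Travelling wave profiles\<close>

text \<open>Profiles of speed 1. Uniform continuity of the slope makes the translates a continuous
  curve in C^1; the variation bound feeds the uniqueness theorem.\<close>

definition wave_profile :: "nat \<Rightarrow> real \<Rightarrow> c1fun \<Rightarrow> bool"
  where "wave_profile k b f \<longleftrightarrow> uniformly_continuous_on UNIV (deriv f) \<and>
    (\<exists>l>0. \<exists>C. locally_bv l C (deriv f)) \<and>
    (\<forall>x. (f x ^ k - 1) * deriv f x = nonlocal_P k b f x)"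

text \<open>Steepness is asked on an interval of length \<open>\<eta>\<close>, not at a point, so
  that every progression from 0 with step at most \<open>\<eta>\<close> meets it. \<open>L\<close>
  is kept apart from \<open>\<eta>\<close> because it enters the final constant.\<close>

definition steep_wave :: "nat \<Rightarrow> real \<Rightarrow> real \<Rightarrow> real \<Rightarrow> c1fun \<Rightarrow> bool"
  where "steep_wave k b L \<eta> f \<longleftrightarrow> wave_profile k b f \<and> (\<forall>x. \<bar>f x\<bar> \<le> 2 \<and> \<bar>deriv f x\<bar> \<le> 2) \<and> deriv f 0 = 0 \<and>
    (\<exists>x1. 0 \<le> x1 \<and> x1 \<le> L * \<eta> \<and> (\<forall>x\<in>{x1..x1 + \<eta>}. 1 / 4 \<le> \<bar>deriv f x\<bar>))"

section \<open>Orbits: first crossing, time of descent, persistence of the slope\<close>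

lemma first_crossing:
  fixes g :: "real \<Rightarrow> real"
  assumes "a \<le> b" and cont: "continuous_on {a..b} g" and "c < g a" "g b \<le> c"
  obtains x where "a < x" "x \<le> b" "g x = c" "\<And>y. a \<le> y \<Longrightarrow> y < x \<Longrightarrow> c < g y"
proof -
  define S where "S = {x \<in> {a..b}. g x \<le> c}"
  have "closed S"
    unfolding S_def by (rule continuous_on_closed_Collect_le[OF cont continuous_on_const closed_atLeastAtMost])
  moreover have S: "b \<in> S" "bdd_below S"
    using assms by (auto simp: S_def bdd_below_def)
  ultimately have "Inf S \<in> S"
    using closed_contains_Inf[of S] by auto
  then have x: "Inf S \<in> {a..b}" "g (Inf S) \<le> c" by (auto simp: S_def)
  have less: "c < g y" if "a \<le> y" "y < Inf S" for y
  proof (rule ccontr)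
    assume "\<not> c < g y"
    then have "y \<in> S" using that x by (auto simp: S_def)
    then have "Inf S \<le> y" using S(2) by (rule cInf_lower)
    then show False using that by simp
  qed
  have "g (Inf S) = c"
  proof (rule ccontr)
    assume ne: "g (Inf S) \<noteq> c"
    obtain y where y: "a \<le> y" "y \<le> Inf S" "g y = c"
      using IVT2'[of g "Inf S" c a] x assms(3) continuous_on_subset[OF cont, of "{a..Inf S}"] by auto
    with ne have "y < Inf S" by (cases "y = Inf S") auto
    with less[OF y(1)] y(3) show False by simp
  qed
  moreover have "a < Inf S"
    using x assms(3) by (cases "a = Inf S") auto
  ultimately show ?thesis
    using that[of "Inf S"] x less by auto
qed

text \<open>Comparison with free fall: as long as the deceleration is at least
  \<open>\<kappa>\<close>, the loss of height after time y is at least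
  \<open>\<kappa> * y\<^sup>2 / 2\<close>.\<close>

lemma descent_time:
  fixes \<phi> \<psi> :: "real \<Rightarrow> real"
  assumes D: "\<And>x. DERIV \<phi> x :> \<psi> x" and init: "\<psi> 0 = 0" "\<phi> 0 = \<beta>" and "0 < u" "0 < \<kappa>"
    and le: "\<And>x. \<phi> x \<le> \<beta>"
    and acc: "\<And>x. \<beta> - u \<le> \<phi> x \<Longrightarrow> \<exists>d. DERIV \<psi> x :> d \<and> d \<le> - \<kappa>"
  obtains x where "0 < x" "x \<le> sqrt (2 * u / \<kappa>)" "\<phi> x = \<beta> - u" "\<psi> x < 0"
proof -
  have slope: "\<psi> y \<le> - \<kappa> * y" if "0 \<le> y" and above: "\<And>z. 0 \<le> z \<Longrightarrow> z \<le> y \<Longrightarrow> \<beta> - u \<le> \<phi> z" for y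
  proof -
    have "\<psi> y + \<kappa> * y \<le> \<psi> 0 + \<kappa> * 0"
    proof (rule DERIV_nonpos_imp_nonincreasing[OF that(1)])
      fix z assume "0 \<le> z" "z \<le> y"
      then obtain d where d: "DERIV \<psi> z :> d" "d \<le> - \<kappa>" using acc above by blast
      then show "\<exists>e. DERIV (\<lambda>y. \<psi> y + \<kappa> * y) z :> e \<and> e \<le> 0"
        by (intro exI[of _ "d + \<kappa>"] conjI) (auto intro!: derivative_eq_intros)
    qed
    then show ?thesis using init by simp
  qed
  define \<tau> where "\<tau> = sqrt (2 * u / \<kappa>)"
  have \<tau>: "0 < \<tau>" "\<kappa> * \<tau>\<^sup>2 = 2 * u" using \<open>0 < u\<close> \<open>0 < \<kappa>\<close> by (auto simp: \<tau>_def)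
  have cont: "continuous_on S \<phi>" for S
    by (rule DERIV_continuous_on[OF has_field_derivative_at_within[OF D]])
  have "\<exists>y\<in>{0..\<tau>}. \<phi> y \<le> \<beta> - u"
  proof (rule ccontr)
    assume "\<not> ?thesis"
    then have above: "\<beta> - u < \<phi> y" if "0 \<le> y" "y \<le> \<tau>" for y using that by force
    have "\<phi> \<tau> + \<kappa> * \<tau>\<^sup>2 / 2 \<le> \<phi> 0 + \<kappa> * 0\<^sup>2 / 2"
    proof (rule DERIV_nonpos_imp_nonincreasing[of 0 \<tau> "\<lambda>y. \<phi> y + \<kappa> * y\<^sup>2 / 2"])
      fix z assume z: "0 \<le> z" "z \<le> \<tau>"
      have "\<psi> z \<le> - \<kappa> * z" by (rule slope[OF z(1)]) (use above z in force)
      then show "\<exists>e. DERIV (\<lambda>y. \<phi> y + \<kappa> * y\<^sup>2 / 2) z :> e \<and> e \<le> 0"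
        by (intro exI[of _ "\<psi> z + \<kappa> * z"] conjI) (auto intro!: derivative_eq_intros D)
    qed (use \<tau> in simp)
    then show False using above[of \<tau>] \<tau> init(2) by simp
  qed
  then obtain y where y: "0 \<le> y" "y \<le> \<tau>" "\<phi> y \<le> \<beta> - u" by auto
  obtain x where x: "0 < x" "x \<le> y" "\<phi> x = \<beta> - u" "\<And>z. 0 \<le> z \<Longrightarrow> z < x \<Longrightarrow> \<beta> - u < \<phi> z"
    using first_crossing[OF y(1) cont, of "\<beta> - u"] y(3) init(2) \<open>0 < u\<close> by auto
  have "\<psi> x \<le> - \<kappa> * x"
    using x by (intro slope) (auto simp: order_le_less)
  then have "\<psi> x < 0" using x(1) \<open>0 < \<kappa>\<close> by (smt (verit) mult_pos_pos mult_minus_left)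
  then show ?thesis using that x y by (auto simp: \<tau>_def)
qed

lemma oscillator_c1fun:
  fixes Q :: "real \<Rightarrow> real"
  assumes "\<alpha> < \<beta>" and contQ: "continuous_on {\<alpha>..\<beta>} Q"
    and Q0: "Q \<alpha> = 0" "Q \<beta> = 0" and Qpos: "\<And>y. \<alpha> < y \<Longrightarrow> y < \<beta> \<Longrightarrow> 0 < Q y"
    and qa: "(Q has_real_derivative qa) (at \<alpha> within {\<alpha>..\<beta>})" "qa > 0"
    and qb: "(Q has_real_derivative qb) (at \<beta> within {\<alpha>..\<beta>})" "qb < 0"
  obtains f :: c1fun where "uniformly_continuous_on UNIV (deriv f)"
    "\<And>x. f x \<in> {\<alpha>..\<beta>}" "\<And>x. (deriv f x)\<^sup>2 = Q (f x)" "f 0 = \<beta>"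
    "\<And>x q. (Q has_real_derivative q) (at (f x) within {\<alpha>..\<beta>}) \<Longrightarrow> DERIV (deriv f) x :> q / 2"
proof -
  obtain \<phi> \<psi> where D: "\<And>x. DERIV \<phi> x :> \<psi> x" and uc: "uniformly_continuous_on UNIV \<psi>"
    and rng: "\<And>x. \<phi> x \<in> {\<alpha>..\<beta>}" and sq: "\<And>x. (\<psi> x)\<^sup>2 = Q (\<phi> x)" and init: "\<phi> 0 = \<beta>"
    and DD: "\<And>x q. (Q has_real_derivative q) (at (\<phi> x) within {\<alpha>..\<beta>}) \<Longrightarrow> DERIV \<psi> x :> q / 2"
    by (rule oscillator[OF assms]) (assumption | rule that)+
  have d: "deriv \<phi> = \<psi>" using D DERIV_imp_deriv by blast
  have "compact (Q ` {\<alpha>..\<beta>})" by (intro compact_continuous_image contQ) simp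
  then obtain C where C: "\<And>y. y \<in> {\<alpha>..\<beta>} \<Longrightarrow> \<bar>Q y\<bar> \<le> C"
    using compact_imp_bounded by (fastforce simp: bounded_iff)
  have "\<bar>\<psi> x\<bar> \<le> sqrt C" for x
    using C[OF rng[of x]] by (intro real_le_rsqrt) (simp add: sq)
  then have "bounded (range \<psi>)" by (auto intro!: boundedI)
  moreover have "bounded (range \<phi>)"
    using rng by (intro bounded_subset[OF bounded_closed_interval[of \<alpha> \<beta>]]) auto
  moreover have "\<phi> differentiable (at x)" for x
    using D real_differentiable_def by blast
  ultimately have "apply_c1fun (C1fun \<phi>) = \<phi>"
    using uniformly_continuous_imp_continuous[OF uc] by (intro C1fun_inverse) (simp add: d)
  then show ?thesis
    using that[of "C1fun \<phi>"] uc rng sq init DD d by simp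
qed

text \<open>
  Along \<open>f'\<^sup>2 = f\<^sup>2 + e - 2 M(f)\<close> the momentum density is \<open>f - f'' = h(f)\<close> with \<open>h = M'\<close>, and the
  equation \<open>(f\<^sup>k - 1) h(f)' + b f\<^sup>k\<^sup>-\<^sup>1 f' h(f) = 0\<close> is the hypothesis on \<open>N = (y\<^sup>k - 1) h\<close>, integrated once so
  that it makes sense at a singularity of \<open>h\<close> at \<open>1\<close>.
\<close>

lemma potential_wave:
  fixes f :: c1fun and M N h :: "real \<Rightarrow> real"
  assumes k: "1 \<le> k" and rng: "\<And>x. f x \<in> {\<alpha>..\<beta>}"
    and sq: "\<And>x. (deriv f x)\<^sup>2 = (f x)\<^sup>2 + e - 2 * M (f x)"
    and DD: "\<And>x. f x \<noteq> 1 \<Longrightarrow> DERIV (deriv f) x :> f x - h (f x)"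
    and N: "\<And>y. y \<in> {\<alpha>..\<beta>} \<Longrightarrow> y \<noteq> 1 \<Longrightarrow> N y = (y ^ k - 1) * h y" "N 1 = 0"
    and DN: "\<And>y. y \<in> {\<alpha>..\<beta>} \<Longrightarrow> ((\<lambda>y. N y + (b - real k) * y ^ (k - 1) * M y) has_real_derivative
      (real k - 1) * (b - real k) * y ^ (k - 2) * M y) (at y within {\<alpha>..\<beta>})"
  shows "(f x ^ k - 1) * deriv f x = nonlocal_P k b f x"
proof -
  obtain j where j: "k = Suc j" using k by (cases k) auto
  \<comment> \<open>With \<open>w\<close> the left side of the claim, the aim is the system of
    \<open>helmholtz_inv_system\<close> for flux and source. Computing w' with f'' = f - h(f),
    subtracting the flux and eliminating the squared slope by the energy relation leaves a function
    of the height alone. This is \<open>Bf\<close>; \<open>G\<close> is its derivative.\<close>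
  define Bf where "Bf y = (y ^ k - 1) * y - b / (real k + 1) * y ^ (k + 1) + (b - real k) / 2 * y ^ (k - 1) * (y\<^sup>2 + e)
    - (N y + (b - real k) * y ^ (k - 1) * M y)" for y
  define G where "G y = (y ^ k - 1) + (real k - 1) * (b - real k) / 2 * y ^ (k - 2) * (y\<^sup>2 + e - 2 * M y)" for y
  have DBf: "(Bf has_real_derivative G y) (at y within {\<alpha>..\<beta>})" if y: "y \<in> {\<alpha>..\<beta>}" for y
  proof -
    \<comment> \<open>At \<open>j = 0\<close> the truncated exponent is wrong, but both sides carry
      the factor \<open>real j\<close>.\<close>
    have pw: "real j * (y\<^sup>2 * y ^ (j - Suc 0)) = real j * (y * y ^ j)"
      by (cases j) (auto simp: power2_eq_square)
    define S where "S = (\<lambda>y. (y ^ k - 1) * y - b / (real k + 1) * y ^ (k + 1) + (b - real k) / 2 * y ^ (k - 1) * (y\<^sup>2 + e))"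
    have "(S has_real_derivative
      (y ^ k - 1) + real k * y ^ j * y - b * y ^ k +
        (b - real k) / 2 * (real j * y ^ (j - 1) * (y\<^sup>2 + e) + y ^ j * (2 * y))) (at y within {\<alpha>..\<beta>})"
      unfolding S_def j
      by (rule derivative_eq_intros refl | simp add: field_simps)+
    moreover have "(y ^ k - 1) + real k * y ^ j * y - b * y ^ k +
        (b - real k) / 2 * (real j * y ^ (j - 1) * (y\<^sup>2 + e) + y ^ j * (2 * y))
      = (y ^ k - 1) + (real k - 1) * (b - real k) / 2 * y ^ (k - 2) * (y\<^sup>2 + e)"
      by (simp add: j field_simps pw)
    ultimately have "(S has_real_derivative (y ^ k - 1) + (real k - 1) * (b - real k) / 2 * y ^ (k - 2) * (y\<^sup>2 + e))
        (at y within {\<alpha>..\<beta>})" by (rule DERIV_cong)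
    from DERIV_diff[OF this DN[OF y]]
    have "(Bf has_real_derivative (y ^ k - 1) + (real k - 1) * (b - real k) / 2 * y ^ (k - 2) * (y\<^sup>2 + e)
        - (real k - 1) * (b - real k) * y ^ (k - 2) * M y) (at y within {\<alpha>..\<beta>})"
      by (simp add: S_def Bf_def[abs_def])
    moreover have "(y ^ k - 1) + (real k - 1) * (b - real k) / 2 * y ^ (k - 2) * (y\<^sup>2 + e)
        - (real k - 1) * (b - real k) * y ^ (k - 2) * M y = G y"
      by (simp add: G_def field_simps)
    ultimately show ?thesis by simp
  qed
  define w where "w x = (f x ^ k - 1) * deriv f x" for x
  define a where "a x = Bf (f x)" for x
  have cube: "deriv f x ^ 3 = deriv f x * ((f x)\<^sup>2 + e - 2 * M (f x))" for x
    using sq[of x] by (simp add: power3_eq_cube power2_eq_square)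
  have Da: "DERIV a x :> w x + gch_source k b (f x) (deriv f x)" for x
  proof -
    have "(Bf has_real_derivative G (f x)) (at (f x) within range f)"
      by (rule has_field_derivative_subset[OF DBf[OF rng]]) (use rng in auto)
    from DERIV_image_chain[OF this, of "deriv f x"] have "DERIV a x :> G (f x) * deriv f x"
      using c1fun_has_deriv[of f x] by (simp add: a_def[abs_def] o_def)
    moreover have "G (f x) * deriv f x = w x + gch_source k b (f x) (deriv f x)"
      by (simp add: G_def w_def gch_source_def cube algebra_simps)
    ultimately show ?thesis by simp
  qed
  have Dw: "DERIV w x :> a x + gch_flux k b (f x) (deriv f x)" for x
  proof -
    have Df: "DERIV (\<lambda>x. f x ^ k - 1) x :> real k * f x ^ (k - 1) * deriv f x"
      by (auto intro!: derivative_eq_intros c1fun_has_deriv)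
    have "DERIV w x :> real k * f x ^ (k - 1) * (deriv f x)\<^sup>2 + (f x ^ k - 1) * f x - N (f x)"
    \<comment> \<open>At the level 1 the profile may lack a second derivative; there
      \<open>f x ^ k - 1\<close> vanishes and continuity of the slope is enough.\<close>
    proof (cases "f x = 1")
      case True
      have "isCont (deriv f) x"
        using c1fun_deriv_continuous[of UNIV f] by (simp add: continuous_on_eq_continuous_at)
      from DERIV_mult_zero[OF Df _ this] show ?thesis
        using True N(2) by (simp add: w_def[abs_def] power2_eq_square mult.assoc)
    next
      case False
      from DERIV_mult[OF Df DD[OF False]] show ?thesis
        unfolding w_def[abs_def] N(1)[OF rng False]
        by (rule DERIV_cong) (simp add: power2_eq_square algebra_simps)
    qed
    moreover have "real k * f x ^ (k - 1) * (deriv f x)\<^sup>2 + (f x ^ k - 1) * f x - N (f x) = a x + gch_flux k b (f x) (deriv f x)"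
    proof -
      have "\<kappa> * P * (y2 + e - 2 * M') + Y - N' = Y - c * R + (b - \<kappa>) / 2 * P * (y2 + e) - (N' + (b - \<kappa>) * P * M')
          + (c * R + (3 * \<kappa> - b) / 2 * P * (y2 + e - 2 * M'))" for \<kappa> P y2 M' Y N' c R
        by (simp add: field_simps)
      then show ?thesis
        unfolding a_def Bf_def gch_flux_def sq by blast
    qed
    ultimately show ?thesis by simp
  qed
  obtain B where B: "\<And>y. \<bar>gch_flux k b (f y) (deriv f y)\<bar> \<le> B" "\<And>y. \<bar>gch_source k b (f y) (deriv f y)\<bar> \<le> B"
    using gch_densities_bounded_continuous(3)[of k b f] by blast
  have "continuous_on {\<alpha>..\<beta>} Bf"
    by (rule DERIV_continuous_on[OF DBf])
  then have "compact (Bf ` {\<alpha>..\<beta>})" by (intro compact_continuous_image) simp_all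
  then obtain C1 where C1: "\<And>y. y \<in> {\<alpha>..\<beta>} \<Longrightarrow> \<bar>Bf y\<bar> \<le> C1"
    using compact_imp_bounded by (fastforce simp: bounded_iff)
  define C where "C = max C1 ((norm f ^ k + 1) * norm f)"
  have aC: "\<bar>a x\<bar> \<le> C" for x using C1[OF rng[of x]] by (simp add: a_def C_def le_max_iff_disj)
  have wC: "\<bar>w x\<bar> \<le> C" for x
  proof -
    have "\<bar>f x ^ k - 1\<bar> \<le> norm f ^ k + 1"
      using power_mono[OF c1fun_abs_le_norm(1)[of f x] abs_ge_zero, of k] unfolding power_abs[symmetric] by linarith
    then have "\<bar>w x\<bar> \<le> (norm f ^ k + 1) * norm f"
      unfolding w_def abs_mult by (intro mult_mono c1fun_abs_le_norm) auto
    then show ?thesis by (simp add: C_def le_max_iff_disj)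
  qed
  show ?thesis
    using helmholtz_inv_system[OF gch_densities_bounded_continuous(1) B(1) gch_densities_bounded_continuous(2) B(2) Dw wC Da aC]
    by (simp add: w_def nonlocal_P_eq)
qed

text \<open>While the slope is negative the orbit descends, by at most \<open>K * \<eta>\<close> in
  the given time, so it stays where \<open>Q\<close> is at least the square of \<open>a\<close>.
  Hence the slope cannot enter the gap between \<open>- a\<close> and 0.\<close>

lemma slope_persists:
  fixes \<phi> \<psi> Q :: "real \<Rightarrow> real"
  assumes D: "\<And>x. DERIV \<phi> x :> \<psi> x" and cont: "continuous_on UNIV \<psi>"
    and sq: "\<And>x. (\<psi> x)\<^sup>2 = Q (\<phi> x)" and K: "\<And>x. \<bar>\<psi> x\<bar> \<le> K"
    and start: "\<phi> x1 = y2" "\<psi> x1 < 0" and a: "0 < a" "\<And>y. y0 \<le> y \<Longrightarrow> y \<le> y2 \<Longrightarrow> a\<^sup>2 \<le> Q y"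
    and \<eta>: "K * \<eta> \<le> y2 - y0" "x \<in> {x1..x1 + \<eta>}"
  shows "a \<le> \<bar>\<psi> x\<bar>"
proof (rule ccontr)
  assume neg: "\<not> a \<le> \<bar>\<psi> x\<bar>"
  have K0: "0 \<le> K" using K[of 0] by linarith
  have "0 \<le> K * \<eta>" using K0 \<eta>(2) by (intro mult_nonneg_nonneg) auto
  then have "a\<^sup>2 \<le> (\<psi> x1)\<^sup>2" using a(2)[of y2] \<eta>(1) by (simp add: sq start)
  then have x1: "\<psi> x1 \<le> - a" using start(2) a(1) abs_le_square_iff[of a "\<psi> x1"] by simp
  \<comment> \<open>A value strictly inside the forbidden gap that the slope has to reach no later
    than at \<open>x\<close>.\<close>
  define c where "c = min (\<psi> x) (- a / 2)"
  have c: "- a < c" "c < 0" "c \<le> \<psi> x" using neg a(1) by (auto simp: c_def)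
  have "x1 \<le> x" using \<eta>(2) by simp
  from first_crossing[OF this, of "\<lambda>x. - \<psi> x" "- c"]
  obtain z where z: "x1 < z" "z \<le> x" "\<psi> z = c" "\<And>y. x1 \<le> y \<Longrightarrow> y < z \<Longrightarrow> \<psi> y < c"
    using x1 c continuous_on_minus[OF continuous_on_subset[OF cont subset_UNIV]] by (auto simp: minus_equation_iff)
  have "\<phi> z \<le> \<phi> x1"
    using z c(2) by (intro DERIV_nonpos_imp_nonincreasing[of x1 z \<phi>]) (force simp: order_le_less intro: D)+
  moreover have "\<phi> x1 - \<phi> z \<le> K * (z - x1)"
    using DERIV_bound_imp_lipschitz[OF D K, of x1 z] z(1) by simp
  moreover have "K * (z - x1) \<le> K * \<eta>"
    using z \<eta>(2) K0 by (intro mult_left_mono) auto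
  ultimately have "a\<^sup>2 \<le> (\<psi> z)\<^sup>2"
    unfolding sq using \<eta>(1) start(1) by (intro a(2)) auto
  then show False using z(3) c a(1) abs_le_square_iff[of a c] by simp
qed

text \<open>
  For \<open>b \<ge> k\<close> the repulsion \<open>h(y) = A (1 - y\<^sup>k)\<^sup>-\<^sup>b\<^sup>/\<^sup>k\<close> is not integrable at \<open>y = 1\<close>. As \<open>A\<close> tends to \<open>0\<close>
  the wave tends to a periodic peaked wave, and its slope changes sign within a short interval.
\<close>

lemma bounce_waves:
  fixes b \<eta>0 :: real
  assumes k: "1 \<le> k" and b: "real k \<le> b" and "0 < \<eta>0"
  shows "\<exists>\<eta> f. 0 < \<eta> \<and> \<eta> \<le> \<eta>0 \<and> steep_wave k b 1 \<eta> f"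
proof -
  define p where "p = b / real k"
  have k0: "0 < real k" and p: "1 \<le> p" and kp: "real k * p = b"
    using k b by (auto simp: p_def field_simps)
  define h0 where "h0 y = (1 - y ^ k) powr (- p)" for y
  have yk: "0 < 1 - y ^ k" "1 - y ^ k \<le> 1" "1 - y ^ k \<le> real k * (1 - y)" if "0 < y" "y < 1" for y :: real
  proof -
    show "0 < 1 - y ^ k" using that k by (simp add: power_less_one_iff)
    show "1 - y ^ k \<le> 1" using that by simp
    show "1 - y ^ k \<le> real k * (1 - y)"
      using Bernoulli_inequality[of "y - 1" k] that by (simp add: algebra_simps)
  qed
  have h0_pos: "0 < h0 y" if "0 < y" "y < 1" for y using yk[OF that] by (simp add: h0_def)
  have h0_mono: "h0 y \<le> h0 z" if "0 < y" "y \<le> z" "z < 1" for y z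
  proof -
    have "y ^ k \<le> z ^ k" using that by (intro power_mono) auto
    then show ?thesis
      unfolding h0_def using p yk(1)[of y] yk(1)[of z] that by (intro powr_mono2') auto
  qed
  have h0_ge: "1 / (real k * (1 - y)) \<le> h0 y" if "0 < y" "y < 1" for y
  proof -
    have "1 / (real k * (1 - y)) \<le> 1 / (1 - y ^ k)"
      using yk[OF that] that k0 by (intro divide_left_mono mult_pos_pos) auto
    also have "\<dots> = (1 - y ^ k) powr (- 1)"
      using yk(1)[OF that] by (simp add: powr_minus divide_inverse)
    also have "\<dots> \<le> h0 y"
      unfolding h0_def using yk[OF that] p by (intro powr_mono') auto
    finally show ?thesis .
  qed
  have Dh: "DERIV (\<lambda>y. (1 - y ^ k) powr c) y :> - (c * real k * y ^ (k - 1) * (1 - y ^ k) powr (c - 1))" if "0 < y" "y < 1" for y c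
  proof -
    have "DERIV (\<lambda>y. 1 - y ^ k) y :> - (real k * y ^ (k - 1))" by (auto intro!: derivative_eq_intros)
    from DERIV_fun_powr[OF this yk(1)[OF that], of c] show ?thesis
      by (simp add: algebra_simps)
  qed
  have "\<exists>F. \<forall>x::real. ereal 0 < ereal x \<longrightarrow> ereal x < ereal 1 \<longrightarrow> (F has_vector_derivative h0 x) (at x)"
  proof (rule einterval_antiderivative)
    fix x assume "ereal 0 < ereal x" "ereal x < ereal 1"
    then show "isCont h0 x" unfolding h0_def[abs_def] using DERIV_isCont[OF Dh] by simp
  qed simp
  then obtain I0 where I0: "\<And>x. 0 < x \<Longrightarrow> x < 1 \<Longrightarrow> DERIV I0 x :> h0 x"
    by (auto simp: has_real_derivative_iff_has_vector_derivative)
  \<comment> \<open>Normalised at 1/2, so that together with the energy constant -1/4 the height 1/2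
    is the lower turning point whatever \<open>A\<close> is.\<close>
  define I where "I y = I0 y - I0 (1 / 2)" for y
  have DI: "DERIV I y :> h0 y" if "0 < y" "y < 1" for y
    unfolding I_def using I0[OF that] by (auto intro!: derivative_eq_intros)
  have I_half: "I (1 / 2) = 0" by (simp add: I_def)
  have I_slope: "I z - I y \<le> (z - y) * h0 z" "0 \<le> I z - I y" if "0 < y" "y \<le> z" "z < 1" for y z
  proof -
    have "I z - I y \<le> (z - y) * h0 z \<and> 0 \<le> I z - I y"
    proof (cases "y = z")
      case False
      with that obtain w where w: "y < w" "w < z" "I z - I y = (z - y) * h0 w"
        using MVT2[of y z I h0] DI by force
      then show ?thesis
        using h0_mono[of w z] h0_pos[of w] that by (auto intro: mult_left_mono)
    qed simp
    then show "I z - I y \<le> (z - y) * h0 z" "0 \<le> I z - I y" by auto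
  qed
  \<comment> \<open>Since \<open>p\<close> is at least 1, \<open>h0\<close> dominates a multiple of
    \<open>1 / (1 - y)\<close>, and its primitive diverges at least logarithmically.\<close>
  have I_ge: "(ln (1 / 2) - ln (1 - y)) / real k \<le> I y" if "1 / 2 \<le> y" "y < 1" for y
  proof -
    have "I (1 / 2) - (- ln (1 - 1 / 2) / real k) \<le> I y - (- ln (1 - y) / real k)"
    proof (rule DERIV_nonneg_imp_nondecreasing[OF that(1)])
      fix x assume x: "1 / 2 \<le> x" "x \<le> y"
      then have x1: "0 < x" "x < 1" using that by auto
      have "DERIV (\<lambda>y. I y - (- ln (1 - y) / real k)) x :> h0 x - 1 / (real k * (1 - x))"
        using x1 k0 by (auto intro!: derivative_eq_intros DI simp: field_simps)
      then show "\<exists>d. DERIV (\<lambda>y. I y - (- ln (1 - y) / real k)) x :> d \<and> 0 \<le> d"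
        using h0_ge[OF x1] by (intro exI conjI) auto
    qed
    then show ?thesis by (simp add: I_half diff_divide_distrib)
  qed
  have blowup: "\<exists>\<delta>>0. \<forall>y. 1 - \<delta> \<le> y \<longrightarrow> y < 1 \<longrightarrow> 1 / 2 \<le> y \<and> Z \<le> h0 y \<and> Z \<le> I y" if "0 < Z" for Z
  proof (intro exI conjI allI impI)
    define \<delta> where "\<delta> = min (1 / (real k * Z)) (exp (- real k * Z) / 2)"
    show "0 < \<delta>" using that k0 by (simp add: \<delta>_def)
    fix y assume y: "1 - \<delta> \<le> y" "y < 1"
    have "exp (- real k * Z) \<le> 1" using that k0 by simp
    moreover have "\<delta> \<le> exp (- real k * Z) / 2" by (simp add: \<delta>_def)
    ultimately show half: "1 / 2 \<le> y" using y(1) by linarith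
    have "real k * (1 - y) \<le> real k * (1 / (real k * Z))"
      using y k0 by (intro mult_left_mono) (auto simp: \<delta>_def)
    then have "1 / (1 / Z) \<le> 1 / (real k * (1 - y))"
      using y k0 that by (intro divide_left_mono mult_pos_pos) auto
    then show "Z \<le> h0 y" using h0_ge[of y] y half by simp
    have "ln (1 - y) \<le> ln (exp (- real k * Z) / 2)"
      using y by (subst ln_le_cancel_iff) (auto simp: \<delta>_def)
    then have "real k * Z \<le> ln (1 / 2) - ln (1 - y)"
      by (simp add: ln_div)
    then have "Z \<le> (ln (1 / 2) - ln (1 - y)) / real k"
      using k0 by (simp add: pos_le_divide_eq mult.commute)
    then show "Z \<le> I y" using I_ge[OF half y(2)] by simp
  qed
  \<comment> \<open>\<open>H\<close> bounds \<open>h0\<close> on [1/2, 3/4] and \<open>V\<close>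
    bounds it on [1/2, 31/32]; sufficiently close to 1 both \<open>h0\<close> and \<open>I\<close>
    exceed any multiple of them.\<close>
  define H where "H = h0 (3 / 4)"
  define V where "V = h0 (31 / 32)"
  have HV: "0 < H" "0 < V" "h0 (1 / 2) \<le> H" by (auto simp: H_def V_def intro: h0_pos h0_mono)
  obtain \<delta> where \<delta>: "0 < \<delta>" "\<And>y. 1 - \<delta> \<le> y \<Longrightarrow> y < 1 \<Longrightarrow> 16 * V + H \<le> h0 y \<and> 16 * V + H \<le> I y"
    using blowup[of "16 * V + H"] HV by auto
  define \<eta> where "\<eta> = min \<eta>0 (min (1 / 8) \<delta>)"
  have \<eta>: "0 < \<eta>" "\<eta> \<le> \<eta>0" "\<eta> \<le> 1 / 8" "\<eta> \<le> \<delta>" using \<delta>(1) \<open>0 < \<eta>0\<close> by (auto simp: \<eta>_def)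
  \<comment> \<open>The upper turning point will lie between \<open>y2\<close> and 1. The fall from
    there to \<open>y2\<close>, at deceleration at least 1, loses a height below
    \<open>\<eta>\<^sup>2 / 2\<close> and so takes at most a time \<open>\<eta>\<close>.\<close>
  define y2 where "y2 = 1 - \<eta>\<^sup>2 / 2"
  have "\<eta>\<^sup>2 \<le> 1 / 8 * \<eta>" unfolding power2_eq_square using \<eta> by (intro mult_right_mono) auto
  then have y2: "31 / 32 \<le> y2" "y2 < 1" "1 - \<delta> \<le> y2"
    using \<eta> by (auto simp: y2_def)
  have hI: "16 * V + H \<le> h0 y2" "16 * V + H \<le> I y2" using \<delta>(2)[OF y2(3,2)] by auto
  \<comment> \<open>Near 1 the force outgrows its potential: beyond 31/32 the potential gains at
    most 1/32 of \<open>h0 y2\<close>, and its earlier part is bounded through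
    \<open>V\<close>.\<close>
  have I_le: "16 * I y2 \<le> h0 y2"
  proof -
    have "I (31 / 32) - I (1 / 2) \<le> (31 / 32 - 1 / 2) * V" unfolding V_def by (rule I_slope) auto
    then have "32 * I (31 / 32) \<le> 15 * V" using I_half by simp
    moreover have "I y2 - I (31 / 32) \<le> (y2 - 31 / 32) * h0 y2" using y2 by (intro I_slope) auto
    moreover have "(y2 - 31 / 32) * h0 y2 \<le> 1 / 32 * h0 y2"
      using y2 h0_pos[of y2] by (intro mult_right_mono) auto
    then have "32 * I y2 - 32 * I (31 / 32) \<le> h0 y2" using calculation by linarith
    ultimately show ?thesis using hI(1) HV by linarith
  qed
  have I2: "0 < I y2" using hI HV by linarith
  \<comment> \<open>The potential energy at \<open>y2\<close> is set to 1/8. This leaves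
    \<open>Q\<close> at least 1/16 on [3/4, y2], while by \<open>I_le\<close> the force at
    \<open>y2\<close> has already reached 2.\<close>
  define A where "A = 1 / (8 * I y2)"
  have A: "0 < A" "A * I y2 = 1 / 8" "2 \<le> A * h0 y2" "A * H \<le> 1 / 8"
  proof -
    show "0 < A" "A * I y2 = 1 / 8" using I2 by (auto simp: A_def)
    have "A * (16 * I y2) \<le> A * h0 y2" using I_le \<open>0 < A\<close> by (intro mult_left_mono) auto
    then show "2 \<le> A * h0 y2" using \<open>A * I y2 = 1 / 8\<close> by linarith
    show "A * H \<le> 1 / 8" using mult_left_mono[of H "I y2" A] \<open>0 < A\<close> \<open>A * I y2 = 1 / 8\<close> hI HV by simp
  qed
  define Q where "Q y = y\<^sup>2 + (- 1 / 4) - 2 * (A * I y)" for y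
  have DQ: "DERIV Q y :> 2 * (y - A * h0 y)" if "0 < y" "y < 1" for y
    unfolding Q_def using DI[OF that] by (auto intro!: derivative_eq_intros)
  have Qcont: "continuous_on {c..d} Q" if "0 < c" "d < 1" for c d
    by (rule DERIV_continuous_on[OF has_field_derivative_at_within[OF DQ]]) (use that in auto)
  have Q34: "1 / 16 \<le> Q y" if y: "3 / 4 \<le> y" "y \<le> y2" for y
  proof -
    have "A * I y \<le> A * I y2" using I_slope(2)[of y y2] y y2 A(1) by (intro mult_left_mono) auto
    moreover have "(3 / 4)\<^sup>2 \<le> y\<^sup>2" using y by (intro power_mono) auto
    ultimately show ?thesis using A(2) by (simp add: Q_def power2_eq_square)
  qed
  have Qlow: "0 < Q y" if y: "1 / 2 < y" "y \<le> 3 / 4" for y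
  proof -
    have "I y - I (1 / 2) \<le> (y - 1 / 2) * h0 y" using y by (intro I_slope) auto
    also have "\<dots> \<le> (y - 1 / 2) * H" unfolding H_def using y by (intro mult_left_mono h0_mono) auto
    finally have "A * I y \<le> (y - 1 / 2) * (A * H)"
      using A(1) by (simp add: I_half mult.left_commute mult_left_mono)
    also have "\<dots> \<le> (y - 1 / 2) * (1 / 8)" using A(4) y by (intro mult_left_mono) auto
    finally have "2 * (A * I y) \<le> (y - 1 / 2) * (1 / 4)" by simp
    also have "\<dots> < (y - 1 / 2) * (y + 1 / 2)" using y by (intro mult_strict_left_mono) auto
    also have "\<dots> = y\<^sup>2 + (- 1 / 4)" by (simp add: power2_eq_square algebra_simps)
    finally show ?thesis by (simp add: Q_def)
  qed
  \<comment> \<open>Where \<open>I\<close> is four times its value at \<open>y2\<close>, twice the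
    potential energy is at least 1, so \<open>Q\<close> is negative and a turning point lies in
    between.\<close>
  obtain \<delta>' where \<delta>': "0 < \<delta>'" "\<And>y. 1 - \<delta>' \<le> y \<Longrightarrow> y < 1 \<Longrightarrow> 4 * I y2 \<le> I y"
    using blowup[of "4 * I y2"] I2 by auto
  define ys where "ys = max y2 (1 - \<delta>')"
  have ys: "y2 \<le> ys" "ys < 1" using y2 \<delta>' by (auto simp: ys_def)
  have "A * (4 * I y2) \<le> A * I ys" using \<delta>'(2)[of ys] ys A(1) by (intro mult_left_mono) (auto simp: ys_def)
  moreover have "ys\<^sup>2 \<le> 1" using ys y2 by (simp add: power_le_one)
  ultimately have "Q ys \<le> 0" using A(2) by (simp add: Q_def)
  then obtain \<beta> where \<beta>: "y2 < \<beta>" "\<beta> \<le> ys" "Q \<beta> = 0" "\<And>y. y2 \<le> y \<Longrightarrow> y < \<beta> \<Longrightarrow> 0 < Q y"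
    using first_crossing[OF ys(1) Qcont, of 0] Q34[of y2] y2 ys by auto
  have \<beta>1: "\<beta> < 1" "1 / 2 < \<beta>" using \<beta> ys y2 by auto
  have Qhalf: "Q (1 / 2) = 0" by (simp add: Q_def I_half power2_eq_square)
  have Qpos: "0 < Q y" if "1 / 2 < y" "y < \<beta>" for y
    using Qlow[of y] Q34[of y] \<beta>(4)[of y] that by linarith
  have DQw: "(Q has_real_derivative 2 * (y - A * h0 y)) (at y within {1 / 2..\<beta>})" if "y \<in> {1 / 2..\<beta>}" for y
    using that \<beta>1 by (intro has_field_derivative_at_within[OF DQ]) auto
  have Ah: "2 \<le> A * h0 y" if "y2 \<le> y" "y < 1" for y
  proof -
    have "A * h0 y2 \<le> A * h0 y" using A(1) that y2 by (intro mult_left_mono h0_mono) auto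
    then show ?thesis using A(3) by linarith
  qed
  have qa: "0 < 2 * (1 / 2 - A * h0 (1 / 2))"
  proof -
    have "A * h0 (1 / 2) \<le> A * H" using A(1) HV(3) by (intro mult_left_mono) auto
    then show ?thesis using A(4) by simp
  qed
  have qb: "2 * (\<beta> - A * h0 \<beta>) < 0"
    using Ah[of \<beta>] \<beta> \<beta>1 by simp
  obtain f :: c1fun where uc: "uniformly_continuous_on UNIV (deriv f)"
    and rng: "\<And>x. f x \<in> {1 / 2..\<beta>}" and sq: "\<And>x. (deriv f x)\<^sup>2 = Q (f x)" and init: "f 0 = \<beta>"
    and DD: "\<And>x q. (Q has_real_derivative q) (at (f x) within {1 / 2..\<beta>}) \<Longrightarrow> DERIV (deriv f) x :> q / 2"
    by (rule oscillator_c1fun[OF \<beta>1(2) Qcont Qhalf \<beta>(3) Qpos DQw qa DQw qb]) (use \<beta>1 in auto)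
  have D2: "DERIV (deriv f) x :> f x - A * h0 (f x)" for x
    using DD[OF DQw[OF rng]] by (rule DERIV_cong) simp
  have Q1: "Q y \<le> 1" if "y \<in> {1 / 2..\<beta>}" for y
  proof -
    have "0 \<le> A * I y" using I_slope(2)[of "1 / 2" y] that \<beta>1 A(1) by (simp add: I_half)
    moreover have "y\<^sup>2 \<le> 1" using that \<beta>1 by (simp add: power_le_one)
    ultimately show ?thesis by (simp add: Q_def)
  qed
  have d1: "\<bar>deriv f x\<bar> \<le> 1" for x
    using Q1[OF rng[of x]] by (simp add: sq[symmetric] abs_square_le_1)
  \<comment> \<open>The orbit stays below \<open>\<beta>\<close>, hence away from the singularity:
    the second derivative is bounded and a linear function dominates.\<close>
  have bv: "locally_bv 1 (1 + A * h0 \<beta>) (deriv f)"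
    unfolding locally_bv_def
  proof (intro allI exI[of _ "\<lambda>x. (1 + A * h0 \<beta>) * x"] conjI impI)
    fix x y :: real assume "x \<le> y"
    have "\<bar>f x - A * h0 (f x)\<bar> \<le> 1 + A * h0 \<beta>" for x
    proof -
      have "A * h0 (f x) \<le> A * h0 \<beta>" "0 < A * h0 (f x)"
        using rng[of x] \<beta>1 A(1) by (auto intro!: mult_left_mono h0_mono mult_pos_pos h0_pos)
      then show ?thesis using rng[of x] \<beta>1 by (auto simp: abs_le_iff)
    qed
    from DERIV_bound_imp_lipschitz[OF D2 this, of y x]
    show "\<bar>deriv f y - deriv f x\<bar> \<le> (1 + A * h0 \<beta>) * y - (1 + A * h0 \<beta>) * x"
      using \<open>x \<le> y\<close> by (simp add: right_diff_distrib)
  qed (simp add: algebra_simps)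
  \<comment> \<open>The orbit never reaches 1; in \<open>N\<close> the value 0 from there on meets
    the requirement \<open>N 1 = 0\<close>.\<close>
  have wave: "(f x ^ k - 1) * deriv f x = nonlocal_P k b f x" for x
  proof (rule potential_wave[OF k rng, where M = "\<lambda>y. A * I y" and h = "\<lambda>y. A * h0 y" and e = "- 1 / 4"
        and N = "\<lambda>y. - A * (if y < 1 then (1 - y ^ k) powr (1 - p) else 0)"])
    show "(deriv f x)\<^sup>2 = (f x)\<^sup>2 + - 1 / 4 - 2 * (A * I (f x))" for x
      using sq by (simp add: Q_def)
    show "- A * (if y < 1 then (1 - y ^ k) powr (1 - p) else 0) = (y ^ k - 1) * (A * h0 y)" if "y \<in> {1 / 2..\<beta>}" for y
    proof -
      have y: "0 < y" "y < 1" using that \<beta>1 by auto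
      have "(1 - y ^ k) powr (1 - p) = (1 - y ^ k) * h0 y"
        using yk(1)[OF y] powr_add[of "1 - y ^ k" 1 "- p"] by (simp add: h0_def)
      moreover have "- A * ((1 - y ^ k) * h0 y) = (y ^ k - 1) * (A * h0 y)" by (simp add: algebra_simps)
      ultimately show ?thesis using y by simp
    qed
    show "((\<lambda>y. - A * (if y < 1 then (1 - y ^ k) powr (1 - p) else 0) + (b - real k) * y ^ (k - 1) * (A * I y)) has_real_derivative
        (real k - 1) * (b - real k) * y ^ (k - 2) * (A * I y)) (at y within {1 / 2..\<beta>})" if "y \<in> {1 / 2..\<beta>}" for y
    proof -
      have y: "0 < y" "y < 1" using that \<beta>1 by auto
      have "DERIV (\<lambda>y. y ^ (k - 1)) y :> (real k - 1) * y ^ (k - 2)"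
        using k by (auto intro!: derivative_eq_intros simp: of_nat_diff numeral_2_eq_2)
      then have "DERIV (\<lambda>y. - A * (1 - y ^ k) powr (1 - p) + (b - real k) * y ^ (k - 1) * (A * I y)) y :>
        - A * (- ((1 - p) * real k * y ^ (k - 1) * (1 - y ^ k) powr (1 - p - 1)))
          + ((b - real k) * ((real k - 1) * y ^ (k - 2)) * (A * I y) + (b - real k) * y ^ (k - 1) * (A * h0 y))"
        by (intro DERIV_add DERIV_cmult DERIV_mult Dh[OF y] DI[OF y]
            DERIV_cong[OF DERIV_add[OF DERIV_cmult[OF Dh[OF y]] DERIV_mult[OF DERIV_cmult DERIV_cmult[OF DI[OF y]]]]]) 
          (auto simp: mult_ac)
      moreover have "- A * (- ((1 - p) * real k * y ^ (k - 1) * (1 - y ^ k) powr (1 - p - 1)))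
          + ((b - real k) * ((real k - 1) * y ^ (k - 2)) * (A * I y) + (b - real k) * y ^ (k - 1) * (A * h0 y))
        = (real k - 1) * (b - real k) * y ^ (k - 2) * (A * I y)"
        unfolding kp[symmetric] by (simp add: h0_def algebra_simps)
      ultimately have "DERIV (\<lambda>y. - A * (1 - y ^ k) powr (1 - p) + (b - real k) * y ^ (k - 1) * (A * I y)) y :>
        (real k - 1) * (b - real k) * y ^ (k - 2) * (A * I y)" by (rule DERIV_cong)
      then have "DERIV (\<lambda>y. - A * (if y < 1 then (1 - y ^ k) powr (1 - p) else 0) + (b - real k) * y ^ (k - 1) * (A * I y)) y :>
        (real k - 1) * (b - real k) * y ^ (k - 2) * (A * I y)"
        by (rule has_field_derivative_transform_within_open[of _ _ _ "{..<1}"]) (use y in auto)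
      then show ?thesis by (rule has_field_derivative_at_within)
    qed
  qed (use D2 in auto)
  have prof: "wave_profile k b f"
    unfolding wave_profile_def using uc bv wave zero_less_one by blast
  have d0: "deriv f 0 = 0" using sq[of 0] init \<beta>(3) by simp
  define u where "u = \<beta> - y2"
  have u: "0 < u" "2 * u \<le> \<eta>\<^sup>2" using \<beta> \<beta>1 by (auto simp: u_def y2_def)
  obtain x1 where x1: "0 < x1" "x1 \<le> sqrt (2 * u / 1)" "f x1 = \<beta> - u" "deriv f x1 < 0"
  proof (rule descent_time[OF c1fun_has_deriv d0 init u(1) zero_less_one])
    show "f x \<le> \<beta>" for x using rng[of x] by simp
    show "\<exists>d. DERIV (deriv f) x :> d \<and> d \<le> - 1" if "\<beta> - u \<le> f x" for x
      using Ah[of "f x"] that rng[of x] \<beta>1 by (intro exI[of _ "f x - A * h0 (f x)"] conjI D2) (auto simp: u_def)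
  qed
  have x1\<eta>: "x1 \<le> \<eta>" using x1(2) real_sqrt_le_mono[OF u(2)] \<eta>(1) by simp
  have "1 / 4 \<le> \<bar>deriv f x\<bar>" if "x \<in> {x1..x1 + \<eta>}" for x
  proof (rule slope_persists[OF c1fun_has_deriv c1fun_deriv_continuous sq d1 _ x1(4) _ _ _ that, of y2 _ "3 / 4"])
    show "f x1 = y2" using x1(3) by (simp add: u_def)
    show "(1 / 4)\<^sup>2 \<le> Q y" if "3 / 4 \<le> y" "y \<le> y2" for y
      using Q34[OF that] by (simp add: power2_eq_square)
    show "1 * \<eta> \<le> y2 - 3 / 4" using \<eta>(3) y2(1) by simp
  qed simp
  moreover have "\<bar>f x\<bar> \<le> 2" "\<bar>deriv f x\<bar> \<le> 2" for x
    using rng[of x] \<beta>1 d1[of x] by auto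
  ultimately show ?thesis
    unfolding steep_wave_def using \<eta>(1,2) prof d0 x1(1) x1\<eta>
    by (intro exI[of _ \<eta>] exI[of _ f] exI[of _ x1] conjI) auto
qed

text \<open>For \<open>q < 1\<close> the weight is singular at 0. The substitution \<tau> =
  \<open>d powr q\<close> turns it into the continuous integrand \<open>n\<close>, bounded by
  \<open>c1 / q\<close> and \<open>c2 / q\<close>.\<close>

lemma power_weight_primitive:
  fixes \<gamma> :: "real \<Rightarrow> real"
  assumes cont: "continuous_on UNIV \<gamma>" and \<gamma>: "\<And>d. c1 \<le> \<gamma> d" "\<And>d. \<gamma> d \<le> c2" and q: "0 < q"
  obtains S where "S 0 = 0" "continuous_on {0..} S"
    "\<And>d. 0 < d \<Longrightarrow> DERIV S d :> \<gamma> d * d powr (q - 1)"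
    "\<And>d. 0 \<le> d \<Longrightarrow> c1 / q * d powr q \<le> S d" "\<And>d. 0 \<le> d \<Longrightarrow> S d \<le> c2 / q * d powr q"
proof -
  define n where "n \<tau> = \<gamma> (max 0 \<tau> powr (1 / q)) / q" for \<tau>
  have "continuous_on UNIV (\<lambda>\<tau>. max 0 \<tau> powr (1 / q))"
    using q by (intro continuous_on_powr' continuous_intros) auto
  from continuous_on_compose2[OF cont this] have "continuous_on UNIV n"
    unfolding n_def using q by (intro continuous_on_divide continuous_on_const) auto
  then obtain F where F: "\<And>x. DERIV F x :> n x" using continuous_real_antiderivative by blast
  have n: "c1 / q \<le> n \<tau>" "n \<tau> \<le> c2 / q" for \<tau>
    using \<gamma> q by (auto simp: n_def divide_right_mono)
  have "c1 / q * \<tau> \<le> F \<tau> - F 0 \<and> F \<tau> - F 0 \<le> c2 / q * \<tau>" if "0 \<le> \<tau>" for \<tau>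
  proof (cases "\<tau> = 0")
    case False
    with that obtain z where "F \<tau> - F 0 = (\<tau> - 0) * n z" using MVT2[of 0 \<tau> F n] F by force
    then show ?thesis using mult_left_mono[OF n(1)[of z] that] mult_left_mono[OF n(2)[of z] that]
      by (simp add: mult.commute)
  qed simp
  note bd = this
  show ?thesis
  proof (rule that[of "\<lambda>d. F (d powr q) - F 0"])
    show "continuous_on {0..} (\<lambda>d. F (d powr q) - F 0)"
    proof -
      have "continuous_on UNIV F" by (rule DERIV_continuous_on[OF F])
      moreover have "continuous_on {0..} (\<lambda>d :: real. d powr q)"
        using q by (intro continuous_on_powr' continuous_intros) auto
      ultimately have "continuous_on {0..} (\<lambda>d. F (d powr q))"
        by (rule continuous_on_compose2) auto
      then show ?thesis by (intro continuous_intros)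
    qed
    fix d :: real assume d: "0 < d"
    have "DERIV (\<lambda>d. d powr q) d :> q * d powr (q - 1)"
      using d by (auto intro!: derivative_eq_intros)
    from DERIV_diff[OF DERIV_chain2[OF F this] DERIV_const]
    have "DERIV (\<lambda>d. F (d powr q) - F 0) d :> n (d powr q) * (q * d powr (q - 1)) - 0" .
    moreover have "n (d powr q) * (q * d powr (q - 1)) - 0 = \<gamma> d * d powr (q - 1)"
      using d q by (simp add: n_def powr_powr)
    ultimately show "DERIV (\<lambda>d. F (d powr q) - F 0) d :> \<gamma> d * d powr (q - 1)" by (rule DERIV_cong)
  qed (use bd in auto)
qed

text \<open>
  For \<open>b < k\<close> the restoring force \<open>h(y) = A sgn(y - 1) \<bar>y\<^sup>k - 1\<bar>\<^sup>-\<^sup>b\<^sup>/\<^sup>k\<close> is integrable at \<open>y = 1\<close>. As \<open>A\<close> tends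
  to infinity the waves oscillate about \<open>1\<close> with slopes of order one and small wave length. For
  \<open>0 < b < k\<close> the second derivative is unbounded where the wave crosses the level \<open>1\<close>.
\<close>

lemma crossing_potential:
  fixes b :: real
  assumes k: "1 \<le> k" and b: "b < real k"
  defines "p \<equiv> - b / real k"
  defines "h \<equiv> \<lambda>y :: real. if 1 < y then (y ^ k - 1) powr p else if y < 1 then - ((1 - y ^ k) powr p) else 0"
  defines "N \<equiv> \<lambda>y :: real. \<bar>y ^ k - 1\<bar> powr (p + 1)"
  obtains M c1 c2 where "0 < c1" "c1 \<le> c2" "M 1 = 0" "continuous_on UNIV M"
    "\<And>y. y \<in> {1/2..3/2} \<Longrightarrow> y \<noteq> 1 \<Longrightarrow> DERIV M y :> h y"
    "\<And>y. y \<in> {1/2..3/2} \<Longrightarrow> c1 / (p + 1) * \<bar>y - 1\<bar> powr (p + 1) \<le> M y"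
    "\<And>y. y \<in> {1/2..3/2} \<Longrightarrow> M y \<le> c2 / (p + 1) * \<bar>y - 1\<bar> powr (p + 1)"
    "\<And>y. y \<in> {1/2..3/2} \<Longrightarrow> 1 < y \<Longrightarrow> c1 * (y - 1) powr p \<le> h y"
    "\<And>y. y \<in> {1/2..3/2} \<Longrightarrow> ((\<lambda>y. N y + (b - real k) * y ^ (k - 1) * M y) has_real_derivative
      (real k - 1) * (b - real k) * y ^ (k - 2) * M y) (at y within {1/2..3/2})"
proof -
  have k0: "0 < real k" using k by simp
  define q where "q = p + 1"
  have q: "0 < q" using b k0 by (simp add: q_def p_def field_simps)
  have kq: "real k * q = real k - b" using k0 by (simp add: q_def p_def field_simps)
  \<comment> \<open>Factoring \<open>y ^ k - 1\<close> separates the singular power of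
    \<open>y - 1\<close> from the regular weight \<open>g y powr p\<close>.\<close>
  define g where "g y = (\<Sum>i<k. y ^ i)" for y :: real
  have gpow: "y ^ k - 1 = (y - 1) * g y" for y
    by (simp add: g_def power_diff_1_eq)
  define G where "G = g (3 / 2)"
  have g1: "1 \<le> g y" "g y \<le> G" if "y \<in> {1/2..3/2}" for y
  proof -
    have "y ^ 0 \<le> g y" unfolding g_def using k that by (intro member_le_sum) auto
    then show "1 \<le> g y" by simp
    show "g y \<le> G" unfolding G_def g_def using that by (intro sum_mono power_mono) auto
  qed
  have G1: "1 \<le> G" using g1[of 1] by auto
  \<comment> \<open>\<open>p\<close> may have either sign, so the extreme values of
    \<open>g y powr p\<close> are bounded by both candidates, 1 and \<open>G powr p\<close>.\<close>
  define c1 where "c1 = min 1 (G powr p)"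
  define c2 where "c2 = max 1 (G powr p)"
  have c: "0 < c1" "c1 \<le> c2" using G1 by (auto simp: c1_def c2_def)
  have gp: "c1 \<le> g y powr p" "g y powr p \<le> c2" if "y \<in> {1/2..3/2}" for y
  proof -
    note g = g1[OF that]
    have "c1 \<le> g y powr p \<and> g y powr p \<le> c2"
    proof (cases "0 \<le> p")
      case True
      then have "1 \<le> g y powr p" "g y powr p \<le> G powr p"
        using g by (auto intro: ge_one_powr_ge_zero powr_mono2)
      then show ?thesis by (auto simp: c1_def c2_def)
    next
      case False
      then have "g y powr p \<le> 1 powr p" "G powr p \<le> g y powr p"
        using g by (auto intro: powr_mono2' simp del: powr_one_eq_one)
      then show ?thesis by (auto simp: c1_def c2_def)
    qed
    then show "c1 \<le> g y powr p" "g y powr p \<le> c2" by auto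
  qed
  \<comment> \<open>Clamping to [1/2, 3/2] gives the weights global bounds without changing them
    where they matter.\<close>
  define cl where "cl y = max (1 / 2) (min (3 / 2) y)" for y :: real
  have cl: "cl y \<in> {1/2..3/2}" for y by (auto simp: cl_def)
  have "continuous_on UNIV (\<lambda>y. g (cl y) powr p)"
  proof (rule continuous_on_powr)
    show "continuous_on UNIV (\<lambda>y. g (cl y))"
      unfolding g_def cl_def by (intro continuous_intros)
    show "\<forall>y\<in>UNIV. g (cl y) \<noteq> 0" using g1(1)[OF cl] by (metis not_one_le_zero)
  qed (rule continuous_on_const)
  then have cont: "continuous_on UNIV (\<lambda>d. g (cl (1 + d)) powr p)" "continuous_on UNIV (\<lambda>d. g (cl (1 - d)) powr p)"
    by (rule continuous_on_compose2, intro continuous_intros, simp)+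
  obtain S where S: "S 0 = 0" "continuous_on {0..} S"
    "\<And>d. 0 < d \<Longrightarrow> DERIV S d :> g (cl (1 + d)) powr p * d powr (q - 1)"
    "\<And>d. 0 \<le> d \<Longrightarrow> c1 / q * d powr q \<le> S d" "\<And>d. 0 \<le> d \<Longrightarrow> S d \<le> c2 / q * d powr q"
    by (rule power_weight_primitive[OF cont(1) gp(1)[OF cl] gp(2)[OF cl] q]) (rule that)
  obtain S' where S': "S' 0 = 0" "continuous_on {0..} S'"
    "\<And>d. 0 < d \<Longrightarrow> DERIV S' d :> g (cl (1 - d)) powr p * d powr (q - 1)"
    "\<And>d. 0 \<le> d \<Longrightarrow> c1 / q * d powr q \<le> S' d" "\<And>d. 0 \<le> d \<Longrightarrow> S' d \<le> c2 / q * d powr q"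
    by (rule power_weight_primitive[OF cont(2) gp(1)[OF cl] gp(2)[OF cl] q]) (rule that)
  define M where "M y = (if y \<le> 1 then S' (1 - y) else S (y - 1))" for y
  have M1: "M 1 = 0" by (simp add: M_def S')
  have Mcont: "continuous_on UNIV M"
  proof -
    have "continuous_on ({..1} \<union> {1..}) M"
      unfolding M_def
    proof (rule continuous_on_If)
      show "continuous_on {..1} (\<lambda>y. S' (1 - y))" "continuous_on {1..} (\<lambda>y. S (y - 1))"
        by (auto intro!: continuous_on_compose2[OF S'(2)] continuous_on_compose2[OF S(2)] continuous_intros)
    qed (auto simp: S S')
    moreover have "{..1} \<union> {1..} = (UNIV :: real set)" by auto
    ultimately show ?thesis by simp
  qed
  have hform: "1 < y \<Longrightarrow> h y = g y powr p * (y - 1) powr p" "y < 1 \<Longrightarrow> h y = - (g y powr p * (1 - y) powr p)"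
    if "y \<in> {1/2..3/2}" for y
  proof -
    have "1 - y ^ k = (1 - y) * g y" using gpow[of y] by (simp add: algebra_simps)
    then show "1 < y \<Longrightarrow> h y = g y powr p * (y - 1) powr p" "y < 1 \<Longrightarrow> h y = - (g y powr p * (1 - y) powr p)"
      using g1(1)[OF that] by (auto simp: h_def gpow powr_mult mult.commute)
  qed
  have DM: "DERIV M y :> h y" if y: "y \<in> {1/2..3/2}" "y \<noteq> 1" for y
  proof (cases "1 < y")
    case True
    have "DERIV (\<lambda>y. S (y - 1)) y :> g (cl (1 + (y - 1))) powr p * (y - 1) powr (q - 1) * 1"
      using True by (intro DERIV_chain2[OF S(3)]) (auto intro!: derivative_eq_intros)
    then have "DERIV (\<lambda>y. S (y - 1)) y :> h y"
      using y True hform(1)[OF y(1)] by (simp add: cl_def q_def)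
    then show ?thesis
      by (rule has_field_derivative_transform_within_open[of _ _ _ "{1<..}"]) (use True in \<open>auto simp: M_def\<close>)
  next
    case False
    then have y1: "y < 1" using y by simp
    have "DERIV (\<lambda>y. S' (1 - y)) y :> g (cl (1 - (1 - y))) powr p * (1 - y) powr (q - 1) * (- 1)"
      using y1 by (intro DERIV_chain2[OF S'(3)]) (auto intro!: derivative_eq_intros)
    then have "DERIV (\<lambda>y. S' (1 - y)) y :> h y"
      using y y1 hform(2)[OF y(1)] by (simp add: cl_def q_def)
    then show ?thesis
      by (rule has_field_derivative_transform_within_open[of _ _ _ "{..<1}"]) (use y1 in \<open>auto simp: M_def\<close>)
  qed
  have Mb: "c1 / q * \<bar>y - 1\<bar> powr q \<le> M y" "M y \<le> c2 / q * \<bar>y - 1\<bar> powr q" for y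
    using S(4,5)[of "y - 1"] S'(4,5)[of "1 - y"] by (auto simp: M_def abs_real_def)
  have hb: "c1 * (y - 1) powr p \<le> h y" if "y \<in> {1/2..3/2}" "1 < y" for y
    using hform(1)[OF that] gp(1)[OF that(1)] by (simp add: mult_right_mono)
  define D where "D y = (real k - 1) * (b - real k) * y ^ (k - 2) * M y" for y
  define Tt where "Tt y = N y + (b - real k) * y ^ (k - 1) * M y" for y
  have DN: "DERIV N y :> (real k - b) * y ^ (k - 1) * h y" if y: "y \<in> {1/2..3/2}" "y \<noteq> 1" for y
  proof (cases "1 < y")
    case True
    then have pos: "0 < y ^ k - 1" using k by (simp add: one_less_power)
    have "DERIV (\<lambda>y. y ^ k - 1) y :> real k * y ^ (k - 1)" by (auto intro!: derivative_eq_intros)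
    from DERIV_fun_powr[OF this pos, of q]
    have "DERIV (\<lambda>y. (y ^ k - 1) powr q) y :> q * (y ^ k - 1) powr (q - 1) * (real k * y ^ (k - 1))" by simp
    moreover have "q * (y ^ k - 1) powr (q - 1) * (real k * y ^ (k - 1)) = (real k - b) * y ^ (k - 1) * h y"
      unfolding kq[symmetric] using True by (simp add: h_def q_def)
    ultimately have "DERIV (\<lambda>y. (y ^ k - 1) powr q) y :> (real k - b) * y ^ (k - 1) * h y" by (rule DERIV_cong)
    then show ?thesis
      by (rule has_field_derivative_transform_within_open[of _ _ _ "{1<..}"])
        (use True in \<open>auto simp: N_def q_def less_imp_le\<close>)
  next
    case False
    then have y1: "0 < y" "y < 1" using y by auto
    then have pos: "0 < 1 - y ^ k" using k by (simp add: power_less_one_iff)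
    have "DERIV (\<lambda>y. 1 - y ^ k) y :> - (real k * y ^ (k - 1))" by (auto intro!: derivative_eq_intros)
    from DERIV_fun_powr[OF this pos, of q]
    have "DERIV (\<lambda>y. (1 - y ^ k) powr q) y :> q * (1 - y ^ k) powr (q - 1) * - (real k * y ^ (k - 1))" by simp
    moreover have "q * (1 - y ^ k) powr (q - 1) * - (real k * y ^ (k - 1)) = (real k - b) * y ^ (k - 1) * h y"
      unfolding kq[symmetric] using y1 by (simp add: h_def q_def)
    ultimately have D1: "DERIV (\<lambda>y. (1 - y ^ k) powr q) y :> (real k - b) * y ^ (k - 1) * h y" by (rule DERIV_cong)
    have D2: "(1 - x ^ k) powr q = N x" if "x \<in> {0<..<1}" for x
    proof -
      have "\<bar>x ^ k - 1\<bar> = 1 - x ^ k" using that power_le_one[of x k] by simp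
      then show ?thesis by (simp add: N_def q_def)
    qed
    show ?thesis
      by (rule has_field_derivative_transform_within_open[OF D1, of "{0<..<1}"]) (use y1 D2 in auto)
  qed
  have DT: "DERIV Tt y :> D y" if y: "y \<in> {1/2..3/2}" "y \<noteq> 1" for y
  proof -
    have "DERIV (\<lambda>y. y ^ (k - 1)) y :> (real k - 1) * y ^ (k - 2)"
      using k by (auto intro!: derivative_eq_intros simp: of_nat_diff numeral_2_eq_2)
    then have "DERIV Tt y :> (real k - b) * y ^ (k - 1) * h y + ((b - real k) * ((real k - 1) * y ^ (k - 2)) * M y + h y * ((b - real k) * y ^ (k - 1)))"
      unfolding Tt_def by (intro DERIV_add DERIV_mult DERIV_cmult DN[OF y] DM[OF y])
    then show ?thesis by (rule DERIV_cong) (simp add: D_def algebra_simps)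
  qed
  have Dcont: "continuous_on UNIV D"
    unfolding D_def by (intro continuous_intros Mcont)
  then obtain Z where Z: "\<And>x. DERIV Z x :> D x" using continuous_real_antiderivative by blast
  have Ncont: "continuous_on UNIV N"
    unfolding N_def using q by (intro continuous_on_powr' continuous_intros) (auto simp: q_def)
  have Tcont: "continuous_on UNIV Tt"
    unfolding Tt_def by (intro continuous_intros Mcont Ncont)
  \<comment> \<open>At 1 the chain rule fails for \<open>Tt\<close>. Off 1 its derivative is the
    continuous \<open>D\<close>, so \<open>Tt\<close> differs from a primitive \<open>Z\<close> by a
    constant on both sides; by continuity the constant is the same, and \<open>Tt\<close> is
    differentiable at 1 as well.\<close>
  define E where "E y = Tt y - Z y" for y
  have Econst: "E y = E 1" if "y \<in> {1/2..3/2}" for y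
  proof (rule has_derivative_zero_unique_strong_convex[of "{1/2..3/2}" "{1}" E 1])
    show "continuous_on {1/2..3/2} E"
      unfolding E_def by (intro continuous_intros continuous_on_subset[OF Tcont] DERIV_continuous_on[OF has_field_derivative_at_within[OF Z]]) auto
    fix x :: real assume "x \<in> {1/2..3/2} - {1}"
    then have "DERIV E x :> D x - D x"
      unfolding E_def by (intro DERIV_diff DT Z) auto
    then show "(E has_derivative (\<lambda>h. 0)) (at x within {1/2..3/2})"
      by (simp add: has_field_derivative_def has_derivative_at_withinI lambda_zero)
  qed (use that in auto)
  have DTw: "(Tt has_real_derivative D y) (at y within {1/2..3/2})" if y: "y \<in> {1/2..3/2}" for y
  proof -
    have "((\<lambda>y. Z y + E 1) has_real_derivative D y + 0) (at y within {1/2..3/2})"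
      by (intro DERIV_add DERIV_const has_field_derivative_at_within[OF Z])
    then have "((\<lambda>y. Z y + E 1) has_real_derivative D y) (at y within {1/2..3/2})" by simp
    then show ?thesis
    proof (rule has_field_derivative_transform_within[OF _ zero_less_one y])
      fix x :: real assume "x \<in> {1/2..3/2}"
      from Econst[OF this] show "Z x + E 1 = Tt x" by (simp add: E_def)
    qed
  qed
  show ?thesis
  proof (rule that[OF c M1 Mcont DM])
    show "((\<lambda>y. N y + (b - real k) * y ^ (k - 1) * M y) has_real_derivative
      (real k - 1) * (b - real k) * y ^ (k - 2) * M y) (at y within {1/2..3/2})" if "y \<in> {1/2..3/2}" for y
      using DTw[OF that] by (simp add: Tt_def[abs_def] D_def)
  qed (use Mb hb in \<open>auto simp: q_def\<close>)
qed

text \<open>Scaling behind the constants: for amplitude \<open>u\<close> the condition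
  \<open>Q \<beta> = 0\<close> makes \<open>A * u powr q\<close> of order one. The force
  \<open>A * u powr p\<close> is then of order \<open>1 / u\<close> and the fall from the crest
  takes a time of order \<open>u\<close>. Hence \<open>L\<close> depends on \<open>k\<close> and
  \<open>b\<close> alone.\<close>

lemma crossing_waves:
  fixes b :: real
  assumes k: "1 \<le> k" and b: "b < real k"
  shows "\<exists>L>0. \<forall>\<eta>0>0. \<exists>\<eta> f. 0 < \<eta> \<and> \<eta> \<le> \<eta>0 \<and> steep_wave k b L \<eta> f"
proof -
  define p where "p = - b / real k"
  define q where "q = p + 1"
  have k0: "0 < real k" using k by simp
  have q: "0 < q" using b k0 by (simp add: q_def p_def field_simps)
  define h0 where "h0 y = (if 1 < y then (y ^ k - 1) powr p else if y < 1 then - ((1 - y ^ k) powr p) else 0)" for y :: real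
  define N0 where "N0 y = \<bar>y ^ k - 1\<bar> powr q" for y :: real
  obtain M0 c1 c2 where c: "0 < c1" "c1 \<le> c2" and M1: "M0 1 = 0" and Mcont: "continuous_on UNIV M0"
    and DM: "\<And>y. y \<in> {1/2..3/2} \<Longrightarrow> y \<noteq> 1 \<Longrightarrow> DERIV M0 y :> h0 y"
    and Mb: "\<And>y. y \<in> {1/2..3/2} \<Longrightarrow> c1 / q * \<bar>y - 1\<bar> powr q \<le> M0 y"
    "\<And>y. y \<in> {1/2..3/2} \<Longrightarrow> M0 y \<le> c2 / q * \<bar>y - 1\<bar> powr q"
    and hb: "\<And>y. y \<in> {1/2..3/2} \<Longrightarrow> 1 < y \<Longrightarrow> c1 * (y - 1) powr p \<le> h0 y"
    and DN: "\<And>y. y \<in> {1/2..3/2} \<Longrightarrow> ((\<lambda>y. N0 y + (b - real k) * y ^ (k - 1) * M0 y) has_real_derivative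
      (real k - 1) * (b - real k) * y ^ (k - 2) * M0 y) (at y within {1/2..3/2})"
    by (rule crossing_potential[OF k b, folded p_def, folded q_def, folded h0_def N0_def]) (rule that)
  have c2: "0 < c2" using c by simp
  \<comment> \<open>Within distance \<open>\<rho> * u\<close> of the level 1 the potential energy is
    then at most 1/8 and the slope at least 1/2: the steep zone.\<close>
  define \<rho> where "\<rho> = (c1 / (8 * c2)) powr (1 / q)"
  have \<rho>q: "\<rho> powr q = c1 / (8 * c2)" using c c2 q by (simp add: \<rho>_def powr_powr)
  have \<rho>: "0 < \<rho>" "\<rho> \<le> 1"
  proof -
    show "0 < \<rho>" using c c2 by (simp add: \<rho>_def)
    have "(c1 / (8 * c2)) powr (1 / q) \<le> 1 powr (1 / q)"
      using c c2 q by (intro powr_mono2) (auto simp: field_simps)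
    then show "\<rho> \<le> 1" by (simp add: \<rho>_def)
  qed
  \<comment> \<open>A lower bound for \<open>s powr p\<close> with \<open>s\<close> in
    [\<rho>/2, 1], for either sign of \<open>p\<close>.\<close>
  define m where "m = min 1 ((\<rho> / 2) powr p)"
  have m: "0 < m" "m \<le> 1" using \<rho> by (auto simp: m_def)
  have dp: "m * u powr p \<le> d powr p" if "0 < u" "\<rho> / 2 * u \<le> d" "d \<le> u" for d u
  proof -
    have d: "0 < d" using that \<rho> by (smt (verit) divide_pos_pos mult_pos_pos)
    define s where "s = d / u"
    have s: "\<rho> / 2 \<le> s" "s \<le> 1" "0 < s" "d = s * u" using that d by (auto simp: s_def field_simps)
    have "m \<le> s powr p"
    proof (cases "0 \<le> p")
      case True
      then have "(\<rho> / 2) powr p \<le> s powr p" using s \<rho> by (intro powr_mono2) auto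
      then show ?thesis by (simp add: m_def)
    next
      case False
      then have "1 powr p \<le> s powr p" using s by (intro powr_mono2') auto
      then show ?thesis by (simp add: m_def)
    qed
    then show ?thesis using s that(1) by (simp add: powr_mult mult_right_mono)
  qed
  define c8 where "c8 = q * c1 / (2 * c2)"
  have c8: "0 < c8" using q c c2 by (simp add: c8_def)
  \<comment> \<open>The fall takes at most \<open>sqrt (2 * u / \<kappa>)\<close> with
    \<open>\<kappa> = m * c8 / (2 * u)\<close>, which is \<open>sqrt (4 / (m * c8)) * u\<close>; the
    factor \<open>4 / \<rho>\<close> converts \<open>u\<close> into the scale
    \<open>\<eta> = \<rho> * u / 4\<close>.\<close>
  define L where "L = sqrt (4 / (m * c8)) * (4 / \<rho>)"
  have L: "0 < L" using m c8 \<rho> by (simp add: L_def)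
  show ?thesis
  proof (rule exI[of _ L], intro conjI L allI impI)
    fix \<eta>0 :: real assume "0 < \<eta>0"
    \<comment> \<open>A cap on the amplitude. Its last entry forces \<open>\<kappa>\<close> to be at
      least 2, so that half of the restoring force absorbs the linear term \<open>y\<close>.\<close>
    define u0 where "u0 = min \<eta>0 (min (1 / 4) (m * c8 / 4))"
    have u0: "0 < u0" "u0 \<le> \<eta>0" "u0 \<le> 1 / 4" "u0 \<le> m * c8 / 4"
      using \<open>0 < \<eta>0\<close> m c8 by (auto simp: u0_def)
    \<comment> \<open>The potential energy at distance \<open>u0\<close> from 1 becomes at least 2,
      which makes \<open>Q\<close> nonpositive there: both turning points lie within
      \<open>u0\<close> of 1.\<close>
    define A where "A = 2 * q / (c1 * u0 powr q)"
    have A: "0 < A" "A * (c1 / q * u0 powr q) = 2"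
      using q c u0 by (auto simp: A_def)
    define Q where "Q y = y\<^sup>2 + 0 - 2 * (A * M0 y)" for y
    have Qcont: "continuous_on S Q" for S
      unfolding Q_def by (intro continuous_intros continuous_on_subset[OF Mcont]) auto
    have AM: "A * (c1 / q * \<bar>y - 1\<bar> powr q) \<le> A * M0 y" "A * M0 y \<le> A * (c2 / q * \<bar>y - 1\<bar> powr q)" if "y \<in> {1/2..3/2}" for y
      using mult_left_mono[OF Mb(1)[OF that] less_imp_le[OF A(1)]] mult_left_mono[OF Mb(2)[OF that] less_imp_le[OF A(1)]] .
    have Qfar: "Q (1 + u0) \<le> 0" "Q (1 - u0) \<le> 0"
    proof -
      have "(1 + u0)\<^sup>2 \<le> 4" "(1 - u0)\<^sup>2 \<le> 1"
        using power_mono[of "1 + u0" 2 2] power_mono[of "1 - u0" 1 2] u0 by simp_all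
      moreover have "A * (c1 / q * u0 powr q) \<le> A * M0 (1 + u0)" "A * (c1 / q * u0 powr q) \<le> A * M0 (1 - u0)"
        using AM(1)[of "1 + u0"] AM(1)[of "1 - u0"] u0 by auto
      ultimately show "Q (1 + u0) \<le> 0" "Q (1 - u0) \<le> 0" using A(2) by (auto simp: Q_def)
    qed
    have Q1: "Q 1 = 1" by (simp add: Q_def M1)
    obtain \<beta> where \<beta>: "1 < \<beta>" "\<beta> \<le> 1 + u0" "Q \<beta> = 0" "\<And>y. 1 \<le> y \<Longrightarrow> y < \<beta> \<Longrightarrow> 0 < Q y"
      using first_crossing[of 1 "1 + u0" Q 0] Qcont Qfar(1) Q1 u0 by auto
    \<comment> \<open>The lower turning point is the first crossing of the reflected function,
      walking down from 1.\<close>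
    obtain a where a: "-1 < a" "a \<le> u0 - 1" "Q (- a) = 0" "\<And>y. -1 \<le> y \<Longrightarrow> y < a \<Longrightarrow> 0 < Q (- y)"
    proof -
      have "continuous_on {-1..u0 - 1} (\<lambda>y. Q (- y))"
        by (intro continuous_on_compose2[OF Qcont[of UNIV]] continuous_intros) auto
      then show ?thesis
        using first_crossing[of "-1" "u0 - 1" "\<lambda>y. Q (- y)" 0] that Qfar(2) Q1 u0 by auto
    qed
    define \<alpha> where "\<alpha> = - a"
    have \<alpha>: "\<alpha> < 1" "1 - u0 \<le> \<alpha>" "Q \<alpha> = 0" "\<And>y. \<alpha> < y \<Longrightarrow> y \<le> 1 \<Longrightarrow> 0 < Q y"
      using a(1,2,3) a(4)[of "- y" for y] by (auto simp: \<alpha>_def)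
    have rng34: "3 / 4 \<le> \<alpha>" "\<beta> \<le> 5 / 4" "\<alpha> < \<beta>" using \<alpha> \<beta> u0 by auto
    have in_rng: "y \<in> {1/2..3/2}" if "y \<in> {\<alpha>..\<beta>}" for y using that rng34 by auto
    have Qpos: "0 < Q y" if "\<alpha> < y" "y < \<beta>" for y
      using \<alpha>(4)[of y] \<beta>(4)[of y] that by linarith
    have DQ: "DERIV Q y :> 2 * (y - A * h0 y)" if "y \<in> {\<alpha>..\<beta>}" "y \<noteq> 1" for y
      unfolding Q_def using DM[OF in_rng[OF that(1)] that(2)] by (auto intro!: derivative_eq_intros)
    have DQw: "(Q has_real_derivative 2 * (y - A * h0 y)) (at y within {\<alpha>..\<beta>})" if "y \<in> {\<alpha>..\<beta>}" "y \<noteq> 1" for y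
      using DQ[OF that] by (rule has_field_derivative_at_within)
    define u where "u = \<beta> - 1"
    have u: "0 < u" "u \<le> u0" using \<beta> by (auto simp: u_def)
    have \<rho>u: "\<rho> * u \<le> u" "0 < \<rho> * u" using \<rho> u mult_right_mono[of \<rho> 1 u] by auto
    have \<beta>2: "2 * (A * M0 \<beta>) = \<beta>\<^sup>2" using \<beta>(3) by (simp add: Q_def)
    have \<beta>sq: "1 \<le> \<beta>\<^sup>2" "\<beta>\<^sup>2 \<le> 2"
    proof -
      show "1 \<le> \<beta>\<^sup>2" using \<beta>(1) by simp
      have "\<beta>\<^sup>2 \<le> (5 / 4)\<^sup>2" using rng34 \<beta>(1) by (intro power_mono) auto
      then show "\<beta>\<^sup>2 \<le> 2" by (simp add: power2_eq_square)
    qed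
    have Au: "1 \<le> 2 * (A * (c2 / q * u powr q))" "A * (c1 / q * u powr q) \<le> 1"
    proof -
      have "\<bar>\<beta> - 1\<bar> = u" using u(1) by (simp add: u_def)
      moreover have "\<beta> \<in> {1/2..3/2}" using in_rng rng34 by auto
      ultimately have "A * (c1 / q * u powr q) \<le> A * M0 \<beta>" "A * M0 \<beta> \<le> A * (c2 / q * u powr q)"
        using AM[of \<beta>] by auto
      then show "1 \<le> 2 * (A * (c2 / q * u powr q))" "A * (c1 / q * u powr q) \<le> 1"
        using \<beta>2 \<beta>sq by linarith+
    qed
    have h_ge: "m * c8 / u \<le> A * h0 y" if "\<rho> / 2 * u \<le> y - 1" "y \<le> \<beta>" for y
    proof -
      have "\<rho> * u \<le> 2 * y - 2" using that(1) by simp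
      then have y1: "1 < y" using \<rho>u by linarith
      then have y: "1 < y" "y \<in> {1/2..3/2}" using that(2) rng34 by auto
      have "c8 / u \<le> A * c1 * u powr p"
      proof -
        have "u powr q = u powr p * u" using u(1) by (simp add: q_def powr_add)
        moreover have "1 * c8 \<le> (2 * (A * (c2 / q * u powr q))) * c8" using Au(1) c8 by (intro mult_right_mono) auto
        moreover have "(2 * (A * (c2 / q * u powr q))) * c8 = A * c1 * u powr q"
          using q c2 by (simp add: c8_def field_simps)
        ultimately have "c8 \<le> (A * c1 * u powr p) * u" by simp
        then show ?thesis using u(1) by (simp add: pos_divide_le_eq)
      qed
      then have "m * (c8 / u) \<le> m * (A * c1 * u powr p)" using m by (intro mult_left_mono) auto
      also have "\<dots> = A * c1 * (m * u powr p)" by simp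
      also have "\<dots> \<le> A * c1 * (y - 1) powr p"
        using dp[OF u(1) that(1)] that(2) A c by (intro mult_left_mono) (auto simp: u_def)
      also have "\<dots> \<le> A * h0 y" using hb[OF y(2,1)] A by (simp add: mult.assoc mult_left_mono)
      finally show ?thesis by simp
    qed
    define \<kappa> where "\<kappa> = m * c8 / (2 * u)"
    have \<kappa>: "0 < \<kappa>" using m c8 u by (simp add: \<kappa>_def)
    have acc: "y - A * h0 y \<le> - \<kappa>" if "\<rho> / 2 * u \<le> y - 1" "y \<le> \<beta>" for y
    proof -
      have "2 * u \<le> m * c8 / 2" using u u0(4) by simp
      then have "2 \<le> \<kappa>" using u(1) by (simp add: \<kappa>_def pos_le_divide_eq)
      moreover have "m * c8 / u = 2 * \<kappa>" using u(1) by (simp add: \<kappa>_def field_simps)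
      ultimately show ?thesis using h_ge[OF that] that(2) rng34 by linarith
    qed
    have Qnear: "1 / 4 \<le> Q y" if "\<bar>y - 1\<bar> \<le> \<rho> * u" for y
    proof -
      have "\<bar>y - 1\<bar> \<le> 1 / 4" using that \<rho>u u u0 by linarith
      then have "3 / 4 \<le> y" "y \<le> 3 / 2" by linarith+
      then have y: "3 / 4 \<le> y" "y \<in> {1/2..3/2}" by auto
      have "\<bar>y - 1\<bar> powr q \<le> (\<rho> * u) powr q" using that q by (intro powr_mono2) auto
      also have "\<dots> = c1 / (8 * c2) * u powr q" using \<rho> u by (simp add: powr_mult \<rho>q)
      finally have "A * (c2 / q * \<bar>y - 1\<bar> powr q) \<le> A * (c2 / q * (c1 / (8 * c2) * u powr q))"
        using A c2 q by (intro mult_left_mono) auto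
      also have "\<dots> = (A * (c1 / q * u powr q)) / 8" using c2 by simp
      finally have "A * M0 y \<le> 1 / 8" using AM(2)[OF y(2)] Au(2) by simp
      moreover have "(3 / 4)\<^sup>2 \<le> y\<^sup>2" using y by (intro power_mono) auto
      ultimately show ?thesis by (simp add: Q_def power2_eq_square)
    qed
    have qb: "2 * (\<beta> - A * h0 \<beta>) < 0"
      using acc[of \<beta>] \<kappa> \<rho>u by (simp add: u_def)
    have h_neg: "h0 y \<le> 0" if "y < 1" for y using that by (simp add: h0_def)
    have qa: "0 < 2 * (\<alpha> - A * h0 \<alpha>)"
      using mult_nonneg_nonpos[of A "h0 \<alpha>"] A h_neg[OF \<alpha>(1)] rng34 by simp
    have \<alpha>\<beta>: "\<alpha> \<in> {\<alpha>..\<beta>}" "\<beta> \<in> {\<alpha>..\<beta>}" "\<alpha> \<noteq> 1" "\<beta> \<noteq> 1" using rng34 \<alpha> \<beta> by auto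
    obtain f :: c1fun where uc: "uniformly_continuous_on UNIV (deriv f)"
      and rng: "\<And>x. f x \<in> {\<alpha>..\<beta>}" and sq: "\<And>x. (deriv f x)\<^sup>2 = Q (f x)" and init: "f 0 = \<beta>"
      and DD: "\<And>x q. (Q has_real_derivative q) (at (f x) within {\<alpha>..\<beta>}) \<Longrightarrow> DERIV (deriv f) x :> q / 2"
      by (rule oscillator_c1fun[OF rng34(3) Qcont \<alpha>(3) \<beta>(3) Qpos DQw[OF \<alpha>\<beta>(1,3)] qa DQw[OF \<alpha>\<beta>(2,4)] qb]) (assumption | rule that)+
    have D2: "DERIV (deriv f) x :> f x - A * h0 (f x)" if "f x \<noteq> 1" for x
      using DD[OF DQw[OF rng that]] by (rule DERIV_cong) simp
    have Q2: "Q y \<le> 4" if "y \<in> {\<alpha>..\<beta>}" for y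
    proof -
      have "0 \<le> A * (c1 / q * \<bar>y - 1\<bar> powr q)" using A c q by simp
      then have "0 \<le> A * M0 y" using AM(1)[OF in_rng[OF that]] by simp
      moreover have "y\<^sup>2 \<le> 2\<^sup>2" using that rng34 by (intro power_mono) auto
      ultimately show ?thesis by (simp add: Q_def)
    qed
    have d2: "\<bar>deriv f x\<bar> \<le> 2" for x
      using Q2[OF rng[of x]] abs_le_square_iff[of "deriv f x" 2] by (simp add: sq)
    have wave: "(f x ^ k - 1) * deriv f x = nonlocal_P k b f x" for x
    proof (rule potential_wave[OF k rng, where M = "\<lambda>y. A * M0 y" and h = "\<lambda>y. A * h0 y" and e = 0 and N = "\<lambda>y. A * N0 y"])
      show "(deriv f x)\<^sup>2 = (f x)\<^sup>2 + 0 - 2 * (A * M0 (f x))" for x using sq by (simp add: Q_def)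
      show "A * N0 y = (y ^ k - 1) * (A * h0 y)" if y: "y \<in> {\<alpha>..\<beta>}" "y \<noteq> 1" for y
      proof (cases "1 < y")
        case True
        then have "0 < y ^ k - 1" using k by (simp add: one_less_power)
        then show ?thesis using True by (simp add: N0_def h0_def q_def powr_add)
      next
        case False
        then have "0 < y" "y < 1" using y rng34 by auto
        then have "0 < 1 - y ^ k" using k by (simp add: power_less_one_iff)
        moreover from this have "\<bar>y ^ k - 1\<bar> = 1 - y ^ k" by simp
        ultimately have "N0 y = (1 - y ^ k) powr p * (1 - y ^ k)" by (simp add: N0_def q_def powr_add)
        moreover have "h0 y = - ((1 - y ^ k) powr p)" using \<open>y < 1\<close> by (simp add: h0_def)
        ultimately show ?thesis by (simp only:) (simp add: algebra_simps)
      qed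
      show "A * N0 1 = 0" by (simp add: N0_def)
      show "((\<lambda>y. A * N0 y + (b - real k) * y ^ (k - 1) * (A * M0 y)) has_real_derivative
        (real k - 1) * (b - real k) * y ^ (k - 2) * (A * M0 y)) (at y within {\<alpha>..\<beta>})" if "y \<in> {\<alpha>..\<beta>}" for y
      proof -
        have "((\<lambda>y. A * (N0 y + (b - real k) * y ^ (k - 1) * M0 y)) has_real_derivative
          A * ((real k - 1) * (b - real k) * y ^ (k - 2) * M0 y)) (at y within {\<alpha>..\<beta>})"
          by (intro DERIV_cmult has_field_derivative_subset[OF DN[OF in_rng[OF that]]]) (use in_rng in auto)
        then show ?thesis by (simp add: algebra_simps)
      qed
    qed (use D2 in auto)
    \<comment> \<open>Slopes are at most 2, so within time \<open>\<eta>\<close> the height changes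
      by at most \<open>\<rho> * u / 2\<close>. Starting from 1 or from
      \<open>1 + \<rho> * u / 2\<close> it stays in the steep zone.\<close>
    define \<eta> where "\<eta> = \<rho> * u / 4"
    have "4 * \<eta> = \<rho> * u" by (simp add: \<eta>_def)
    then have \<eta>: "0 < \<eta>" "\<eta> \<le> \<eta>0" using \<rho>u u u0 by linarith+
    have lip: "\<bar>f x - f y\<bar> \<le> 2 * \<bar>x - y\<bar>" for x y
      by (rule DERIV_bound_imp_lipschitz[OF c1fun_has_deriv d2])
    have big: "1 / 2 \<le> \<bar>deriv f x\<bar>" if "\<bar>f x - 1\<bar> \<le> \<rho> * u" for x
    proof -
      have "(1 / 2)\<^sup>2 \<le> (deriv f x)\<^sup>2" unfolding sq using Qnear[OF that] by (simp add: power2_eq_square)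
      then show ?thesis using abs_le_square_iff[of "1 / 2" "deriv f x"] by simp
    qed
    \<comment> \<open>Two crossings of the level 1 within \<open>\<eta>\<close> would enclose a
      critical point, by Rolle, and that point would lie in the steep zone.\<close>
    have isolated: "f x \<noteq> 1" if y: "f y = 1" and xy: "x \<noteq> y" "\<bar>x - y\<bar> \<le> \<eta>" for x y
    proof
      assume x: "f x = 1"
      define l r where "l = min x y" and "r = max x y"
      have lr: "l < r" "f l = 1" "f r = 1" "r - l \<le> \<eta>" using x y xy by (auto simp: l_def r_def min_def max_def abs_real_def)
      obtain z where z: "l < z" "z < r" "deriv f z = 0"
        using MVT2[OF lr(1), of f "deriv f"] c1fun_has_deriv lr by auto
      have "\<bar>f z - 1\<bar> \<le> 2 * \<bar>z - l\<bar>" using lip[of z l] lr(2) by simp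
      also have "\<dots> \<le> 2 * \<eta>" using z lr by simp
      also have "\<dots> \<le> \<rho> * u" using \<rho>u by (simp add: \<eta>_def)
      finally show False using big[of z] z(3) by simp
    qed
    \<comment> \<open>Between crossings f'' is bounded on one side: above the level 1 it is at most
      2, below it is nonnegative. So \<open>2 * x - deriv f x\<close> or \<open>deriv f\<close> is
      monotone there; \<open>\<sigma>\<close> records which, and the slope 4 makes one inequality
      cover increments of both signs.\<close>
    have one_side: "\<exists>\<sigma>. \<bar>\<sigma>\<bar> \<le> 1 \<and> (\<forall>x y. c \<le> x \<longrightarrow> x \<le> y \<longrightarrow> y \<le> d \<longrightarrow>
      \<bar>deriv f y - deriv f x\<bar> \<le> 4 * (y - x) + \<sigma> * (deriv f y - deriv f x))"
      if ne: "\<And>x. c < x \<Longrightarrow> x < d \<Longrightarrow> f x \<noteq> 1" for c d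
    proof -
      have "(\<forall>x. c < x \<longrightarrow> x < d \<longrightarrow> 1 < f x) \<or> (\<forall>x. c < x \<longrightarrow> x < d \<longrightarrow> f x < 1)"
      proof (rule ccontr)
        assume "\<not> ?thesis"
        then obtain x y where xy: "c < x" "x < d" "f x \<le> 1" "c < y" "y < d" "1 \<le> f y" by (auto simp: not_less)
        have "\<exists>z. min x y \<le> z \<and> z \<le> max x y \<and> f z = 1"
        proof (cases "x \<le> y")
          case True
          then show ?thesis using IVT'[of f x 1 y] xy c1fun_continuous by auto
        next
          case False
          then show ?thesis using IVT2'[of f x 1 y] xy c1fun_continuous by auto
        qed
        then show False using ne xy by (metis less_le_trans le_less_trans max_less_iff_conj min_less_iff_conj)
      qed
      then show ?thesis
      proof
        assume gt: "\<forall>x. c < x \<longrightarrow> x < d \<longrightarrow> 1 < f x"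
        have "2 * x - deriv f x \<le> 2 * y - deriv f y" if xy: "c \<le> x" "x \<le> y" "y \<le> d" for x y
        proof (rule DERIV_nonneg_imp_increasing_open[OF xy(2)])
          fix z assume "x < z" "z < y"
          then have z: "1 < f z" using gt xy by auto
          have "0 < f z ^ k - 1" using z k by (simp add: one_less_power)
          then have "0 < h0 (f z)" using z by (simp add: h0_def)
          then have "0 < A * h0 (f z)" using A(1) by simp
          moreover have "f z \<le> 2" using rng[of z] rng34 by simp
          ultimately have "0 \<le> 2 - (f z - A * h0 (f z))" by linarith
          then show "\<exists>e. DERIV (\<lambda>x. 2 * x - deriv f x) z :> e \<and> 0 \<le> e"
            using D2[of z] z by (intro exI[of _ "2 - (f z - A * h0 (f z))"] conjI) (auto intro!: derivative_eq_intros)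
        qed (intro continuous_intros c1fun_deriv_continuous)
        then show ?thesis by (intro exI[of _ "-1"]) force
      next
        assume lt: "\<forall>x. c < x \<longrightarrow> x < d \<longrightarrow> f x < 1"
        have "deriv f x \<le> deriv f y" if xy: "c \<le> x" "x \<le> y" "y \<le> d" for x y
        proof (rule DERIV_nonneg_imp_increasing_open[OF xy(2)])
          fix z assume "x < z" "z < y"
          then have z: "f z < 1" using lt xy by auto
          have "A * h0 (f z) \<le> 0" using h_neg[OF z] A by (intro mult_nonneg_nonpos) auto
          then have "0 \<le> f z - A * h0 (f z)" using rng[of z] rng34 by simp
          then show "\<exists>e. DERIV (deriv f) z :> e \<and> 0 \<le> e"
            using D2[of z] z by auto
        qed (rule c1fun_deriv_continuous)
        then show ?thesis by (intro exI[of _ 1]) force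
      qed
    qed
    have bv: "locally_bv \<eta> (4 * \<eta> + 8) (deriv f)"
      unfolding locally_bv_def
    proof
      fix a :: real
      obtain z where z: "a \<le> z" "z \<le> a + \<eta>" "\<And>x. a \<le> x \<Longrightarrow> x \<le> a + \<eta> \<Longrightarrow> x \<noteq> z \<Longrightarrow> f x \<noteq> 1"
      proof (cases "\<exists>z. a \<le> z \<and> z \<le> a + \<eta> \<and> f z = 1")
        case True
        then obtain z where z: "a \<le> z" "z \<le> a + \<eta>" "f z = 1" by blast
        then show ?thesis by (intro that[of z] isolated) auto
      next
        case False
        then show ?thesis using \<eta>(1) by (intro that[of a]) auto
      qed
      obtain \<sigma>1 where s1: "\<bar>\<sigma>1\<bar> \<le> 1" "\<And>x y. a \<le> x \<Longrightarrow> x \<le> y \<Longrightarrow> y \<le> z \<Longrightarrow>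
          \<bar>deriv f y - deriv f x\<bar> \<le> 4 * (y - x) + \<sigma>1 * (deriv f y - deriv f x)"
        using one_side[of a z] z by auto
      obtain \<sigma>2 where s2: "\<bar>\<sigma>2\<bar> \<le> 1" "\<And>x y. z \<le> x \<Longrightarrow> x \<le> y \<Longrightarrow> y \<le> a + \<eta> \<Longrightarrow>
          \<bar>deriv f y - deriv f x\<bar> \<le> 4 * (y - x) + \<sigma>2 * (deriv f y - deriv f x)"
        using one_side[of z "a + \<eta>"] z by auto
      \<comment> \<open>A window of length \<open>\<eta>\<close> contains at most one crossing
        \<open>z\<close>. The two one-sided dominating functions are glued there, normalised to
        agree at \<open>z\<close>; each deviates from \<open>4 * x\<close> by at most 4.\<close>
      define W where "W x = 4 * x + (if x \<le> z then \<sigma>1 * (deriv f x - deriv f z) else \<sigma>2 * (deriv f x - deriv f z))" for x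
      have Wb: "\<bar>W x - 4 * x\<bar> \<le> 4" for x
      proof -
        have *: "\<bar>deriv f x - deriv f z\<bar> \<le> 4" using d2[of x] d2[of z] by linarith
        have "\<bar>\<sigma>\<bar> * \<bar>deriv f x - deriv f z\<bar> \<le> 1 * 4" if "\<bar>\<sigma>\<bar> \<le> 1" for \<sigma> :: real
          using that * by (intro mult_mono) auto
        then show ?thesis using s1(1) s2(1) by (simp add: W_def abs_mult)
      qed
      have W1: "\<bar>deriv f y - deriv f x\<bar> \<le> W y - W x" if "a \<le> x" "x \<le> y" "y \<le> z" for x y
        using s1(2)[OF that] that by (simp add: W_def algebra_simps)
      have Wz: "W x = 4 * x + \<sigma>2 * (deriv f x - deriv f z)" if "z \<le> x" for x
        using that by (auto simp: W_def)
      have W2: "\<bar>deriv f y - deriv f x\<bar> \<le> W y - W x" if "z \<le> x" "x \<le> y" "y \<le> a + \<eta>" for x y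
        using s2(2)[OF that] Wz[of x] Wz[of y] that by (simp add: algebra_simps)
      have "\<bar>deriv f y - deriv f x\<bar> \<le> W y - W x" if xy: "a \<le> x" "x \<le> y" "y \<le> a + \<eta>" for x y
      proof -
        consider "y \<le> z" | "z \<le> x" | "x \<le> z" "z \<le> y" by linarith
        then show ?thesis
        proof cases
          case 3
          have "\<bar>deriv f y - deriv f x\<bar> \<le> \<bar>deriv f y - deriv f z\<bar> + \<bar>deriv f z - deriv f x\<bar>" by linarith
          also have "\<dots> \<le> (W y - W z) + (W z - W x)" using 3 xy by (intro add_mono W1 W2) auto
          finally show ?thesis by simp
        qed (use xy W1 W2 in auto)
      qed
      moreover have "W (a + \<eta>) - W a \<le> 4 * \<eta> + 8"
        using Wb[of "a + \<eta>"] Wb[of a] unfolding distrib_left by linarith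
      ultimately show "\<exists>W. W (a + \<eta>) - W a \<le> 4 * \<eta> + 8 \<and>
        (\<forall>x y. a \<le> x \<longrightarrow> x \<le> y \<longrightarrow> y \<le> a + \<eta> \<longrightarrow> \<bar>deriv f y - deriv f x\<bar> \<le> W y - W x)"
        by blast
    qed
    have prof: "wave_profile k b f"
      unfolding wave_profile_def using uc bv wave \<eta>(1) by blast
    have d0: "deriv f 0 = 0" using sq[of 0] init \<beta>(3) by simp
    \<comment> \<open>The fall is followed only down to \<open>1 + \<rho> * u / 2\<close>, since the
      force may degenerate at the level 1: for \<open>b < 0\<close> it tends to 0 there.\<close>
    define v where "v = u - \<rho> / 2 * u"
    have v: "0 < v" "v \<le> u" using \<rho>u u by (auto simp: v_def)
    obtain x1 where x1: "0 < x1" "x1 \<le> sqrt (2 * v / \<kappa>)" "f x1 = \<beta> - v" "deriv f x1 < 0"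
    proof (rule descent_time[OF c1fun_has_deriv d0 init v(1) \<kappa>])
      show "f x \<le> \<beta>" for x using rng[of x] by simp
      show "\<exists>d. DERIV (deriv f) x :> d \<and> d \<le> - \<kappa>" if "\<beta> - v \<le> f x" for x
      proof -
        have *: "\<rho> / 2 * u \<le> f x - 1" using that by (simp add: v_def u_def)
        have "f x \<noteq> 1" using * \<rho>u by auto
        then show ?thesis using D2 acc[OF *] rng[of x] by auto
      qed
    qed
    have "2 * v / \<kappa> \<le> 2 * u / \<kappa>" using v \<kappa> by (intro divide_right_mono) auto
    also have "\<dots> = 4 / (m * c8) * u\<^sup>2" using u m c8 by (simp add: \<kappa>_def power2_eq_square)
    finally have "sqrt (2 * v / \<kappa>) \<le> sqrt (4 / (m * c8) * u\<^sup>2)" by (rule real_sqrt_le_mono)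
    also have "\<dots> = sqrt (4 / (m * c8)) * u"
      unfolding real_sqrt_mult[of "4 / (m * c8)" "u\<^sup>2"] using u by simp
    also have "\<dots> = L * \<eta>" using \<rho> by (simp add: L_def \<eta>_def)
    finally have x1L: "x1 \<le> L * \<eta>" using x1(2) by simp
    have slope: "1 / 4 \<le> \<bar>deriv f x\<bar>" if "x \<in> {x1..x1 + \<eta>}" for x
    proof -
      have \<eta>4: "\<rho> * u = 4 * \<eta>" by (simp add: \<eta>_def)
      have "f x1 = 1 + \<rho> * u / 2" using x1(3) by (simp add: v_def u_def)
      then have "f x1 = 1 + 2 * \<eta>" by (simp add: \<eta>4)
      moreover have "\<bar>f x - f x1\<bar> \<le> 2 * \<eta>" using lip[of x x1] that by auto
      ultimately have "\<bar>f x - 1\<bar> \<le> 4 * \<eta>" using \<eta>(1) by linarith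
      then have "\<bar>f x - 1\<bar> \<le> \<rho> * u" by (simp add: \<eta>4)
      then show ?thesis using big[of x] by simp
    qed
    have bd: "\<bar>f x\<bar> \<le> 2" for x using rng[of x] rng34 by auto
    show "\<exists>\<eta> f. 0 < \<eta> \<and> \<eta> \<le> \<eta>0 \<and> steep_wave k b L \<eta> f"
      unfolding steep_wave_def using \<eta> prof bd d2 d0 x1(1) x1L slope
      by (intro exI[of _ \<eta>] exI[of _ f] exI[of _ x1] conjI) (simp_all add: less_imp_le)
  qed
qed

lemma wave_profiles:
  assumes k: "1 \<le> k"
  shows "\<exists>L>0. \<forall>\<eta>0>0. \<exists>\<eta> f. 0 < \<eta> \<and> \<eta> \<le> \<eta>0 \<and> steep_wave k b L \<eta> f"
proof (cases "b < real k")
  case True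
  then show ?thesis by (rule crossing_waves[OF k])
next
  case False
  then have "real k \<le> b" by simp
  from bounce_waves[OF k this] show ?thesis by (intro exI[of _ 1]) simp
qed

section \<open>Travelling waves\<close>

lift_definition c1fun_shift :: "real \<Rightarrow> c1fun \<Rightarrow> c1fun" is "\<lambda>s f x. f (x - s)"
proof -
  fix s :: real and f :: "real \<Rightarrow> real"
  assume f: "(\<forall>x. f differentiable (at x)) \<and> continuous_on UNIV (deriv f) \<and>
      bounded (range f) \<and> bounded (range (deriv f))"
  have D: "DERIV (\<lambda>x. f (x - s)) x :> deriv f (x - s)" for x
  proof -
    have "DERIV f (x - s) :> deriv f (x - s)"
      using f real_differentiable_imp_DERIV by blast
    then have "DERIV (\<lambda>x. f (x - s)) x :> deriv f (x - s) * 1"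
      by (rule DERIV_chain2) (auto intro!: derivative_eq_intros)
    then show ?thesis by simp
  qed
  have d: "deriv (\<lambda>x. f (x - s)) = (\<lambda>x. deriv f (x - s))"
    using D DERIV_imp_deriv by blast
  have "continuous_on UNIV (\<lambda>x. deriv f (x - s))"
    by (rule continuous_on_compose2[of UNIV "deriv f"]) (use f in \<open>auto intro!: continuous_intros\<close>)
  moreover have "bounded (range (\<lambda>x. g (x - s)))" if "bounded (range g)" for g :: "real \<Rightarrow> real"
    using that by (rule bounded_subset) auto
  ultimately show "(\<forall>x. (\<lambda>x. f (x - s)) differentiable (at x)) \<and> continuous_on UNIV (deriv (\<lambda>x. f (x - s))) \<and>
      bounded (range (\<lambda>x. f (x - s))) \<and> bounded (range (deriv (\<lambda>x. f (x - s))))"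
    using f D unfolding d by (auto simp: real_differentiable_def)
qed

declare scaleR_c1fun.rep_eq [simp del]

lemma c1fun_scaleR_apply: "apply_c1fun (a *\<^sub>R f) x = a * f x"
  by (simp add: scaleR_c1fun.rep_eq)

lemma c1fun_shift_apply: "apply_c1fun (c1fun_shift s f) x = f (x - s)"
  by (simp add: c1fun_shift.rep_eq)

lemma deriv_c1fun_shift: "deriv (apply_c1fun (c1fun_shift s f)) x = deriv f (x - s)"
proof -
  have "DERIV (\<lambda>x. f (x - s)) x :> deriv f (x - s) * 1"
    by (rule DERIV_chain2[OF c1fun_has_deriv]) (auto intro!: derivative_eq_intros)
  then show ?thesis
    by (simp add: c1fun_shift.rep_eq[abs_def] DERIV_imp_deriv)
qed

lemma deriv_c1fun_scaleR: "deriv (apply_c1fun (a *\<^sub>R f)) x = a * deriv f x"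
proof -
  have "DERIV (\<lambda>x. a * f x) x :> a * deriv f x"
    by (intro DERIV_cmult c1fun_has_deriv)
  then show ?thesis
    by (simp add: scaleR_c1fun.rep_eq[abs_def] DERIV_imp_deriv)
qed

lemma norm_c1fun_le:
  assumes "\<And>x. \<bar>apply_c1fun f x\<bar> \<le> A" "\<And>x. \<bar>deriv (apply_c1fun f) x\<bar> \<le> B"
  shows "norm f \<le> A + B"
  unfolding norm_c1fun_def by (intro add_mono cSUP_least) (use assms in auto)

text \<open>Translation is not continuous on all of C^1. Values are Lipschitz under translation in
  any case; the slopes need the uniform continuity assumed here.\<close>

lemma continuous_on_c1fun_shift:
  assumes uc: "uniformly_continuous_on UNIV (deriv (apply_c1fun f))"
  shows "continuous_on UNIV (\<lambda>s. c1fun_shift s f)"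
  unfolding continuous_on_iff
proof (intro ballI allI impI)
  fix s e :: real assume "0 < e"
  then obtain d where d: "0 < d" "\<And>x y. \<bar>y - x\<bar> < d \<Longrightarrow> \<bar>deriv f y - deriv f x\<bar> < e / 3"
    using uc unfolding uniformly_continuous_on_def dist_real_def by (metis UNIV_I divide_pos_pos zero_less_numeral)
  define n where "n = norm f + 1"
  have n: "0 < n" by (simp add: n_def add_nonneg_pos)
  define d' where "d' = min d (e / (3 * n))"
  have "0 < d'" using d(1) \<open>0 < e\<close> n by (simp add: d'_def)
  moreover have "dist (c1fun_shift s' f) (c1fun_shift s f) < e" if "dist s' s < d'" for s'
  proof -
    have "norm (c1fun_shift s' f - c1fun_shift s f) \<le> e / 3 + e / 3"
    proof (rule norm_c1fun_le)
      fix x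
      have "\<bar>f (x - s') - f (x - s)\<bar> \<le> norm f * \<bar>(x - s') - (x - s)\<bar>"
        by (rule DERIV_bound_imp_lipschitz[OF c1fun_has_deriv c1fun_abs_le_norm(2)])
      also have "\<dots> \<le> n * (e / (3 * n))"
        using that n by (intro mult_mono) (auto simp: d'_def n_def dist_real_def)
      also have "\<dots> = e / 3" using n by simp
      finally show "\<bar>apply_c1fun (c1fun_shift s' f - c1fun_shift s f) x\<bar> \<le> e / 3"
        by (simp add: apply_c1fun_diff c1fun_shift_apply c1fun_scaleR_apply)
      show "\<bar>deriv (apply_c1fun (c1fun_shift s' f - c1fun_shift s f)) x\<bar> \<le> e / 3"
        using d(2)[of "x - s'" "x - s"] that abs_minus_commute[of s s']
        by (simp add: deriv_c1fun_diff deriv_c1fun_shift d'_def dist_real_def less_imp_le)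
    qed
    then show ?thesis using \<open>0 < e\<close> by (simp add: dist_norm)
  qed
  ultimately show "\<exists>d>0. \<forall>s'\<in>UNIV. dist s' s < d \<longrightarrow> dist (c1fun_shift s' f) (c1fun_shift s f) < e"
    by blast
qed

lemma c1fun_shift_has_vector_derivative:
  assumes uc: "uniformly_continuous_on UNIV (deriv (apply_c1fun f))"
  shows "((\<lambda>s. c1_val (c1fun_shift s f)) has_vector_derivative - c1_deriv (c1fun_shift s f)) (at s)"
  unfolding has_vector_derivative_def has_derivative_at_alt
proof (intro conjI allI impI bounded_linear_scaleR_left)
  fix e :: real assume "0 < e"
  then obtain d where d: "0 < d" "\<And>x y. \<bar>y - x\<bar> < d \<Longrightarrow> \<bar>deriv f y - deriv f x\<bar> < e"
    using uc unfolding uniformly_continuous_on_def dist_real_def by (metis UNIV_I)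
  have "norm (c1_val (c1fun_shift s' f) - c1_val (c1fun_shift s f) - (s' - s) *\<^sub>R - c1_deriv (c1fun_shift s f)) \<le> e * norm (s' - s)"
    if s': "norm (s' - s) < d" for s'
  proof (rule norm_bound)
    fix x
    have "\<bar>(f (x - s') + (s' - s) * deriv f (x - s)) - f (x - s)\<bar> \<le> e * \<bar>s' - s\<bar>"
    proof (cases "s' = s")
      case False
      \<comment> \<open>The linear correction turns the remainder into an increment of
        \<open>g\<close>, whose derivative is a difference of slopes at nearby points.\<close>
      define g where "g \<sigma> = f (x - \<sigma>) + \<sigma> * deriv f (x - s)" for \<sigma>
      have Dg: "DERIV g \<sigma> :> - deriv f (x - \<sigma>) + deriv f (x - s)" for \<sigma>
      proof -
        have "DERIV (\<lambda>\<sigma>. f (x - \<sigma>)) \<sigma> :> deriv f (x - \<sigma>) * (- 1)"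
          by (rule DERIV_chain2[OF c1fun_has_deriv]) (auto intro!: derivative_eq_intros)
        then show ?thesis unfolding g_def by (auto intro!: derivative_eq_intros)
      qed
      have "norm (g s' - g s) \<le> e * norm (s' - s)"
      proof (rule field_differentiable_bound[of "closed_segment s s'"])
        fix z assume z: "z \<in> closed_segment s s'"
        show "(g has_real_derivative - deriv f (x - z) + deriv f (x - s)) (at z within closed_segment s s')"
          by (rule has_field_derivative_at_within[OF Dg])
        have "\<bar>z - s\<bar> < d" using z s' by (auto simp: closed_segment_eq_real_ivl split: if_splits)
        then show "norm (- deriv f (x - z) + deriv f (x - s)) \<le> e"
          using d(2)[of "x - s" "x - z"] by (simp add: abs_minus_commute)
      qed auto
      then show ?thesis by (simp add: g_def algebra_simps)
    qed simp
    then show "norm (apply_bcontfun (c1_val (c1fun_shift s' f) - c1_val (c1fun_shift s f) - (s' - s) *\<^sub>R - c1_deriv (c1fun_shift s f)) x) \<le> e * norm (s' - s)"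
      by (simp add: apply_c1_val apply_c1_deriv c1fun_shift_apply c1fun_scaleR_apply deriv_c1fun_shift algebra_simps)
  qed
  then show "\<exists>d>0. \<forall>y. norm (y - s) < d \<longrightarrow>
      norm (c1_val (c1fun_shift y f) - c1_val (c1fun_shift s f) - (y - s) *\<^sub>R - c1_deriv (c1fun_shift s f)) \<le> e * norm (y - s)"
    using d(1) by blast
qed

section \<open>Translation and scaling of the nonlocal term, and the resulting solutions\<close>

lemma helmholtz_inv_shift: "helmholtz_inv (\<lambda>y. a * h (y - s)) x = a * helmholtz_inv h (x - s)"
proof -
  have "helmholtz_inv (\<lambda>y. a * h (y - s)) x = (LINT y|lborel. a * (1 / 2 * exp (- \<bar>(x - s) - y\<bar>) * h y))"
    unfolding helmholtz_inv_def
    using lborel_integral_real_affine[of 1 "\<lambda>y. 1 / 2 * exp (- \<bar>x - y\<bar>) * (a * h (y - s))" s]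
    by (simp add: algebra_simps)
  then show ?thesis by (simp add: helmholtz_inv_def)
qed

lemma deriv_helmholtz_inv_shift:
  assumes h: "continuous_on UNIV h" "\<And>y. \<bar>h y\<bar> \<le> B"
  shows "deriv (helmholtz_inv (\<lambda>y. a * h (y - s))) x = a * deriv (helmholtz_inv h) (x - s)"
proof -
  obtain L R C where LR: "\<And>x. \<bar>L x\<bar> \<le> C" "\<And>x. \<bar>R x\<bar> \<le> C"
    "\<And>x. DERIV L x :> h x - L x" "\<And>x. DERIV R x :> R x - h x"
    "\<And>x. helmholtz_inv h x = (L x + R x) / 2" "\<And>x. deriv (helmholtz_inv h) x = (R x - L x) / 2"
    by (rule helmholtz_inv_split[OF h]) (rule that)
  have "DERIV (helmholtz_inv h) x :> deriv (helmholtz_inv h) x" for x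
    unfolding LR(6) unfolding LR(5)[abs_def] by (auto intro!: derivative_eq_intros LR(3,4))
  then have "DERIV (\<lambda>x. a * helmholtz_inv h (x - s)) x :> a * (deriv (helmholtz_inv h) (x - s) * 1)"
    by (intro DERIV_cmult DERIV_chain2[where f = "helmholtz_inv h"]) (auto intro!: derivative_eq_intros)
  then show ?thesis
    by (simp add: helmholtz_inv_shift[abs_def] DERIV_imp_deriv)
qed

lemma nonlocal_P_scale_shift:
  assumes k: "1 \<le> k"
  shows "nonlocal_P k b (a *\<^sub>R c1fun_shift s f) x = a ^ (k + 1) * nonlocal_P k b f (x - s)"
proof -
  obtain B where B: "\<And>y. \<bar>gch_flux k b (f y) (deriv f y)\<bar> \<le> B" "\<And>y. \<bar>gch_source k b (f y) (deriv f y)\<bar> \<le> B"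
    using gch_densities_bounded_continuous(3)[of k b f] by blast
  obtain j where j: "k = Suc j" using k by (cases k) auto
  have flux: "gch_flux k b (a * p) (a * q) = a ^ (k + 1) * gch_flux k b p q" for p q
    by (simp add: gch_flux_def j power_mult_distrib power2_eq_square algebra_simps)
  have source: "gch_source k b (a * p) (a * q) = a ^ (k + 1) * gch_source k b p q" for p q
  \<comment> \<open>For \<open>k = 1\<close> the truncated exponent destroys the homogeneity of the
    source, but its coefficient is zero.\<close>
  proof (cases j)
    case 0
    then show ?thesis by (simp add: gch_source_def j)
  next
    case (Suc i)
    then show ?thesis
      by (simp add: gch_source_def j power_mult_distrib power2_eq_square power3_eq_cube)
  qed
  show ?thesis
    unfolding nonlocal_P_eq
    by (simp add: deriv_c1fun_scaleR deriv_c1fun_shift c1fun_shift_apply c1fun_scaleR_apply flux source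
        helmholtz_inv_shift[where h = "\<lambda>y. gch_source k b (f y) (deriv f y)"]
        deriv_helmholtz_inv_shift[OF gch_densities_bounded_continuous(1) B(1)] right_diff_distrib)
qed

lemma travelling_wave_solution:
  assumes k: "1 \<le> k" and f: "wave_profile k b f" and T: "0 < T"
  shows "gch_solution k b T (a *\<^sub>R f) (restrict (\<lambda>t. a *\<^sub>R c1fun_shift (a ^ k * t) f) {0..T})"
proof -
  let ?u = "\<lambda>t. a *\<^sub>R c1fun_shift (a ^ k * t) f"
  have uc: "uniformly_continuous_on UNIV (deriv f)" using f by (simp add: wave_profile_def)
  have cont: "continuous_on S ?u" for S
    by (intro continuous_intros continuous_on_compose2[OF continuous_on_c1fun_shift[OF uc]]) auto
  then have contr: "continuous_on {0..T} (restrict ?u {0..T})"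
    by (rule continuous_on_eq) auto
  have "w \<in> mspace (CT_C1 T)" if "w \<in> extensional {0..T}" "continuous_on {0..T} w" for w
    using that compact_imp_bounded[OF compact_continuous_image[OF that(2)]] by (simp add: CT_C1_def)
  then have mem: "restrict ?u {0..T} \<in> mspace (CT_C1 T)"
    using contr by blast
  have init: "restrict ?u {0..T} 0 = a *\<^sub>R f"
  proof -
    have "c1fun_shift 0 f = f" by (rule c1fun_eqI) (simp add: c1fun_shift_apply c1fun_scaleR_apply)
    then show ?thesis using T by simp
  qed
  define v where "v t = - (a ^ k) *\<^sub>R c1_deriv (?u t)" for t
  have vcont: "continuous_on {0..T} v"
  proof -
    have "bounded_linear c1_deriv"
      by (rule bounded_linear_intro[of _ 1]) (auto simp: c1_deriv_add c1_deriv_scaleR norm_c1fun_eq)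
    from bounded_linear.continuous_on[OF this cont] show ?thesis
      unfolding v_def by (intro continuous_intros)
  qed
  have Dv: "((\<lambda>t. c1_val (?u t)) has_vector_derivative v t) (at t)" for t
  proof -
    have "((\<lambda>t. a ^ k * t) has_vector_derivative a ^ k) (at t)"
      unfolding has_real_derivative_iff_has_vector_derivative[symmetric] by (auto intro!: derivative_eq_intros)
    from vector_diff_chain_at[OF this c1fun_shift_has_vector_derivative[OF uc]]
    have "((\<lambda>t. c1_val (c1fun_shift (a ^ k * t) f)) has_vector_derivative a ^ k *\<^sub>R - c1_deriv (c1fun_shift (a ^ k * t) f)) (at t)"
      by (simp add: o_def)
    then have "((\<lambda>t. a *\<^sub>R c1_val (c1fun_shift (a ^ k * t) f)) has_vector_derivative
        a *\<^sub>R (a ^ k *\<^sub>R - c1_deriv (c1fun_shift (a ^ k * t) f))) (at t)"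
      by (rule bounded_linear.has_vector_derivative[OF bounded_linear_scaleR_right])
    then show ?thesis
      by (simp add: v_def c1_val_scaleR c1_deriv_scaleR mult.commute)
  qed
  have eq: "v t x + ?u t x ^ k * deriv (?u t) x = nonlocal_P k b (?u t) x" for t x
  proof -
    define y where "y = x - a ^ k * t"
    have "v t x + ?u t x ^ k * deriv (?u t) x = a ^ (k + 1) * ((f y ^ k - 1) * deriv f y)"
      by (simp add: v_def apply_c1_deriv deriv_c1fun_scaleR deriv_c1fun_shift c1fun_shift_apply c1fun_scaleR_apply y_def
          power_mult_distrib algebra_simps)
    also have "\<dots> = nonlocal_P k b (?u t) x"
      using f by (simp add: wave_profile_def nonlocal_P_scale_shift[OF k] y_def)
    finally show ?thesis .
  qed
  have "((\<lambda>t. c1_val (restrict ?u {0..T} t)) has_vector_derivative v t) (at t within {0..T})" if "t \<in> {0..T}" for t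
    by (rule has_vector_derivative_transform[OF that _ has_vector_derivative_at_within[OF Dv]]) auto
  then show ?thesis
    unfolding gch_solution_def using mem init vcont eq by (intro conjI exI[of _ v] ballI allI) auto
qed

text \<open>Scaling multiplies the variation of the slope by \<open>\<bar>a\<bar>\<close> and
  translation only moves its windows. One bound therefore holds at all times, and
  \<open>gch_solution_unique\<close> resolves the definite description in
  \<open>gch_flow\<close>.\<close>

lemma travelling_wave_flow:
  assumes k: "1 \<le> k" and f: "wave_profile k b f" and T: "0 < T"
  shows "a *\<^sub>R f \<in> gch_data k b T"
    and "gch_flow k b T (a *\<^sub>R f) = restrict (\<lambda>t. a *\<^sub>R c1fun_shift (a ^ k * t) f) {0..T}"
proof -
  let ?u = "restrict (\<lambda>t. a *\<^sub>R c1fun_shift (a ^ k * t) f) {0..T}"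
  obtain l C where l: "0 < l" "locally_bv l C (deriv f)"
    using f by (auto simp: wave_profile_def)
  note sol = travelling_wave_solution[OF k f T, of a]
  have bv: "locally_bv l (\<bar>a\<bar> * C) (deriv (?u t))" if t: "t \<in> {0..T}" for t
    unfolding locally_bv_def
  proof
    fix c
    obtain W where W: "W (c - a ^ k * t + l) - W (c - a ^ k * t) \<le> C"
      "\<And>x y. c - a ^ k * t \<le> x \<Longrightarrow> x \<le> y \<Longrightarrow> y \<le> c - a ^ k * t + l \<Longrightarrow> \<bar>deriv f y - deriv f x\<bar> \<le> W y - W x"
      using l(2) unfolding locally_bv_def by blast
    have "\<bar>deriv (?u t) y - deriv (?u t) x\<bar> \<le> \<bar>a\<bar> * W (y - a ^ k * t) - \<bar>a\<bar> * W (x - a ^ k * t)"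
      if "c \<le> x" "x \<le> y" "y \<le> c + l" for x y
    proof -
      have "\<bar>a\<bar> * \<bar>deriv f (y - a ^ k * t) - deriv f (x - a ^ k * t)\<bar> \<le> \<bar>a\<bar> * (W (y - a ^ k * t) - W (x - a ^ k * t))"
        using that by (intro mult_left_mono W(2)) auto
      then show ?thesis
        using t by (simp add: deriv_c1fun_scaleR deriv_c1fun_shift abs_mult[symmetric] right_diff_distrib)
    qed
    moreover have "\<bar>a\<bar> * W (c + l - a ^ k * t) - \<bar>a\<bar> * W (c - a ^ k * t) \<le> \<bar>a\<bar> * C"
    proof -
      have "c + l - a ^ k * t = c - a ^ k * t + l" by simp
      then show ?thesis
        using mult_left_mono[OF W(1) abs_ge_zero[of a]] by (simp only: right_diff_distrib)
    qed
    ultimately show "\<exists>W. W (c + l) - W c \<le> \<bar>a\<bar> * C \<and>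
        (\<forall>x y. c \<le> x \<longrightarrow> x \<le> y \<longrightarrow> y \<le> c + l \<longrightarrow> \<bar>deriv (?u t) y - deriv (?u t) x\<bar> \<le> W y - W x)"
      by (intro exI[of _ "\<lambda>x. \<bar>a\<bar> * W (x - a ^ k * t)"]) blast
  qed
  have unique: "w = ?u" if "gch_solution k b T (a *\<^sub>R f) w" for w
    by (rule gch_solution_unique[OF sol that l(1) bv])
  then show "a *\<^sub>R f \<in> gch_data k b T"
    unfolding gch_data_def using sol by blast
  show "gch_flow k b T (a *\<^sub>R f) = ?u"
    unfolding gch_flow_def using sol unique by (rule the_equality)
qed

text \<open>A walk from 0 with step \<open>D\<close> reaches the steep interval after
  \<open>m\<close> steps, where \<open>m * D\<close> is at most \<open>(L + 1) * \<eta>\<close>. The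
  slope has gone from 0 to size at least 1/4, so the largest change \<open>S\<close> in one step is
  at least \<open>1 / (4 * m)\<close>.\<close>

lemma wave_drift_separation:
  assumes steep: "steep_wave k b L \<eta> f"
    and D: "0 < D" "D \<le> \<eta>" and S: "\<And>x. \<bar>deriv (apply_c1fun f) (x + D) - deriv (apply_c1fun f) x\<bar> \<le> S"
  shows "D \<le> 4 * (L + 1) * \<eta> * S"
proof -
  obtain x1 where wave: "deriv f 0 = 0" "0 \<le> x1" "x1 \<le> L * \<eta>" "\<forall>x\<in>{x1..x1 + \<eta>}. 1 / 4 \<le> \<bar>deriv f x\<bar>"
    using steep by (auto simp: steep_wave_def)
  \<comment> \<open>The least number of steps that reach \<open>x1\<close>; as a step is at most
    \<open>\<eta>\<close>, the walk cannot jump over the steep interval.\<close>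
  define m where "m = nat \<lceil>x1 / D\<rceil>"
  have "0 \<le> x1 / D" using wave(2) D(1) by simp
  then have m: "x1 / D \<le> real m" "real m < x1 / D + 1"
    unfolding m_def using ceiling_correct[of "x1 / D"] by linarith+
  then have m': "x1 \<le> real m * D" "real m * D \<le> x1 + D"
    using D(1) by (auto simp: field_simps)
  have "\<bar>deriv f (real n * D)\<bar> \<le> real n * S" for n
  proof (induction n)
    case (Suc n)
    have "real (Suc n) * D = real n * D + D" by (simp add: algebra_simps)
    then have "\<bar>deriv f (real (Suc n) * D) - deriv f (real n * D)\<bar> \<le> S" using S[of "real n * D"] by simp
    moreover have "real (Suc n) * S = real n * S + S" by (simp add: algebra_simps)
    ultimately show ?case using Suc by linarith
  qed (simp add: wave(1))
  from this[of m] have "1 / 4 \<le> real m * S"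
    using bspec[OF wave(4), of "real m * D"] m' D(2) by auto
  then have "D * (1 / 4) \<le> D * (real m * S)" using D(1) by (intro mult_left_mono) auto
  moreover have "D * (real m * S) \<le> (L + 1) * \<eta> * S"
  proof -
    have "0 \<le> S" using S[of 0] by linarith
    moreover have "real m * D \<le> (L + 1) * \<eta>" using m'(2) wave(3) D(2) by (simp add: algebra_simps)
    ultimately have "real m * D * S \<le> (L + 1) * \<eta> * S" by (intro mult_right_mono)
    then show ?thesis by (simp add: mult_ac)
  qed
  ultimately have "D \<le> 4 * ((L + 1) * \<eta> * S)" by linarith
  then show ?thesis by (simp only: mult.assoc)
qed

theorem theorem1p1:
  fixes k :: nat and b R T :: real
  assumes "k \<ge> 1" and "R > 0" and "T > 0"
  shows "\<not> uniformly_continuous_map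
             (submetric euclidean_metric (gch_ball k b T R)) (CT_C1 T) (gch_flow k b T) \<and>
         (\<exists>f g :: nat \<Rightarrow> c1fun.
            (\<forall>n. f n \<in> gch_ball k b T R \<and> f n + g n \<in> gch_ball k b T R) \<and>
            (\<exists>C>0. \<forall>n. norm (f n) \<le> C) \<and>
            (\<lambda>n. norm (g n)) \<longlonglongrightarrow> 0 \<and>
            (\<exists>c>0. \<exists>T0>0. T0 \<le> T \<and>
               (\<forall>t\<in>{0<..T0}.
                  liminf (\<lambda>n. ereal (norm (gch_flow k b T (f n + g n) t - gch_flow k b T (f n) t)))
                    \<ge> ereal (c * t))))"
proof -
  have k0: "0 < real k" using assms(1) by simp
  obtain L where L: "0 < L"
    and prof: "\<And>\<eta>0. 0 < \<eta>0 \<Longrightarrow> \<exists>\<eta> f. 0 < \<eta> \<and> \<eta> \<le> \<eta>0 \<and> steep_wave k b L \<eta> f"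
    using wave_profiles[OF assms(1), of b] by blast
  have "\<exists>\<eta> f. 0 < \<eta> \<and> \<eta> \<le> inverse (real (Suc n)) \<and> steep_wave k b L \<eta> f" for n
    by (rule prof) simp
  then obtain \<eta> \<phi> where \<eta>: "\<And>n. 0 < \<eta> n" "\<And>n. \<eta> n \<le> inverse (real (Suc n))"
    and steep: "\<And>n. steep_wave k b L (\<eta> n) (\<phi> n)"
    by metis
  have wave: "wave_profile k b (\<phi> n)"
    and bd: "\<bar>\<phi> n x\<bar> \<le> 2" "\<bar>deriv (\<phi> n) x\<bar> \<le> 2" for n x
    using steep[of n] by (auto simp: steep_wave_def)
  have \<eta>1: "\<eta> n \<le> 1" for n
    using order_trans[OF \<eta>(2)] by (metis inverse_1 le_imp_inverse_le of_nat_0_less_iff of_nat_1 of_nat_le_iff Suc_le_mono le0 One_nat_def zero_less_one)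
  have \<eta>_lim: "\<eta> \<longlonglongrightarrow> 0"
    by (rule tendsto_sandwich[OF _ _ tendsto_const LIMSEQ_inverse_real_of_nat]) (use \<eta> in \<open>auto intro!: always_eventually less_imp_le\<close>)
  have n\<phi>: "norm (\<phi> n) \<le> 4" for n
    using norm_c1fun_le[of "\<phi> n" 2 2] bd by simp
  \<comment> \<open>Profiles have norm at most 4 and the amplitude factor
    \<open>1 + \<eta> n\<close> is at most 2, hence the 8. This fits both data into a ball of any
    radius.\<close>
  define \<epsilon> where "\<epsilon> = min 1 (R / 8)"
  have \<epsilon>: "0 < \<epsilon>" "\<epsilon> * 8 \<le> R" using assms(2) by (auto simp: \<epsilon>_def)
  define f where "f n = \<epsilon> *\<^sub>R \<phi> n" for n
  define g where "g n = (\<epsilon> * \<eta> n) *\<^sub>R \<phi> n" for n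
  have fg: "f n + g n = (\<epsilon> * (1 + \<eta> n)) *\<^sub>R \<phi> n" for n
    by (simp add: f_def g_def algebra_simps)
  have nf: "norm (f n) \<le> \<epsilon> * 4" for n
    using n\<phi>[of n] \<epsilon>(1) by (simp add: f_def)
  have nfg: "norm (f n + g n) \<le> R" for n
  proof -
    have "\<epsilon> * (1 + \<eta> n) * norm (\<phi> n) \<le> \<epsilon> * 2 * 4"
      using n\<phi>[of n] \<epsilon>(1) \<eta>(1)[of n] \<eta>1[of n] by (intro mult_mono) auto
    moreover have "norm (f n + g n) = \<epsilon> * (1 + \<eta> n) * norm (\<phi> n)"
      using \<epsilon>(1) \<eta>(1)[of n] by (simp add: fg abs_mult)
    ultimately show ?thesis using \<epsilon>(2) by linarith
  qed
  have ball: "f n \<in> gch_ball k b T R" "f n + g n \<in> gch_ball k b T R" for n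
  proof -
    have "f n \<in> gch_data k b T" "f n + g n \<in> gch_data k b T"
      unfolding fg unfolding f_def by (rule travelling_wave_flow(1)[OF assms(1) wave assms(3)])+
    moreover have "norm (f n) \<le> R" using nf[of n] \<epsilon> by linarith
    ultimately show "f n \<in> gch_ball k b T R" "f n + g n \<in> gch_ball k b T R"
      using nfg[of n] by (simp_all add: gch_ball_def)
  qed
  have ng: "norm (g n) \<le> \<epsilon> * 4 * \<eta> n" for n
  proof -
    have "norm (g n) = \<epsilon> * \<eta> n * norm (\<phi> n)" using \<epsilon>(1) \<eta>(1)[of n] by (simp add: g_def abs_mult)
    also have "\<dots> \<le> \<epsilon> * \<eta> n * 4" using n\<phi>[of n] \<epsilon>(1) \<eta>(1)[of n] by (intro mult_left_mono) auto
    finally show ?thesis by simp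
  qed
  have g_lim: "(\<lambda>n. norm (g n)) \<longlonglongrightarrow> 0"
  proof (rule tendsto_sandwich[OF _ _ tendsto_const])
    show "(\<lambda>n. \<epsilon> * 4 * \<eta> n) \<longlonglongrightarrow> 0" using tendsto_mult_left[OF \<eta>_lim, of "\<epsilon> * 4"] by simp
  qed (use ng in auto)
  \<comment> \<open>Up to this time the drift is at most \<open>\<eta> n\<close>, the largest step
    allowed in \<open>wave_drift_separation\<close>; \<open>real k * 2 ^ k\<close> comes from the
    upper bound for \<open>(1 + \<eta> n) ^ k - 1\<close>.\<close>
  define T0 where "T0 = min T (1 / (\<epsilon> ^ k * (real k * 2 ^ k)))"
  have \<epsilon>k: "0 < \<epsilon> ^ k" using \<epsilon>(1) by simp
  have T0: "0 < T0" "T0 \<le> T" using assms(3) k0 \<epsilon>k by (auto simp: T0_def)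
  \<comment> \<open>The least drift \<open>\<epsilon> ^ k * real k * t * \<eta> n\<close> over the
    factor \<open>4 * (L + 1) * \<eta> n\<close> of the walk, times the amplitude
    \<open>\<epsilon>\<close>; the scale \<open>\<eta> n\<close> cancels.\<close>
  define c where "c = \<epsilon> * (\<epsilon> ^ k * real k / (4 * (L + 1)))"
  have c: "0 < c" using \<epsilon>(1) \<epsilon>k k0 L by (simp add: c_def)
  have lower: "c * t - 2 * \<epsilon> * \<eta> n \<le> norm (gch_flow k b T (f n + g n) t - gch_flow k b T (f n) t)"
    if t: "t \<in> {0<..T0}" for t n
  proof -
    define N where "N = norm (gch_flow k b T (f n + g n) t - gch_flow k b T (f n) t)"
    define a1 where "a1 = \<epsilon> * (1 + \<eta> n)"
    have tT: "t \<in> {0..T}" using t T0 by auto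
    have flow: "gch_flow k b T (f n + g n) t = a1 *\<^sub>R c1fun_shift (a1 ^ k * t) (\<phi> n)"
      "gch_flow k b T (f n) t = \<epsilon> *\<^sub>R c1fun_shift (\<epsilon> ^ k * t) (\<phi> n)"
      unfolding fg unfolding f_def a1_def using tT
      by (simp_all add: travelling_wave_flow(2)[OF assms(1) wave[of n] assms(3)])
    define D where "D = a1 ^ k * t - \<epsilon> ^ k * t"
    have D_eq: "D = \<epsilon> ^ k * ((1 + \<eta> n) ^ k - 1) * t"
    proof -
      have "a1 ^ k = \<epsilon> ^ k * (1 + \<eta> n) ^ k" by (simp only: a1_def power_mult_distrib)
      then show ?thesis by (simp only: D_def) (simp add: algebra_simps)
    qed
    have low: "real k * \<eta> n \<le> (1 + \<eta> n) ^ k - 1"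
      using Bernoulli_inequality[of "\<eta> n" k] \<eta>(1)[of n] by simp
    have up: "(1 + \<eta> n) ^ k - 1 \<le> real k * 2 ^ k * \<eta> n"
      using abs_power_diff_le[of "1 + \<eta> n" 2 1 k] \<eta>(1)[of n] \<eta>1[of n] by simp
    have D_low: "\<epsilon> ^ k * real k * t * \<eta> n \<le> D"
      unfolding D_eq using mult_left_mono[OF low, of "\<epsilon> ^ k * t"] \<epsilon>k t by (simp add: mult_ac)
    have D_pos: "0 < D"
      by (rule less_le_trans[OF _ D_low]) (use \<epsilon>k k0 t \<eta>(1)[of n] in auto)
    have D_up: "D \<le> \<eta> n"
    proof -
      have "D \<le> \<epsilon> ^ k * (real k * 2 ^ k * \<eta> n) * t"
        unfolding D_eq using up \<epsilon>k t by (intro mult_right_mono mult_left_mono) auto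
      also have "\<dots> = (\<epsilon> ^ k * (real k * 2 ^ k) * t) * \<eta> n" by simp
      also have "\<dots> \<le> 1 * \<eta> n"
      proof (rule mult_right_mono)
        have "\<epsilon> ^ k * (real k * 2 ^ k) * t \<le> \<epsilon> ^ k * (real k * 2 ^ k) * (1 / (\<epsilon> ^ k * (real k * 2 ^ k)))"
          using t \<epsilon>k by (intro mult_left_mono) (auto simp: T0_def)
        then show "\<epsilon> ^ k * (real k * 2 ^ k) * t \<le> 1" using \<epsilon>(1) k0 by simp
      qed (use \<eta>(1)[of n] in simp)
      finally show ?thesis by simp
    qed
    \<comment> \<open>Besides the drift the two waves differ in amplitude; this costs
      \<open>\<eta> n\<close> times the slope bound 2, which vanishes in the limit.\<close>
    have S: "\<bar>deriv (\<phi> n) (x + D) - deriv (\<phi> n) x\<bar> \<le> N / \<epsilon> + 2 * \<eta> n" for x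
    proof -
      \<comment> \<open>Seen at \<open>z\<close>, the faster wave shows its profile at
        \<open>x\<close> and the slower one at \<open>x + D\<close>.\<close>
      define z where "z = x + a1 ^ k * t"
      have "\<bar>deriv (apply_c1fun (gch_flow k b T (f n + g n) t - gch_flow k b T (f n) t)) z\<bar> \<le> N"
        unfolding N_def by (rule c1fun_abs_le_norm(2))
      then have "\<bar>a1 * deriv (\<phi> n) x - \<epsilon> * deriv (\<phi> n) (x + D)\<bar> \<le> N"
        by (simp add: flow deriv_c1fun_diff deriv_c1fun_scaleR deriv_c1fun_shift z_def D_def algebra_simps)
      moreover have "a1 * deriv (\<phi> n) x - \<epsilon> * deriv (\<phi> n) (x + D)
          = \<epsilon> * ((deriv (\<phi> n) x - deriv (\<phi> n) (x + D)) + \<eta> n * deriv (\<phi> n) x)"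
        by (simp add: a1_def algebra_simps)
      ultimately have "\<epsilon> * \<bar>(deriv (\<phi> n) x - deriv (\<phi> n) (x + D)) + \<eta> n * deriv (\<phi> n) x\<bar> \<le> N"
        using \<epsilon>(1) by (simp add: abs_mult)
      then have "\<bar>(deriv (\<phi> n) x - deriv (\<phi> n) (x + D)) + \<eta> n * deriv (\<phi> n) x\<bar> \<le> N / \<epsilon>"
        using \<epsilon>(1) by (simp add: pos_le_divide_eq mult.commute)
      moreover have "\<bar>\<eta> n * deriv (\<phi> n) x\<bar> \<le> \<eta> n * 2"
        unfolding abs_mult using bd(2)[of n x] \<eta>(1)[of n] by (intro mult_mono) auto
      ultimately show ?thesis by linarith
    qed
    have "D \<le> 4 * (L + 1) * \<eta> n * (N / \<epsilon> + 2 * \<eta> n)"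
      by (rule wave_drift_separation[OF steep D_pos D_up S])
    with D_low have "(\<epsilon> ^ k * real k * t) * \<eta> n \<le> (4 * (L + 1) * (N / \<epsilon> + 2 * \<eta> n)) * \<eta> n"
      by (simp add: mult_ac)
    then have "\<epsilon> ^ k * real k * t \<le> 4 * (L + 1) * (N / \<epsilon> + 2 * \<eta> n)"
      using \<eta>(1)[of n] by (rule mult_right_le_imp_le)
    then have "\<epsilon> ^ k * real k * t / (4 * (L + 1)) \<le> N / \<epsilon> + 2 * \<eta> n"
      using L by (simp add: pos_divide_le_eq mult.commute)
    then have "\<epsilon> * (\<epsilon> ^ k * real k * t / (4 * (L + 1))) \<le> \<epsilon> * (N / \<epsilon> + 2 * \<eta> n)"
      using \<epsilon>(1) by (intro mult_left_mono) auto
    moreover have "\<epsilon> * (N / \<epsilon> + 2 * \<eta> n) = N + 2 * \<epsilon> * \<eta> n" using \<epsilon>(1) by (simp add: distrib_left)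
    moreover have "\<epsilon> * (\<epsilon> ^ k * real k * t / (4 * (L + 1))) = c * t" by (simp add: c_def)
    ultimately show ?thesis unfolding N_def by linarith
  qed
  have lim: "(\<lambda>n. c * t - 2 * \<epsilon> * \<eta> n) \<longlonglongrightarrow> c * t" for t
    using tendsto_diff[OF tendsto_const tendsto_mult_left[OF \<eta>_lim, of "2 * \<epsilon>"], of "c * t"] by simp
  have liminf: "ereal (c * t) \<le> liminf (\<lambda>n. ereal (norm (gch_flow k b T (f n + g n) t - gch_flow k b T (f n) t)))"
    if t: "t \<in> {0<..T0}" for t
  proof -
    have "liminf (\<lambda>n. ereal (c * t - 2 * \<epsilon> * \<eta> n)) = ereal (c * t)"
      using lim[of t] by (intro lim_imp_Liminf) (auto simp: tendsto_ereal)
    moreover have "liminf (\<lambda>n. ereal (c * t - 2 * \<epsilon> * \<eta> n))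
        \<le> liminf (\<lambda>n. ereal (norm (gch_flow k b T (f n + g n) t - gch_flow k b T (f n) t)))"
      using lower[OF t] by (intro Liminf_mono always_eventually) auto
    ultimately show ?thesis by simp
  qed
  have "\<not> uniformly_continuous_map (submetric euclidean_metric (gch_ball k b T R)) (CT_C1 T) (gch_flow k b T)"
  proof
    assume uc: "uniformly_continuous_map (submetric euclidean_metric (gch_ball k b T R)) (CT_C1 T) (gch_flow k b T)"
    \<comment> \<open>The single time \<open>T0\<close> suffices: the sup metric dominates the
      distance there, which is eventually above \<open>c * T0 / 2\<close> although the data approach
      each other.\<close>
    have cT: "0 < c * T0 / 2" using c T0 by simp
    then obtain d where d: "0 < d" "\<And>x y. x \<in> gch_ball k b T R \<Longrightarrow> y \<in> gch_ball k b T R \<Longrightarrow> dist y x < d \<Longrightarrow>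
        mdist (CT_C1 T) (gch_flow k b T y) (gch_flow k b T x) < c * T0 / 2"
      using uc unfolding uniformly_continuous_map_def by fastforce
    have "\<forall>\<^sub>F n in sequentially. norm (g n) < d"
      using order_tendstoD(2)[OF g_lim d(1)] .
    moreover have "\<forall>\<^sub>F n in sequentially. c * T0 / 2 < c * T0 - 2 * \<epsilon> * \<eta> n"
      using cT by (intro order_tendstoD(1)[OF lim[of T0]]) linarith
    ultimately have "\<forall>\<^sub>F n in sequentially. False"
    proof eventually_elim
      case (elim n)
      let ?x = "gch_flow k b T (f n + g n)" and ?y = "gch_flow k b T (f n)"
      have mem: "?x \<in> mspace (CT_C1 T)" "?y \<in> mspace (CT_C1 T)"
        using gch_flow_maps[of k b T R] ball[of n] by auto
      have "mdist (CT_C1 T) ?x ?y < c * T0 / 2"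
        using d(2)[OF ball(1)[of n] ball(2)[of n]] elim(1) by (simp add: dist_norm)
      then have "mdist euclidean_metric (?x T0) (?y T0) \<le> c * T0 / 2"
        using mdist_cfunspace_imp_mdist_le[OF mem[unfolded CT_C1_def], of "c * T0 / 2" T0] T0
        by (simp add: CT_C1_def)
      then have "norm (?x T0 - ?y T0) \<le> c * T0 / 2" by (simp add: dist_norm)
      moreover have "c * T0 - 2 * \<epsilon> * \<eta> n \<le> norm (?x T0 - ?y T0)"
        using T0 by (intro lower) auto
      ultimately show False using elim(2) by linarith
    qed
    then show False by simp
  qed
  moreover have "0 < \<epsilon> * 4" using \<epsilon>(1) by simp
  ultimately show ?thesis
    using ball nf g_lim c T0 liminf
    by (intro conjI exI[of _ f] exI[of _ g] exI[of _ c] exI[of _ T0] exI[of _ "\<epsilon> * 4"]) auto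
qed

end
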